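(* Let $\mathbf{A}$ be a finite nilpotent algebra with universe $A$, let $0\in A$, and let $\mathbf{B}$ be a coordinatised extension of $\mathbf{A}$ by Abelian group operations $+,0,-$ (as defined in the context), with $(A,+,0,-)=\prod_{j=1}^s\mathbb{Z}_{p_j}$. Let $m>2$ be the product of the distinct prime divisors of $|A|$, and let $e:(A,+,0,-)\to(\mathbb{Z}_m)^s$ be the natural group embedding. Then there is a $d\in\mathbb{N}$ such that for every circuit $C$ over $\mathbf{B}$ (with inputs $x_1,\ldots,x_k$) there is a $\mathrm{CC}^+[m]$-circuit $C'$ (with $sk$ inputs and $s$ outputs) of essential depth $d$ with $$C'(e(x_1),\ldots,e(x_k))=e\,C(x_1,\ldots,x_k)\quad\text{for all }x_1,\ldots,x_k\in A.$$ Moreover: (1) In general $d\le(\lceil\log_2(s\cdot\mathrm{ar}(\mathbf{B}))\rceil+1)\cdot(\log_2|A|-1)$. (2) If $m$ is not a prime, then $d\le 3(\log_2|A|-1)$. Furthermore $C'$ can be computed from $C$ in linear time.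
   Context: **Algebras.** An algebra $\mathbf{A}=(A,(f_i^{\mathbf{A}})_{i\in I})$ is a set $A$ (universe) with finitary basic operations; its signature records their arities. It is finite if $A$ and $I$ are finite; $\mathrm{ar}(\mathbf{A})$ is the maximal arity of its basic operations. $\mathrm{Pol}(\mathbf{A})$ is the set of polynomial operations of $\mathbf{A}$ (compositions of basic operations and constants from $A$); algebras on the same universe with the same polynomial operations are polynomially equivalent. A circuit over $\mathbf{A}$ is an $A$-valued circuit with a unique output gate, whose gates are labelled by basic operations of $\mathbf{A}$ (or are input gates or constants from $A$). **Nilpotent algebras.** All nilpotent algebras are assumed to be from a congruence modular variety. An algebra $\mathbf{A}=(A,(f^{\mathbf{A}})_{f\in I})$ from a congruence modular variety is $1$-nilpotent (Abelian) if it is polynomially equivalent to a module. It is $n$-nilpotent if there are algebras $\mathbf{L}=(L,(f^{\mathbf{L}})_{f\in I})$, $\mathbf{U}=(U,(f^{\mathbf{U}})_{f\in I})$ in the same signature such that $\mathbf{L}$ is Abelian, $\mathbf{U}$ is $(n-1)$-nilpotent, $A=L\times U$ (up to isomorphism), and every basic operation has the form $f^{\mathbf{A}}((l_1,u_1),\ldots,(l_k,u_k))=(f^{\mathbf{L}}(l_1,\ldots,l_k)+\hat f(u_1,\ldots,u_k),\,f^{\mathbf{U}}(u_1,\ldots,u_k))$ for some function $\hat f:U^k\to L$, where $+$ is the addition of the module polynomially equivalent to $\mathbf{L}$. In this situation write $\mathbf{A}=\mathbf{L}\otimes\mathbf{U}$. Nilpotent means $n$-nilpotent for some $n$. **Coordinatised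 extension.** Given a finite nilpotent algebra $\mathbf{A}$ and $0\in A$, a coordinatised extension of $\mathbf{A}$ is a finite nilpotent algebra $\mathbf{B}$ with the same universe $A$ such that $\mathrm{Pol}(\mathbf{A})\subseteq\mathrm{Pol}(\mathbf{B})$ and $\mathbf{B}=\mathbf{L}_1\otimes(\mathbf{L}_2\otimes(\cdots\otimes\mathbf{L}_n))$, where every $\mathbf{L}_i$ is polynomially equivalent to a module with group $(L_i,+,0,-)=\mathbb{Z}_{q_i}^{k_i}$ and a ring $R\le\mathrm{End}(\mathbb{Z}_{q_i}^{k_i})$ of scalars, for a prime $q_i$ and $k_i\in\mathbb{N}$, and $\mathbf{B}$ contains basic operations $+,0,-$ such that $(A,+,0,-)=\prod_{i=1}^n(L_i,+,0,-)$. (By a known theorem of Aichinger such a $\mathbf{B}$ always exists.) Thus $(A,+,0,-)=\prod_{j=1}^s\mathbb{Z}_{p_j}$ with primes $p_j$ (possibly repeated) and $|A|=\prod_{j=1}^s p_j$. **Embedding.** The natural embedding $e:\prod_{j=1}^s\mathbb{Z}_{p_j}\to(\mathbb{Z}_m)^s$ is given on the $j$-th coordinate by $x\mapsto (m/p_j)\,x$. **$\mathrm{CC}^+[m]$-circuits.** A $\mathrm{CC}^+[m]$-circuit is a circuit over $\mathbb{Z}_m=\{0,\ldots,m-1\}$ containing $+$-gates (addition modulo $m$), constant gates, and $\mathrm{MOD}_m$-gates, of arbitrary fan-in. A $\mathrm{MOD}_m$-gate outputs $1$ if its inputs sum up to $0$ modulo $m$, and $0$ otherwise. Parallel wires are allowed.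 The essential depth of a $\mathrm{CC}^+[m]$-circuit is its depth, not counting its $+$-gates. *)

theory Defs
  imports Complex_Main "HOL-Computational_Algebra.Primes" "HOL-Algebra.Product_Groups"
begin

section \<open>Algebras and polynomial operations\<close>

record ('a, 'i) alg =
  univ :: "'a set"
  syms :: "'i set"
  ar :: "'i \<Rightarrow> nat"
  opr :: "'i \<Rightarrow> 'a list \<Rightarrow> 'a"

definition tuples :: "'a set \<Rightarrow> nat \<Rightarrow> 'a list set" where
  "tuples S k = {xs. length xs = k \<and> set xs \<subseteq> S}"

definition is_alg :: "('a, 'i) alg \<Rightarrow> bool" where
  "is_alg A \<longleftrightarrow> univ A \<noteq> {} \<and>
     (\<forall>f\<in>syms A. \<forall>xs\<in>tuples (univ A) (ar A f). opr A f xs \<in> univ A)"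

definition finite_alg :: "('a, 'i) alg \<Rightarrow> bool" where
  "finite_alg A \<longleftrightarrow> is_alg A \<and> finite (univ A) \<and> finite (syms A)"

definition same_signature :: "('a, 'i) alg \<Rightarrow> ('b, 'i) alg \<Rightarrow> bool" where
  "same_signature A B \<longleftrightarrow> syms A = syms B \<and> (\<forall>f\<in>syms A. ar A f = ar B f)"

definition max_arity :: "('a, 'i) alg \<Rightarrow> nat" where
  "max_arity A = Max (ar A ` syms A)"

text \<open>The \<open>k\<close>-ary polynomial operations; they are extensional functions on \<open>k\<close>-tuples, so that
  equality of polynomial operations is equality in HOL.\<close>

inductive_set Pol :: "('a, 'i) alg \<Rightarrow> nat \<Rightarrow> ('a list \<Rightarrow> 'a) set"
  for A :: "('a, 'i) alg" and k :: nat where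
  proj: "i < k \<Longrightarrow> (\<lambda>xs\<in>tuples (univ A) k. xs ! i) \<in> Pol A k"
| const: "a \<in> univ A \<Longrightarrow> (\<lambda>xs\<in>tuples (univ A) k. a) \<in> Pol A k"
| comp: "\<lbrakk>f \<in> syms A; length gs = ar A f; \<forall>g\<in>set gs. g \<in> Pol A k\<rbrakk>
    \<Longrightarrow> (\<lambda>xs\<in>tuples (univ A) k. opr A f (map (\<lambda>g. g xs) gs)) \<in> Pol A k"

definition polynomially_equivalent :: "('a, 'i) alg \<Rightarrow> ('a, 'j) alg \<Rightarrow> bool" where
  "polynomially_equivalent A B \<longleftrightarrow> univ A = univ B \<and> (\<forall>k. Pol A k = Pol B k)"

section \<open>Congruence modular varieties\<close>

datatype 'i trm = V nat | T 'i "'i trm list"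

primrec eval_trm :: "('a, 'i) alg \<Rightarrow> (nat \<Rightarrow> 'a) \<Rightarrow> 'i trm \<Rightarrow> 'a" where
  "eval_trm A \<rho> (V n) = \<rho> n"
| "eval_trm A \<rho> (T f ts) = opr A f (map (eval_trm A \<rho>) ts)"

primrec wf_trm :: "('a, 'i) alg \<Rightarrow> 'i trm \<Rightarrow> bool" where
  "wf_trm A (V n) \<longleftrightarrow> True"
| "wf_trm A (T f ts) \<longleftrightarrow> f \<in> syms A \<and> length ts = ar A f \<and> list_all (wf_trm A) ts"

definition satisfies :: "('a, 'i) alg \<Rightarrow> ('i trm \<times> 'i trm) set \<Rightarrow> bool" where
  "satisfies A E \<longleftrightarrow> (\<forall>(s, t)\<in>E. wf_trm A s \<and> wf_trm A t \<and>
     (\<forall>\<rho>. range \<rho> \<subseteq> univ A \<longrightarrow> eval_trm A \<rho> s = eval_trm A \<rho> t))"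

definition congruence :: "('a, 'i) alg \<Rightarrow> ('a \<times> 'a) set \<Rightarrow> bool" where
  "congruence A \<theta> \<longleftrightarrow> equiv (univ A) \<theta> \<and>
     (\<forall>f\<in>syms A. \<forall>xs ys. length xs = ar A f \<and> list_all2 (\<lambda>x y. (x, y) \<in> \<theta>) xs ys
        \<longrightarrow> (opr A f xs, opr A f ys) \<in> \<theta>)"

definition cong_join :: "('a, 'i) alg \<Rightarrow> ('a \<times> 'a) set \<Rightarrow> ('a \<times> 'a) set \<Rightarrow> ('a \<times> 'a) set" where
  "cong_join A \<alpha> \<beta> = \<Inter>{\<theta>. congruence A \<theta> \<and> \<alpha> \<subseteq> \<theta> \<and> \<beta> \<subseteq> \<theta>}"

definition congruence_modular :: "('a, 'i) alg \<Rightarrow> bool" where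
  "congruence_modular A \<longleftrightarrow> (\<forall>\<alpha> \<beta> \<gamma>. congruence A \<alpha> \<and> congruence A \<beta> \<and> congruence A \<gamma> \<and> \<alpha> \<subseteq> \<gamma>
     \<longrightarrow> cong_join A \<alpha> (\<beta> \<inter> \<gamma>) = cong_join A \<alpha> \<beta> \<inter> \<gamma>)"

text \<open>A variety is the class of models of a set \<open>E\<close> of identities.  HOL cannot quantify over the types
  of the universes of its members.  The algebras whose universe is a set of natural numbers suffice
  when the signature is countable: a failure of the modular law in some member is witnessed by finitely
  many elements (a chain from \<open>a\<close> to \<open>b\<close> showing that \<open>(a, b)\<close> is in the join of \<open>\<alpha>\<close> and \<open>\<beta>\<close>) and so
  also occurs, for the restricted congruences, in the countable subalgebra that they generate.\<close>

definition in_cm_variety :: "('a, 'i) alg \<Rightarrow> bool" where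
  "in_cm_variety A \<longleftrightarrow> (\<exists>E. satisfies A E \<and>
     (\<forall>M :: (nat, 'i) alg. is_alg M \<and> same_signature A M \<and> satisfies M E \<longrightarrow> congruence_modular M))"

section \<open>Modules and nilpotent algebras\<close>

text \<open>A module over an arbitrary unital ring is an Abelian group \<open>G\<close> (written multiplicatively in the
  library) with the image of the ring in \<open>End G\<close>; only this image matters for polynomial operations.
  Scalars are extensional functions on the carrier.\<close>

definition endo_ring :: "'a monoid \<Rightarrow> ('a \<Rightarrow> 'a) set \<Rightarrow> bool" where
  "endo_ring G R \<longleftrightarrow> R \<subseteq> hom G G \<inter> extensional (carrier G) \<and>
     (\<lambda>x\<in>carrier G. x) \<in> R \<and>
     (\<forall>r\<in>R. (\<lambda>x\<in>carrier G. inv\<^bsub>G\<^esub> (r x)) \<in> R) \<and>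
     (\<forall>r\<in>R. \<forall>t\<in>R. (\<lambda>x\<in>carrier G. r x \<otimes>\<^bsub>G\<^esub> t x) \<in> R \<and> compose (carrier G) r t \<in> R)"

datatype 'a module_sym = MPlus | MZero | MNeg | MScale "'a \<Rightarrow> 'a"

primrec module_ar :: "'a module_sym \<Rightarrow> nat" where
  "module_ar MPlus = 2"
| "module_ar MZero = 0"
| "module_ar MNeg = 1"
| "module_ar (MScale r) = 1"

primrec module_opr :: "'a monoid \<Rightarrow> 'a module_sym \<Rightarrow> 'a list \<Rightarrow> 'a" where
  "module_opr G MPlus xs = xs ! 0 \<otimes>\<^bsub>G\<^esub> xs ! 1"
| "module_opr G MZero xs = \<one>\<^bsub>G\<^esub>"
| "module_opr G MNeg xs = inv\<^bsub>G\<^esub> (xs ! 0)"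
| "module_opr G (MScale r) xs = r (xs ! 0)"

definition module_alg :: "'a monoid \<Rightarrow> ('a \<Rightarrow> 'a) set \<Rightarrow> ('a, 'a module_sym) alg" where
  "module_alg G R = \<lparr>univ = carrier G, syms = {MPlus, MZero, MNeg} \<union> MScale ` R,
     ar = module_ar, opr = module_opr G\<rparr>"

definition module_equivalent :: "('a, 'i) alg \<Rightarrow> 'a monoid \<Rightarrow> bool" where
  "module_equivalent L G \<longleftrightarrow> is_alg L \<and> comm_group G \<and>
     (\<exists>R. endo_ring G R \<and> polynomially_equivalent L (module_alg G R))"

text \<open>\<open>A = L \<otimes> U\<close> up to the isomorphism \<open>x \<mapsto> (\<pi> x, \<sigma> x)\<close>, with \<open>G\<close> the additive group of the
  module polynomially equivalent to \<open>L\<close>.\<close>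

definition is_extension ::
  "('a, 'i) alg \<Rightarrow> ('l, 'i) alg \<Rightarrow> 'l monoid \<Rightarrow> ('u, 'i) alg \<Rightarrow> ('a \<Rightarrow> 'l) \<Rightarrow> ('a \<Rightarrow> 'u) \<Rightarrow> bool" where
  "is_extension A L G U \<pi> \<sigma> \<longleftrightarrow> is_alg A \<and> is_alg U \<and> same_signature A L \<and> same_signature A U \<and>
     module_equivalent L G \<and>
     bij_betw (\<lambda>x. (\<pi> x, \<sigma> x)) (univ A) (univ L \<times> univ U) \<and>
     (\<forall>f\<in>syms A. \<exists>h \<in> tuples (univ U) (ar A f) \<rightarrow> univ L. \<forall>xs\<in>tuples (univ A) (ar A f).
        \<pi> (opr A f xs) = opr L f (map \<pi> xs) \<otimes>\<^bsub>G\<^esub> h (map \<sigma> xs) \<and>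
        \<sigma> (opr A f xs) = opr U f (map \<sigma> xs))"

text \<open>The factors may be sought on the type \<open>'a\<close>, as their universes embed into that of \<open>A\<close>.\<close>

fun n_nilpotent :: "nat \<Rightarrow> ('a, 'i) alg \<Rightarrow> bool" where
  "n_nilpotent 0 A \<longleftrightarrow> False"
| "n_nilpotent (Suc 0) A \<longleftrightarrow> in_cm_variety A \<and> (\<exists>G. module_equivalent A G)"
| "n_nilpotent (Suc (Suc n)) A \<longleftrightarrow> in_cm_variety A \<and>
     (\<exists>(L :: ('a, 'i) alg) G (U :: ('a, 'i) alg) \<pi> \<sigma>.
        n_nilpotent (Suc 0) L \<and> n_nilpotent (Suc n) U \<and> is_extension A L G U \<pi> \<sigma>)"

definition nilpotent :: "('a, 'i) alg \<Rightarrow> bool" where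
  "nilpotent A \<longleftrightarrow> (\<exists>n. n_nilpotent n A)"

section \<open>Coordinatised extensions\<close>

definition Zprod :: "(nat \<Rightarrow> nat) \<Rightarrow> nat set \<Rightarrow> (nat \<Rightarrow> int) monoid" where
  "Zprod p J = product_group J (\<lambda>j. integer_mod_group (p j))"

text \<open>\<open>L\<close> is polynomially equivalent to a module on \<open>\<int>\<^sub>q\<^sup>k\<close>, where \<open>k = card J\<close>.\<close>

definition coordinate_level :: "(nat \<Rightarrow> nat) \<Rightarrow> nat set \<Rightarrow> (nat \<Rightarrow> int, 'i) alg \<Rightarrow> bool" where
  "coordinate_level p J L \<longleftrightarrow> finite J \<and> (\<exists>q. prime q \<and> (\<forall>j\<in>J. p j = q)) \<and>
     module_equivalent L (Zprod p J)"

text \<open>\<open>coordinate_tower p [J\<^sub>1, \<dots>, J\<^sub>n] B\<close>: \<open>B\<close> equals \<open>L\<^sub>1 \<otimes> (L\<^sub>2 \<otimes> (\<dots> \<otimes> L\<^sub>n))\<close>, where the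
  coordinates with index in the block \<open>J\<^sub>i\<close> are those of \<open>L\<^sub>i\<close>.\<close>

fun coordinate_tower :: "(nat \<Rightarrow> nat) \<Rightarrow> nat set list \<Rightarrow> (nat \<Rightarrow> int, 'i) alg \<Rightarrow> bool" where
  "coordinate_tower p [] B \<longleftrightarrow> False"
| "coordinate_tower p [J] B \<longleftrightarrow> coordinate_level p J B"
| "coordinate_tower p (J # K # Js) B \<longleftrightarrow>
     univ B = carrier (Zprod p (\<Union>(set (J # K # Js)))) \<and> J \<inter> \<Union>(set (K # Js)) = {} \<and>
     (\<exists>L U. coordinate_level p J L \<and> coordinate_tower p (K # Js) U \<and>
        is_extension B L (Zprod p J) U (\<lambda>x. restrict x J) (\<lambda>x. restrict x (\<Union>(set (K # Js)))))"

definition alg_iso :: "('a \<Rightarrow> 'b) \<Rightarrow> ('a, 'i) alg \<Rightarrow> ('b, 'i) alg \<Rightarrow> bool" where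
  "alg_iso \<phi> A B \<longleftrightarrow> same_signature A B \<and> bij_betw \<phi> (univ A) (univ B) \<and>
     (\<forall>f\<in>syms A. \<forall>xs\<in>tuples (univ A) (ar A f). \<phi> (opr A f xs) = opr B f (map \<phi> xs))"

text \<open>\<open>B\<close> is a coordinatised extension of \<open>A\<close> with zero \<open>z\<close>; the bijection \<open>\<kappa>\<close> is the
  identification of the universe with \<open>\<int>\<^bsub>p 0\<^esub> \<times> \<dots> \<times> \<int>\<^bsub>p (s - 1)\<^esub>\<close>.\<close>

definition coordinatised_extension ::
  "('a, 'i) alg \<Rightarrow> 'a \<Rightarrow> ('a, 'j) alg \<Rightarrow> nat \<Rightarrow> (nat \<Rightarrow> nat) \<Rightarrow> ('a \<Rightarrow> nat \<Rightarrow> int) \<Rightarrow> bool" where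
  "coordinatised_extension A z B s p \<kappa> \<longleftrightarrow>
     finite_alg B \<and> nilpotent B \<and> univ B = univ A \<and> (\<forall>k. Pol A k \<subseteq> Pol B k) \<and>
     (\<exists>B' Js. coordinate_tower p Js B' \<and> \<Union>(set Js) = {..<s} \<and> alg_iso \<kappa> B B') \<and>
     (\<exists>plus\<in>syms B. ar B plus = 2 \<and> (\<forall>x\<in>univ B. \<forall>y\<in>univ B.
        \<kappa> (opr B plus [x, y]) = \<kappa> x \<otimes>\<^bsub>Zprod p {..<s}\<^esub> \<kappa> y)) \<and>
     (\<exists>zero\<in>syms B. ar B zero = 0 \<and> opr B zero [] = z \<and> \<kappa> z = \<one>\<^bsub>Zprod p {..<s}\<^esub>) \<and>
     (\<exists>neg\<in>syms B. ar B neg = 1 \<and> (\<forall>x\<in>univ B.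
        \<kappa> (opr B neg [x]) = inv\<^bsub>Zprod p {..<s}\<^esub> (\<kappa> x)))"

definition embed :: "nat \<Rightarrow> nat \<Rightarrow> (nat \<Rightarrow> nat) \<Rightarrow> ('a \<Rightarrow> nat \<Rightarrow> int) \<Rightarrow> 'a \<Rightarrow> int list" where
  "embed m s p \<kappa> x = map (\<lambda>j. int (m div p j) * \<kappa> x j) [0..<s]"

section \<open>Circuits\<close>

text \<open>Gates are listed in topological order.  \<open>Gate l ws\<close> has label \<open>l\<close> and receives one wire from each
  gate number in \<open>ws\<close>, repetitions being parallel wires.\<close>

datatype 'l gate = Input nat | Gate 'l "nat list"

record 'l circuit =
  ninputs :: nat
  gates :: "'l gate list"
  outs :: "nat list"

definition wf_circuit :: "('l \<Rightarrow> nat \<Rightarrow> bool) \<Rightarrow> 'l circuit \<Rightarrow> bool" where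
  "wf_circuit ok C \<longleftrightarrow>
     (\<forall>i<length (gates C). case gates C ! i of
        Input j \<Rightarrow> j < ninputs C
      | Gate l ws \<Rightarrow> ok l (length ws) \<and> (\<forall>w\<in>set ws. w < i)) \<and>
     (\<forall>w\<in>set (outs C). w < length (gates C))"

primrec gate_value :: "('l \<Rightarrow> 'v list \<Rightarrow> 'v) \<Rightarrow> (nat \<Rightarrow> 'v) \<Rightarrow> 'v list \<Rightarrow> 'l gate \<Rightarrow> 'v" where
  "gate_value sem inp vs (Input j) = inp j"
| "gate_value sem inp vs (Gate l ws) = sem l (map ((!) vs) ws)"

definition gate_values :: "('l \<Rightarrow> 'v list \<Rightarrow> 'v) \<Rightarrow> (nat \<Rightarrow> 'v) \<Rightarrow> 'l gate list \<Rightarrow> 'v list" where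
  "gate_values sem inp gs = foldl (\<lambda>vs g. vs @ [gate_value sem inp vs g]) [] gs"

definition run_circuit :: "('l \<Rightarrow> 'v list \<Rightarrow> 'v) \<Rightarrow> 'l circuit \<Rightarrow> 'v list \<Rightarrow> 'v list" where
  "run_circuit sem C xs = map ((!) (gate_values sem ((!) xs) (gates C))) (outs C)"

datatype ('a, 'i) alg_label = Const 'a | Basic 'i

fun alg_sem :: "('a, 'i) alg \<Rightarrow> ('a, 'i) alg_label \<Rightarrow> 'a list \<Rightarrow> 'a" where
  "alg_sem A (Const a) xs = a"
| "alg_sem A (Basic f) xs = opr A f xs"

fun alg_label_ok :: "('a, 'i) alg \<Rightarrow> ('a, 'i) alg_label \<Rightarrow> nat \<Rightarrow> bool" where
  "alg_label_ok A (Const a) n \<longleftrightarrow> a \<in> univ A \<and> n = 0"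
| "alg_label_ok A (Basic f) n \<longleftrightarrow> f \<in> syms A \<and> n = ar A f"

definition circuit_over :: "('a, 'i) alg \<Rightarrow> ('a, 'i) alg_label circuit \<Rightarrow> bool" where
  "circuit_over A C \<longleftrightarrow> wf_circuit (alg_label_ok A) C \<and> length (outs C) = 1"

datatype cc_label = CConst int | Plus | MOD

fun cc_sem :: "nat \<Rightarrow> cc_label \<Rightarrow> int list \<Rightarrow> int" where
  "cc_sem m (CConst c) xs = c"
| "cc_sem m Plus xs = sum_list xs mod int m"
| "cc_sem m MOD xs = (if sum_list xs mod int m = 0 then 1 else 0)"

fun cc_label_ok :: "nat \<Rightarrow> cc_label \<Rightarrow> nat \<Rightarrow> bool" where
  "cc_label_ok m (CConst c) n \<longleftrightarrow> c \<in> {0..<int m} \<and> n = 0"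
| "cc_label_ok m Plus n \<longleftrightarrow> True"
| "cc_label_ok m MOD n \<longleftrightarrow> True"

definition cc_circuit :: "nat \<Rightarrow> cc_label circuit \<Rightarrow> bool" where
  "cc_circuit m C \<longleftrightarrow> wf_circuit (cc_label_ok m) C"

text \<open>The maximal number of \<open>MOD\<close>-gates on a path of the circuit, obtained by evaluating the circuit
  over \<open>nat\<close> with each gate computing its own essential depth.\<close>

definition depth_sem :: "cc_label \<Rightarrow> nat list \<Rightarrow> nat" where
  "depth_sem l ds = Max (set (0 # ds)) + (if l = MOD then 1 else 0)"

definition essential_depth :: "cc_label circuit \<Rightarrow> nat" where
  "essential_depth C = Max (set (0 # gate_values depth_sem (\<lambda>_. 0) (gates C)))"

section \<open>Linear time\<close>

text \<open>Random access machines with uniform cost measure, addition and truncated subtraction, a read-only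
  input tape and a write-only output tape, in structured form.  \<open>Load i j\<close> and \<open>Store i j\<close> are the
  instructions with indirect addressing.\<close>

datatype com =
    SetC nat nat
  | Add nat nat nat
  | Sub nat nat nat
  | Load nat nat
  | Store nat nat
  | Read nat
  | Write nat
  | Skip
  | Seq com com
  | IfNZ nat com com
  | WhileNZ nat com

type_synonym config = "(nat \<Rightarrow> nat) \<times> nat list \<times> nat list"

inductive exec :: "com \<Rightarrow> config \<Rightarrow> nat \<Rightarrow> config \<Rightarrow> bool" where
  "exec (SetC i c) (M, inp, out) 1 (M(i := c), inp, out)"
| "exec (Add i j k) (M, inp, out) 1 (M(i := M j + M k), inp, out)"
| "exec (Sub i j k) (M, inp, out) 1 (M(i := M j - M k), inp, out)"
| "exec (Load i j) (M, inp, out) 1 (M(i := M (M j)), inp, out)"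
| "exec (Store i j) (M, inp, out) 1 (M(M i := M j), inp, out)"
| "exec (Read i) (M, x # inp, out) 1 (M(i := x), inp, out)"
| "exec (Write i) (M, inp, out) 1 (M, inp, out @ [M i])"
| "exec Skip c 1 c"
| "exec P c t c' \<Longrightarrow> exec Q c' t' c'' \<Longrightarrow> exec (Seq P Q) c (t + t') c''"
| "M i \<noteq> 0 \<Longrightarrow> exec P (M, inp, out) t c' \<Longrightarrow> exec (IfNZ i P Q) (M, inp, out) (Suc t) c'"
| "M i = 0 \<Longrightarrow> exec Q (M, inp, out) t c' \<Longrightarrow> exec (IfNZ i P Q) (M, inp, out) (Suc t) c'"
| "M i = 0 \<Longrightarrow> exec (WhileNZ i P) (M, inp, out) 1 (M, inp, out)"
| "M i \<noteq> 0 \<Longrightarrow> exec P (M, inp, out) t c' \<Longrightarrow> exec (WhileNZ i P) c' t' c''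
    \<Longrightarrow> exec (WhileNZ i P) (M, inp, out) (Suc (t + t')) c''"

definition linear_time_computable ::
  "'x set \<Rightarrow> ('x \<Rightarrow> nat list) \<Rightarrow> ('y \<Rightarrow> nat list) \<Rightarrow> ('x \<Rightarrow> 'y) \<Rightarrow> bool" where
  "linear_time_computable X encX encY F \<longleftrightarrow>
     (\<exists>P c. \<forall>x\<in>X. \<exists>t M inp. t \<le> c * length (encX x) \<and>
        exec P (\<lambda>_. 0, encX x, []) t (M, inp, encY (F x)))"

primrec encode_gate :: "('l \<Rightarrow> nat) \<Rightarrow> 'l gate \<Rightarrow> nat list" where
  "encode_gate \<nu> (Input j) = [0, j]"
| "encode_gate \<nu> (Gate l ws) = [Suc (\<nu> l), length ws] @ ws"

text \<open>The length of the code is linear in the numbers of gates, wires and outputs.\<close>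

definition encode_circuit :: "('l \<Rightarrow> nat) \<Rightarrow> 'l circuit \<Rightarrow> nat list" where
  "encode_circuit \<nu> C = [ninputs C, length (gates C)] @ concat (map (encode_gate \<nu>) (gates C)) @
     [length (outs C)] @ outs C"

definition alg_labels :: "('a, 'i) alg \<Rightarrow> ('a, 'i) alg_label set" where
  "alg_labels A = Const ` univ A \<union> Basic ` syms A"

fun cc_code :: "cc_label \<Rightarrow> nat" where
  "cc_code Plus = 0"
| "cc_code MOD = 1"
| "cc_code (CConst c) = 2 + nat c"

end

theory Submission
  imports Defs "HOL-Number_Theory.Cong"
begin

text \<open>Evaluate a circuit over \<open>L\<^sub>1 \<otimes> (\<dots> \<otimes> L\<^sub>n)\<close> level by level, beginning with \<open>L\<^sub>n\<close>.  The
  \<open>L\<^sub>i\<close>-part of an operation is an affine map of the \<open>L\<^sub>i\<close>-parts of its arguments plus a function of the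
  coordinates of later levels.  The affine part needs only \<open>+\<close>-gates, so the length of the circuit does
  not enter the essential depth, and a level costs the essential depth \<open>c\<close> of an arbitrary function of a
  bounded number of coordinates with values in \<open>\<int>\<^sub>q\<close>.  Such a function is a combination of indicators of
  points, hence of conjunctions of bits \<open>[x\<^sub>i = \<alpha>\<^sub>i]\<close>.  If \<open>m\<close> is a prime \<open>> 2\<close>, a binary tree of \<open>MOD\<close>-gates
  computes a conjunction.  Otherwise a prime divisor \<open>r \<noteq> q\<close> of \<open>m\<close> serves to write the conjunction as a
  linear combination modulo \<open>q\<close> of indicators of affine hyperplanes over \<open>\<int>\<^sub>r\<close>, and \<open>c = 2\<close>.
  Every gate is replaced by a block of constant size that depends only on its label, which makes the
  translation streamable.\<close>

section \<open>Translating gates into blocks\<close>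

text \<open>The embedding identifies coordinate \<open>j\<close> with the subgroup of multiples of
  \<open>m div p j\<close> in Z_m. So \<open>+\<close>-gates modulo \<open>m\<close> serve all
  primes at once, and since every target carries the factor \<open>m div p j\<close>, a congruence
  modulo \<open>p j\<close> suffices; this is why an inverse modulo \<open>q\<close> is of use in a
  circuit modulo \<open>m\<close>. The depth is controlled by an invariant: in every gate of the
  source circuit, coordinate \<open>j\<close> has essential depth at most \<open>c\<close> times the
  number of coordinates in later levels. The affine part respects this bound, and the nonlinear part
  reads only coordinates whose bound is smaller by at least \<open>c\<close>. Counting coordinates
  instead of levels gives the maximum \<open>c * (s - 1)\<close>, and 2^s \<le> |A| turns it into
  the logarithm. The form of the translation is dictated by two demands: the depth has to be the
  same \<open>d\<close> for all circuits, and one program without multiplication has to produce the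
  output. Hence all blocks have the same size, with idle \<open>MOD\<close>-gates as filling, and
  the address of a gate is a constant multiple of a gate number plus a constant.\<close>

datatype expr = EIn nat | ERef nat nat | ELit int | EAdd expr expr | EMod expr

primrec esize :: "expr \<Rightarrow> nat" where
  "esize (EIn c) = 1"
| "esize (ERef a j) = 1"
| "esize (ELit c) = 1"
| "esize (EAdd e f) = esize e + esize f + 1"
| "esize (EMod e) = esize e + 1"

text \<open>An expression describes one coordinate of the value of a gate. Here \<open>m\<close> is
  the modulus, \<open>n\<close> the number of input coordinates that may be read, \<open>r\<close>
  the number of arguments and \<open>s\<close> the number of coordinates of each;
  \<open>ERef a j\<close> stands for coordinate \<open>j\<close> of argument
  \<open>a\<close>.\<close>

primrec expr_ok :: "nat \<Rightarrow> nat \<Rightarrow> nat \<Rightarrow> nat \<Rightarrow> expr \<Rightarrow> bool" where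
  "expr_ok m n r s (EIn c) \<longleftrightarrow> c < n"
| "expr_ok m n r s (ERef a j) \<longleftrightarrow> a < r \<and> j < s"
| "expr_ok m n r s (ELit c) \<longleftrightarrow> c \<in> {0..<int m}"
| "expr_ok m n r s (EAdd e f) \<longleftrightarrow> expr_ok m n r s e \<and> expr_ok m n r s f"
| "expr_ok m n r s (EMod e) \<longleftrightarrow> expr_ok m n r s e"

text \<open>The semantics is a parameter so that one recursion yields both the values
  (\<open>cc_sem m\<close>) and the essential depths (\<open>depth_sem\<close>). Even a reference is
  a \<open>Plus\<close>-gate with one wire: every expression ends in a gate of its own, at no cost
  in essential depth.\<close>

primrec expr_val :: "(cc_label \<Rightarrow> 'v list \<Rightarrow> 'v) \<Rightarrow> (nat \<Rightarrow> 'v) \<Rightarrow> (nat \<Rightarrow> nat \<Rightarrow> 'v) \<Rightarrow> expr \<Rightarrow> 'v" where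
  "expr_val sem u E (EIn c) = u c"
| "expr_val sem u E (ERef a j) = sem Plus [E a j]"
| "expr_val sem u E (ELit c) = sem (CConst c) []"
| "expr_val sem u E (EAdd e f) = sem Plus [expr_val sem u E e, expr_val sem u E f]"
| "expr_val sem u E (EMod e) = sem MOD [expr_val sem u E e]"

lemma expr_val_cong:
  assumes "expr_ok m n r s e" and "\<And>c. c < n \<Longrightarrow> u c = u' c"
    and "\<And>a j. a < r \<Longrightarrow> j < s \<Longrightarrow> E a j = E' a j"
  shows "expr_val sem u E e = expr_val sem u' E' e"
  using assms by (induction e) auto

text \<open>Lets the actual depths of the arguments be replaced by upper bounds that do not depend
  on the gate.\<close>

lemma expr_val_depth_mono:
  assumes "expr_ok m n r s e" and "\<And>c. c < n \<Longrightarrow> u c \<le> u' c"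
    and "\<And>a j. a < r \<Longrightarrow> j < s \<Longrightarrow> E a j \<le> E' a j"
  shows "expr_val depth_sem u E e \<le> expr_val depth_sem u' E' e"
  using assms by (induction e) (auto simp: depth_sem_def le_max_iff_disj)

lemma esize_pos [simp]: "esize e > 0"
  by (cases e) auto

lemma esize_neq_0 [simp]: "esize e \<noteq> 0"
  by simp

section \<open>Relocatable gate templates and blocks of constant size\<close>

datatype tgate = TIn nat | TGate cc_label "(nat \<times> nat) list"

text \<open>\<open>\<rho> 0\<close> is the start of the current block and
  \<open>\<rho> (Suc a)\<close> that of the block of argument \<open>a\<close>. An input gate has no
  arguments, so there \<open>\<rho> 1\<close> is free to hold the position of its first coordinate
  among the inputs.\<close>

primrec inst :: "(nat \<Rightarrow> nat) \<Rightarrow> tgate \<Rightarrow> cc_label gate" where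
  "inst \<rho> (TIn c) = Input (\<rho> 1 + c)"
| "inst \<rho> (TGate l ws) = Gate l (map (\<lambda>(r, c). \<rho> r + c) ws)"

text \<open>A wire \<open>(0, c)\<close> leads to gate \<open>c\<close> of the current block, and a wire \<open>(Suc a, c)\<close> to gate \<open>c\<close>
  of the block of the \<open>a\<close>-th argument.\<close>

primrec compile :: "nat \<Rightarrow> nat \<Rightarrow> expr \<Rightarrow> tgate list" where
  "compile M k (EIn c) = [TIn c]"
| "compile M k (ERef a j) = [TGate Plus [(Suc a, j * M + (M - 1))]]"
| "compile M k (ELit c) = [TGate (CConst c) []]"
| "compile M k (EAdd e f) = compile M k e @ compile M (k + esize e) f @
     [TGate Plus [(0, k + esize e - 1), (0, k + esize e + esize f - 1)]]"
| "compile M k (EMod e) = compile M k e @ [TGate MOD [(0, k + esize e - 1)]]"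

lemma length_compile [simp]: "length (compile M k e) = esize e"
  by (induction e arbitrary: k) auto

text \<open>The chain of \<open>d\<close> \<open>MOD\<close>-gates brings the essential depth up to the prescribed value.\<close>

definition pad :: "nat \<Rightarrow> nat \<Rightarrow> nat \<Rightarrow> tgate list" where
  "pad d k n = map (\<lambda>t. if t < d then TGate MOD (if t = 0 then [] else [(0, k + t - 1)])
     else TGate Plus []) [0..<n]"

lemma length_pad [simp]: "length (pad d k n) = n"
  by (simp add: pad_def)

text \<open>The filling precedes the code, so the value of the expression always sits in the last
  gate of the slot, at offset \<open>j * M + (M - 1)\<close>, whatever the size of the
  expression.\<close>

definition slot :: "nat \<Rightarrow> nat \<Rightarrow> nat \<Rightarrow> expr \<Rightarrow> tgate list" where
  "slot d M j e = pad d (j * M) (M - esize e) @ compile M (j * M + (M - esize e)) e"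

lemma length_slot [simp]: "esize e \<le> M \<Longrightarrow> length (slot d M j e) = M"
  by (simp add: slot_def)

definition block :: "nat \<Rightarrow> nat \<Rightarrow> nat \<Rightarrow> (nat \<Rightarrow> expr) \<Rightarrow> tgate list" where
  "block d M s es = concat (map (\<lambda>j. slot d M j (es j)) [0..<s])"

lemma block_0 [simp]: "block d M 0 es = []"
  and block_Suc: "block d M (Suc s) es = block d M s es @ slot d M s (es s)"
  by (simp_all add: block_def)

lemma length_block [simp]: "(\<And>j. j < s \<Longrightarrow> esize (es j) \<le> M) \<Longrightarrow> length (block d M s es) = s * M"
  by (induction s) (auto simp: block_Suc)

section \<open>Values and depths inside one block\<close>

abbreviation extend_values where
  "extend_values sem inp \<equiv> foldl (\<lambda>vs g. vs @ [gate_value sem inp vs g])"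

lemma length_extend_values [simp]: "length (extend_values sem inp vs gs) = length vs + length gs"
  by (induction gs arbitrary: vs) auto

lemma length_gate_values [simp]: "length (gate_values sem inp gs) = length gs"
  by (simp add: gate_values_def)

lemma gate_values_append:
  "gate_values sem inp (gs @ hs) = extend_values sem inp (gate_values sem inp gs) hs"
  by (simp add: gate_values_def)

text \<open>The bound on the references places them in the part \<open>vs\<close> that is already
  evaluated, and appending values does not change its entries. So the second operand of a sum still
  sees the same arguments as the first.\<close>

lemma compile_values:
  assumes "expr_ok m n r s e" and "length vs = \<rho> 0 + k"
    and "\<And>a j. a < r \<Longrightarrow> j < s \<Longrightarrow> \<rho> (Suc a) + (j * M + (M - 1)) < length vs"
  shows "\<exists>ws. extend_values sem inp vs (map (inst \<rho>) (compile M k e)) = vs @ ws \<and>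
    length ws = esize e \<and>
    last ws = expr_val sem (\<lambda>c. inp (\<rho> 1 + c)) (\<lambda>a j. vs ! (\<rho> (Suc a) + (j * M + (M - 1)))) e"
  using assms
proof (induction e arbitrary: k vs)
  case (EAdd e f)
  let ?E = "\<lambda>vs a j. vs ! (\<rho> (Suc a) + (j * M + (M - 1)))"
  let ?u = "\<lambda>c. inp (\<rho> 1 + c)"
  from EAdd.IH(1)[of vs k] EAdd.prems obtain ws1 where
    1: "extend_values sem inp vs (map (inst \<rho>) (compile M k e)) = vs @ ws1" "length ws1 = esize e"
      "last ws1 = expr_val sem ?u (?E vs) e" by auto
  from EAdd.IH(2)[of "vs @ ws1" "k + esize e"] EAdd.prems 1(2) obtain ws2 where
    2: "extend_values sem inp (vs @ ws1) (map (inst \<rho>) (compile M (k + esize e) f)) = (vs @ ws1) @ ws2"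
      "length ws2 = esize f" "last ws2 = expr_val sem ?u (?E (vs @ ws1)) f"
    by (auto simp: less_imp_le_nat trans_less_add1)
  have E: "expr_val sem ?u (?E (vs @ ws1)) f = expr_val sem ?u (?E vs) f"
    by (rule expr_val_cong[of m n r s]) (use EAdd.prems in \<open>auto simp: nth_append\<close>)
  have ne: "ws1 \<noteq> []" "ws2 \<noteq> []"
    using 1(2) 2(2) by auto
  have i1: "(vs @ ws1 @ ws2) ! (\<rho> 0 + (k + esize e - 1)) = last ws1"
    using ne(1) 1(2) EAdd.prems(2) esize_pos[of e] by (auto simp: nth_append last_conv_nth simp del: esize_pos esize_neq_0)
  have i2: "(vs @ ws1 @ ws2) ! (\<rho> 0 + (k + esize e + esize f - 1)) = last ws2"
    using ne(2) 1(2) 2(2) EAdd.prems(2) esize_pos[of f] by (auto simp: nth_append last_conv_nth simp del: esize_pos esize_neq_0)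
  show ?case
    using 1 2 E i1 i2 by (intro exI[of _ "ws1 @ ws2 @ [sem Plus [last ws1, last ws2]]"]) simp
next
  case (EMod e)
  let ?E = "\<lambda>vs a j. vs ! (\<rho> (Suc a) + (j * M + (M - 1)))"
  let ?u = "\<lambda>c. inp (\<rho> 1 + c)"
  from EMod.IH[of vs k] EMod.prems obtain ws1 where
    1: "extend_values sem inp vs (map (inst \<rho>) (compile M k e)) = vs @ ws1" "length ws1 = esize e"
      "last ws1 = expr_val sem ?u (?E vs) e" by auto
  have ne: "ws1 \<noteq> []"
    using 1(2) by auto
  have i1: "(vs @ ws1) ! (\<rho> 0 + (k + esize e - 1)) = last ws1"
    using ne(1) 1(2) EMod.prems(2) esize_pos[of e] by (auto simp: nth_append last_conv_nth simp del: esize_pos esize_neq_0)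
  show ?case
    using 1 i1 by (intro exI[of _ "ws1 @ [sem MOD [last ws1]]"]) simp
qed auto

text \<open>From each gate of a compiled expression a path leads to its last gate, and depth never
  decreases along a wire.\<close>

lemma compile_depth:
  assumes "expr_ok m n r s e" and "length vs = \<rho> 0 + k"
    and "\<And>a j. a < r \<Longrightarrow> j < s \<Longrightarrow> \<rho> (Suc a) + (j * M + (M - 1)) < length vs"
    and "\<And>c. inp c \<le> u c"
    and "extend_values depth_sem inp vs (map (inst \<rho>) (compile M k e)) = vs @ ws"
  shows "\<forall>w\<in>set ws. w \<le> last ws"
  using assms
proof (induction e arbitrary: k vs ws)
  case (EAdd e f)
  obtain ws1 where
    1: "extend_values depth_sem inp vs (map (inst \<rho>) (compile M k e)) = vs @ ws1" "length ws1 = esize e"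
    using compile_values[of m n r s e vs \<rho> k M depth_sem inp] EAdd.prems by auto
  obtain ws2 where
    2: "extend_values depth_sem inp (vs @ ws1) (map (inst \<rho>) (compile M (k + esize e) f)) = (vs @ ws1) @ ws2"
      "length ws2 = esize f"
    using compile_values[of m n r s f "vs @ ws1" \<rho> "k + esize e" M depth_sem inp] EAdd.prems 1(2)
    by (auto simp: less_imp_le_nat trans_less_add1)
  have ne: "ws1 \<noteq> []" "ws2 \<noteq> []"
    using 1(2) 2(2) by auto
  have i1: "(vs @ ws1 @ ws2) ! (\<rho> 0 + (k + esize e - 1)) = last ws1"
    using ne(1) 1(2) EAdd.prems(2) esize_pos[of e] by (auto simp: nth_append last_conv_nth simp del: esize_pos esize_neq_0)
  have i2: "(vs @ ws1 @ ws2) ! (\<rho> 0 + (k + esize e + esize f - 1)) = last ws2"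
    using ne(2) 1(2) 2(2) EAdd.prems(2) esize_pos[of f] by (auto simp: nth_append last_conv_nth simp del: esize_pos esize_neq_0)
  have ws: "ws = ws1 @ ws2 @ [depth_sem Plus [last ws1, last ws2]]"
    using EAdd.prems(5) 1(1) 2(1) i1 i2 by simp
  have "\<forall>w\<in>set ws1. w \<le> last ws1" "\<forall>w\<in>set ws2. w \<le> last ws2"
    using EAdd.IH(1)[OF _ _ _ _ 1(1)] EAdd.IH(2)[OF _ _ _ _ 2(1)] EAdd.prems 1(2)
    by (auto simp: less_imp_le_nat trans_less_add1)
  then show ?case
    by (auto simp: ws depth_sem_def le_max_iff_disj)
next
  case (EMod e)
  obtain ws1 where
    1: "extend_values depth_sem inp vs (map (inst \<rho>) (compile M k e)) = vs @ ws1" "length ws1 = esize e"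
    using compile_values[of m n r s e vs \<rho> k M depth_sem inp] EMod.prems by auto
  have ne: "ws1 \<noteq> []"
    using 1(2) by auto
  have i1: "(vs @ ws1) ! (\<rho> 0 + (k + esize e - 1)) = last ws1"
    using ne(1) 1(2) EMod.prems(2) esize_pos[of e] by (auto simp: nth_append last_conv_nth simp del: esize_pos esize_neq_0)
  have ws: "ws = ws1 @ [depth_sem MOD [last ws1]]"
    using EMod.prems(5) 1(1) i1 by simp
  have "\<forall>w\<in>set ws1. w \<le> last ws1"
    using EMod.IH[OF _ _ _ _ 1(1)] EMod.prems by auto
  then show ?case
    by (auto simp: ws depth_sem_def le_SucI)
qed auto

lemma pad_Suc:
  "pad d k (Suc n) = pad d k n @
    [if n < d then TGate MOD (if n = 0 then [] else [(0, k + n - 1)]) else TGate Plus []]"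
  by (simp add: pad_def)

lemma pad_values:
  "\<exists>ws. extend_values sem inp vs (map (inst \<rho>) (pad d k n)) = vs @ ws \<and> length ws = n"
  by (induction n) (auto simp: pad_Suc, auto simp: pad_def)

text \<open>Each \<open>MOD\<close>-gate of the chain receives its predecessor, so the depths count
  up from 1 until \<open>d\<close> is reached; the fillers after that have no wires.\<close>

lemma pad_depth:
  assumes "length vs = \<rho> 0 + k"
  shows "extend_values depth_sem inp vs (map (inst \<rho>) (pad d k n)) =
    vs @ map (\<lambda>t. if t < d then Suc t else 0) [0..<n]"
proof (induction n)
  case (Suc n)
  show ?case
  proof (cases n)
    case 0
    then show ?thesis by (auto simp: pad_def depth_sem_def)
  next
    case (Suc n')
    then have "(vs @ map (\<lambda>t. if t < d then Suc t else 0) [0..<n]) ! (\<rho> 0 + (k + n - 1)) =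
        (if n' < d then Suc n' else 0)"
      using assms by (simp add: nth_append del: upt_Suc)
    with Suc.IH Suc show ?thesis
      by (auto simp: pad_Suc depth_sem_def)
  qed
qed (simp add: pad_def)

lemma slot_values:
  assumes "expr_ok m n r s e" and "length vs = \<rho> 0 + j * M" and "esize e \<le> M"
    and "\<And>a j. a < r \<Longrightarrow> j < s \<Longrightarrow> \<rho> (Suc a) + (j * M + (M - 1)) < length vs"
  shows "\<exists>ws. extend_values sem inp vs (map (inst \<rho>) (slot d M j e)) = vs @ ws \<and>
    length ws = M \<and>
    last ws = expr_val sem (\<lambda>c. inp (\<rho> 1 + c)) (\<lambda>a j. vs ! (\<rho> (Suc a) + (j * M + (M - 1)))) e"
proof -
  obtain ws1 where 1: "extend_values sem inp vs (map (inst \<rho>) (pad d (j * M) (M - esize e))) = vs @ ws1"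
    "length ws1 = M - esize e"
    using pad_values by blast
  let ?E = "\<lambda>vs a j. vs ! (\<rho> (Suc a) + (j * M + (M - 1)))"
  let ?u = "\<lambda>c. inp (\<rho> 1 + c)"
  have len: "length (vs @ ws1) = \<rho> 0 + (j * M + (M - esize e))"
    using assms(2) 1(2) by simp
  have refs: "\<rho> (Suc a) + (j * M + (M - 1)) < length (vs @ ws1)" if "a < r" "j < s" for a j
    using assms(4)[OF that] by simp
  obtain ws2 where 2: "extend_values sem inp (vs @ ws1) (map (inst \<rho>) (compile M (j * M + (M - esize e)) e)) =
     (vs @ ws1) @ ws2" "length ws2 = esize e" "last ws2 = expr_val sem ?u (?E (vs @ ws1)) e"
    using compile_values[OF assms(1) len refs, of sem inp] by blast
  have E: "expr_val sem ?u (?E (vs @ ws1)) e = expr_val sem ?u (?E vs) e"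
    by (rule expr_val_cong[of m n r s]) (use assms in \<open>auto simp: nth_append\<close>)
  have "ws2 \<noteq> []" using 2(2) by auto
  then show ?thesis
    using 1 2 E assms(3) by (intro exI[of _ "ws1 @ ws2"]) (simp add: slot_def)
qed

text \<open>The room \<open>esize e + d \<le> M\<close> accommodates the whole chain, which attains
  \<open>d\<close>; the code does not exceed \<open>d\<close> because its last gate is its
  deepest.\<close>

lemma slot_depth:
  assumes "expr_ok m n r s e" and "length vs = \<rho> 0 + j * M" and "esize e + d \<le> M"
    and "\<And>a j. a < r \<Longrightarrow> j < s \<Longrightarrow> \<rho> (Suc a) + (j * M + (M - 1)) < length vs"
    and "extend_values depth_sem (\<lambda>_. 0) vs (map (inst \<rho>) (slot d M j e)) = vs @ ws"
    and "last ws \<le> d"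
  shows "(\<forall>w\<in>set ws. w \<le> d) \<and> (d = 0 \<or> d \<in> set ws)"
proof -
  define ws1 where "ws1 = map (\<lambda>t. if t < d then Suc t else 0) [0..<M - esize e]"
  have 1: "extend_values depth_sem (\<lambda>_. 0) vs (map (inst \<rho>) (pad d (j * M) (M - esize e))) = vs @ ws1"
    unfolding ws1_def by (rule pad_depth) (rule assms)
  have l1: "length ws1 = M - esize e"
    by (simp add: ws1_def)
  have len: "length (vs @ ws1) = \<rho> 0 + (j * M + (M - esize e))"
    using assms(2) l1 by simp
  have refs: "\<rho> (Suc a) + (j * M + (M - 1)) < length (vs @ ws1)" if "a < r" "j < s" for a j
    using assms(4)[OF that] by simp
  obtain ws2 where 2: "extend_values depth_sem (\<lambda>_. 0) (vs @ ws1)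
      (map (inst \<rho>) (compile M (j * M + (M - esize e)) e)) = (vs @ ws1) @ ws2" "length ws2 = esize e"
    using compile_values[OF assms(1) len refs, of depth_sem "\<lambda>_. 0"] by blast
  have ws: "ws = ws1 @ ws2"
    using assms(5) 1 2(1) by (simp add: slot_def)
  have "\<forall>w\<in>set ws2. w \<le> last ws2"
    using compile_depth[OF assms(1) len refs _ 2(1)] by blast
  moreover have "last ws2 = last ws"
    using ws 2(2) by (cases "ws2 = []") auto
  ultimately have "\<forall>w\<in>set ws2. w \<le> d"
    using assms(6) by auto
  moreover have "\<forall>w\<in>set ws1. w \<le> d"
    by (auto simp: ws1_def)
  moreover have "d = 0 \<or> d \<in> set ws1"
  proof (cases d)
    case (Suc d')
    then have "d' \<in> {0..<M - esize e}" using assms(3) by auto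
    then show ?thesis using Suc by (force simp: ws1_def)
  qed simp
  ultimately show ?thesis
    by (auto simp: ws)
qed

lemma slot_end_less: "j < s \<Longrightarrow> 0 < M \<Longrightarrow> j * M + (M - 1) < s * (M::nat)"
  by (metis Suc_leI Suc_pred add.commute add_less_cancel_left diff_less less_le_trans mult_Suc
      mult_le_mono1 zero_less_one)

lemma block_values:
  assumes "\<And>j. j < t \<Longrightarrow> expr_ok m n r s (es j)" and "\<And>j. j < t \<Longrightarrow> esize (es j) \<le> M"
    and "length vs = \<rho> 0"
    and "\<And>a j. a < r \<Longrightarrow> j < s \<Longrightarrow> \<rho> (Suc a) + (j * M + (M - 1)) < length vs"
  shows "\<exists>ws. extend_values sem inp vs (map (inst \<rho>) (block d M t es)) = vs @ ws \<and>
    length ws = t * M \<and> (\<forall>j<t. ws ! (j * M + (M - 1)) =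
       expr_val sem (\<lambda>c. inp (\<rho> 1 + c)) (\<lambda>a j. vs ! (\<rho> (Suc a) + (j * M + (M - 1)))) (es j))"
  using assms(1,2)
proof (induction t)
  case (Suc t)
  let ?E = "\<lambda>vs a j. vs ! (\<rho> (Suc a) + (j * M + (M - 1)))"
  let ?u = "\<lambda>c. inp (\<rho> 1 + c)"
  obtain ws1 where 1: "extend_values sem inp vs (map (inst \<rho>) (block d M t es)) = vs @ ws1"
    "length ws1 = t * M" "\<forall>j<t. ws1 ! (j * M + (M - 1)) = expr_val sem ?u (?E vs) (es j)"
    using Suc by force
  have t: "expr_ok m n r s (es t)" "esize (es t) \<le> M"
    using Suc by auto
  obtain ws2 where 2: "extend_values sem inp (vs @ ws1) (map (inst \<rho>) (slot d M t (es t))) = (vs @ ws1) @ ws2"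
     "length ws2 = M" "last ws2 = expr_val sem ?u (?E (vs @ ws1)) (es t)"
    using slot_values[OF t(1), of "vs @ ws1" \<rho> t M sem inp d] t(2) 1(2) assms(3,4)
    by (auto simp: trans_less_add1)
  have E: "expr_val sem ?u (?E (vs @ ws1)) (es t) = expr_val sem ?u (?E vs) (es t)"
    by (rule expr_val_cong[OF t(1)]) (use assms(4) in \<open>auto simp: nth_append\<close>)
  have M: "M > 0"
    using t(2) esize_pos[of "es t"] by linarith
  then have "ws2 \<noteq> []" using 2(2) by auto
  then have l: "ws2 ! (M - 1) = last ws2"
    using 2(2) by (simp add: last_conv_nth)
  have "(ws1 @ ws2) ! (j * M + (M - 1)) = expr_val sem ?u (?E vs) (es j)" if "j < Suc t" for j
  proof (cases "j = t")
    case True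
    then show ?thesis using 1(2) 2 l E by (simp add: nth_append)
  next
    case False
    then have "j < t" using that by simp
    then show ?thesis using 1(2,3) slot_end_less[OF _ M, of j t] by (simp add: nth_append)
  qed
  then show ?case
    using 1 2 by (intro exI[of _ "ws1 @ ws2"]) (simp add: block_Suc)
qed simp

lemma block_depth:
  assumes "\<And>j. j < t \<Longrightarrow> expr_ok m n r s (es j)" and "\<And>j. j < t \<Longrightarrow> esize (es j) + d \<le> M"
    and "length vs = \<rho> 0"
    and "\<And>a j. a < r \<Longrightarrow> j < s \<Longrightarrow> \<rho> (Suc a) + (j * M + (M - 1)) < length vs"
    and "extend_values depth_sem (\<lambda>_. 0) vs (map (inst \<rho>) (block d M t es)) = vs @ ws"
    and "\<And>j. j < t \<Longrightarrow> ws ! (j * M + (M - 1)) \<le> d"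
  shows "(\<forall>w\<in>set ws. w \<le> d) \<and> (t = 0 \<or> d = 0 \<or> d \<in> set ws)"
  using assms(1,2,5,6)
proof (induction t arbitrary: ws)
  case (Suc t)
  have t: "expr_ok m n r s (es t)" "esize (es t) + d \<le> M"
    using Suc by auto
  have pre: "expr_ok m n r s (es j)" "esize (es j) \<le> M" if "j < t" for j
    using Suc.prems(1,2)[of j] that by auto
  obtain ws1 where 1: "extend_values depth_sem (\<lambda>_. 0) vs (map (inst \<rho>) (block d M t es)) = vs @ ws1"
    "length ws1 = t * M"
    using block_values[where t = t and es = es, OF pre assms(3,4), where sem = depth_sem and inp = "\<lambda>_. 0" and d = d]
    by (auto simp del: length_extend_values)
  obtain ws2 where 2: "extend_values depth_sem (\<lambda>_. 0) (vs @ ws1) (map (inst \<rho>) (slot d M t (es t))) = (vs @ ws1) @ ws2"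
     "length ws2 = M"
    using slot_values[OF t(1), of "vs @ ws1" \<rho> t M depth_sem "\<lambda>_. 0" d] t(2) 1(2) assms(3,4)
    by (auto simp: trans_less_add1)
  have ws: "ws = ws1 @ ws2"
    using Suc.prems(3) 1(1) 2(1) by (simp add: block_Suc)
  have M: "M > 0"
    using t(2) esize_pos[of "es t"] by linarith
  then have ne: "ws2 \<noteq> []" using 2(2) by auto
  have "ws1 ! (j * M + (M - 1)) \<le> d" if "j < t" for j
    using Suc.prems(4)[of j] slot_end_less[OF that M] that 1(2) by (simp add: ws nth_append)
  then have "\<forall>w\<in>set ws1. w \<le> d"
    using Suc.IH[of ws1] Suc.prems 1(1) by auto
  moreover have "last ws2 \<le> d"
    using Suc.prems(4)[of t] 1(2) 2(2) ne by (simp add: ws nth_append last_conv_nth)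
  then have "(\<forall>w\<in>set ws2. w \<le> d) \<and> (d = 0 \<or> d \<in> set ws2)"
    using slot_depth[OF t(1) _ t(2) _ 2(1)] 1(2) assms(3,4) by (auto simp: trans_less_add1)
  ultimately show ?case
    by (auto simp: ws)
qed simp

section \<open>Concatenating the blocks of all gates\<close>

primrec gate_base :: "nat \<Rightarrow> nat \<Rightarrow> nat \<Rightarrow> 'l gate \<Rightarrow> nat \<Rightarrow> nat" where
  "gate_base N s i (Input j) = (\<lambda>r. if r = 0 then i * N else s * j)"
| "gate_base N s i (Gate l ws) = (\<lambda>r. if r = 0 then i * N else ws ! (r - 1) * N)"

primrec gate_exprs :: "('l \<Rightarrow> nat \<Rightarrow> expr) \<Rightarrow> 'l gate \<Rightarrow> nat \<Rightarrow> expr" where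
  "gate_exprs ES (Input j) = EIn"
| "gate_exprs ES (Gate l ws) = ES l"

primrec translate ::
    "nat \<Rightarrow> nat \<Rightarrow> nat \<Rightarrow> ('l \<Rightarrow> nat \<Rightarrow> expr) \<Rightarrow> nat \<Rightarrow> 'l gate list \<Rightarrow> cc_label gate list" where
  "translate d M s ES i [] = []"
| "translate d M s ES i (g # gs) =
     map (inst (gate_base (s * M) s i g)) (block d M s (gate_exprs ES g)) @ translate d M s ES (Suc i) gs"

definition translate_circuit ::
    "nat \<Rightarrow> nat \<Rightarrow> nat \<Rightarrow> ('l \<Rightarrow> nat \<Rightarrow> expr) \<Rightarrow> 'l circuit \<Rightarrow> cc_label circuit" where
  "translate_circuit d M s ES C = \<lparr>ninputs = s * ninputs C, gates = translate d M s ES 0 (gates C),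
     outs = map (\<lambda>j. hd (outs C) * (s * M) + (j * M + (M - 1))) [0..<s]\<rparr>"

lemma translate_append:
  "translate d M s ES i (gs @ hs) = translate d M s ES i gs @ translate d M s ES (i + length gs) hs"
  by (induction gs arbitrary: i) auto

text \<open>The summand \<open>d\<close> reserves room for the chain in every slot; the expressions
  of an input gate have size 1, which leaves \<open>d < M\<close>. Expressions of proper gates do
  not read inputs, hence the 0 in \<open>expr_ok\<close>.\<close>

definition translatable :: "nat \<Rightarrow> nat \<Rightarrow> nat \<Rightarrow> nat \<Rightarrow> ('l \<Rightarrow> nat \<Rightarrow> expr) \<Rightarrow> nat \<Rightarrow> 'l gate \<Rightarrow> bool" where
  "translatable m d M s ES i g \<longleftrightarrow> (case g of Input j \<Rightarrow> d < M
     | Gate l ws \<Rightarrow> (\<forall>w\<in>set ws. w < i) \<and>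
        (\<forall>j<s. expr_ok m 0 (length ws) s (ES l j) \<and> esize (ES l j) + d \<le> M))"

text \<open>Lets the block lemmas be applied to both kinds of gates at once: an input gate reads
  \<open>s\<close> inputs and no arguments, a proper gate reads only arguments, whose blocks end
  before the current one begins.\<close>

lemma translatable_exprs:
  assumes "translatable m d M s ES i g"
  obtains n r where "\<And>j. j < s \<Longrightarrow> expr_ok m n r s (gate_exprs ES g j)"
    and "\<And>j. j < s \<Longrightarrow> esize (gate_exprs ES g j) + d \<le> M"
    and "\<And>a j. a < r \<Longrightarrow> j < s \<Longrightarrow> gate_base (s * M) s i g (Suc a) + (j * M + (M - 1)) < i * (s * M)"
    and "\<And>l ws. g = Gate l ws \<Longrightarrow> r = length ws \<and> n = 0"
    and "\<And>c. g = Input c \<Longrightarrow> r = 0 \<and> n = s"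
proof (cases g)
  case (Input c)
  then show ?thesis
    using assms that[of s 0] by (auto simp: translatable_def)
next
  case (Gate l ws)
  have "gate_base (s * M) s i g (Suc a) + (j * M + (M - 1)) < i * (s * M)"
    if "a < length ws" "j < s" for a j
  proof -
    have "ws ! a < i"
      using assms Gate that by (auto simp: translatable_def)
    moreover have "j * M + (M - 1) < s * M"
    proof (rule slot_end_less[OF that(2)])
      show "0 < M"
        using assms Gate that esize_pos[of "ES l j"]
          by (auto simp: translatable_def simp del: esize_pos dest!: spec[of _ j])
    qed
    ultimately have "ws ! a * (s * M) + (j * M + (M - 1)) < Suc (ws ! a) * (s * M)"
      by simp
    also have "\<dots> \<le> i * (s * M)"
      using \<open>ws ! a < i\<close> by (intro mult_right_mono) auto
    finally show ?thesis using Gate by simp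
  qed
  moreover have "\<forall>j<s. expr_ok m 0 (length ws) s (ES l j) \<and> esize (ES l j) + d \<le> M"
    using assms Gate by (simp add: translatable_def)
  ultimately show ?thesis
    using Gate by (intro that[where n = 0 and r = "length ws"]) simp_all
qed

lemma length_translate:
  assumes "\<And>i. i < length gs \<Longrightarrow> translatable m d M s ES i (gs ! i)"
  shows "length (translate d M s ES 0 gs) = length gs * (s * M)"
  using assms
proof (induction gs rule: rev_induct)
  case (snoc g gs)
  have tr: "translatable m d M s ES i (gs ! i)" if "i < length gs" for i
    using snoc.prems[of i] that by (simp add: nth_append)
  obtain n r where "\<And>j. j < s \<Longrightarrow> esize (gate_exprs ES g j) + d \<le> M"
    using translatable_exprs[of m d M s ES "length gs" g] snoc.prems[of "length gs"] by auto
  then have "length (block d M s (gate_exprs ES g)) = s * M"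
    by (intro length_block) (auto dest: add_leD1)
  moreover have "length (translate d M s ES 0 gs) = length gs * (s * M)"
    by (rule snoc.IH[OF tr])
  ultimately show ?case by (simp add: translate_append)
qed simp

text \<open>At the ends of the slots the values obey a recursion along the source circuit, in which
  the interior of the blocks no longer occurs. It holds in any semantics and so serves for values
  and for depths; \<open>u\<close> is arbitrary because expressions of proper gates contain no
  \<open>EIn\<close>.\<close>

lemma translate_values:
  assumes "\<And>i. i < length gs \<Longrightarrow> translatable m d M s ES i (gs ! i)"
    and "\<And>i j. v i j = gate_values sem inp (translate d M s ES 0 gs) ! (i * (s * M) + (j * M + (M - 1)))"
    and "i < length gs" and "j < s"
  shows "v i j = (case gs ! i of Input c \<Rightarrow> inp (s * c + j)
    | Gate l ws \<Rightarrow> expr_val sem (\<lambda>_. u) (\<lambda>a. v (ws ! a)) (ES l j))"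
  using assms
proof (induction gs arbitrary: v i j rule: rev_induct)
  case (snoc g gs)
  let ?k = "length gs" and ?N = "s * M"
  define vs where "vs = gate_values sem inp (translate d M s ES 0 gs)"
  have tr: "translatable m d M s ES i (gs ! i)" if "i < length gs" for i
    using snoc.prems(1)[of i] that by (simp add: nth_append)
  have tg: "translatable m d M s ES ?k g"
    using snoc.prems(1)[of ?k] by simp
  have lvs: "length vs = ?k * ?N"
    using length_translate[OF tr] by (simp add: vs_def)
  obtain n r where nr: "\<And>j. j < s \<Longrightarrow> expr_ok m n r s (gate_exprs ES g j)"
    "\<And>j. j < s \<Longrightarrow> esize (gate_exprs ES g j) + d \<le> M"
    "\<And>a j. a < r \<Longrightarrow> j < s \<Longrightarrow> gate_base ?N s ?k g (Suc a) + (j * M + (M - 1)) < ?k * ?N"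
    "\<And>l ws. g = Gate l ws \<Longrightarrow> r = length ws \<and> n = 0"
    "\<And>c. g = Input c \<Longrightarrow> r = 0 \<and> n = s"
    by (rule translatable_exprs[OF tg]) blast
  have base0: "gate_base ?N s ?k g 0 = ?k * ?N"
    by (cases g) auto
  let ?E = "\<lambda>a j. vs ! (gate_base ?N s ?k g (Suc a) + (j * M + (M - 1)))"
  obtain ws' where ws': "extend_values sem inp vs
      (map (inst (gate_base ?N s ?k g)) (block d M s (gate_exprs ES g))) = vs @ ws'"
    "length ws' = s * M" "\<forall>j<s. ws' ! (j * M + (M - 1)) =
       expr_val sem (\<lambda>c. inp (gate_base ?N s ?k g 1 + c)) ?E (gate_exprs ES g j)"
    using block_values[of s m n r s "gate_exprs ES g" M vs "gate_base ?N s ?k g" sem inp d]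
      nr base0 lvs by (auto dest: add_leD1)
  have v: "v i j = (vs @ ws') ! (i * ?N + (j * M + (M - 1)))" for i j
    using snoc.prems(2) ws'(1) by (simp add: translate_append gate_values_append vs_def)
  have M: "M > 0"
    using nr(2)[OF snoc.prems(4)] esize_pos[of "gate_exprs ES g j"] by linarith
  have old: "v i j = vs ! (i * ?N + (j * M + (M - 1)))" if "i < ?k" "j < s" for i j
  proof -
    have "i * ?N + (j * M + (M - 1)) < Suc i * ?N"
      using slot_end_less[OF that(2) M] by simp
    also have "\<dots> \<le> ?k * ?N"
      using that(1) by (intro mult_right_mono) auto
    finally show ?thesis using lvs by (simp add: v nth_append)
  qed
  show ?case
  proof (cases "i < ?k")
    case True
    define v' where "v' i j = vs ! (i * ?N + (j * M + (M - 1)))" for i j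
    have "v' i j = (case gs ! i of Input c \<Rightarrow> inp (s * c + j)
      | Gate l ws \<Rightarrow> expr_val sem (\<lambda>_. u) (\<lambda>a. v' (ws ! a)) (ES l j))"
      by (rule snoc.IH[OF tr _ True snoc.prems(4)]) (simp_all add: v'_def vs_def)
    moreover have "expr_val sem (\<lambda>_. u) (\<lambda>a. v' (ws ! a)) (ES l j) =
        expr_val sem (\<lambda>_. u) (\<lambda>a. v (ws ! a)) (ES l j)" if "gs ! i = Gate l ws" for l ws
    proof (rule expr_val_cong)
      show "expr_ok m 0 (length ws) s (ES l j)"
        using tr[OF True] that snoc.prems(4) by (simp add: translatable_def)
      show "v' (ws ! a) j = v (ws ! a) j" if "a < length ws" "j < s" for a j
      proof -
        have "ws ! a < ?k"
          using tr[OF True] \<open>gs ! i = Gate l ws\<close> that True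
          by (auto simp: translatable_def all_set_conv_all_nth)
        then show ?thesis
          using old that by (simp add: v'_def)
      qed
    qed simp
    ultimately show ?thesis
      using old[OF True snoc.prems(4)] True by (auto simp: v'_def nth_append split: gate.split)
  next
    case False
    then have i: "i = ?k" using snoc.prems(3) by simp
    have *: "v i j = expr_val sem (\<lambda>c. inp (gate_base ?N s ?k g 1 + c)) ?E (gate_exprs ES g j)"
      using ws'(3) snoc.prems(4) lvs by (simp add: v i nth_append)
    show ?thesis
    proof (cases g)
      case (Input c)
      then show ?thesis using * i by (simp add: nth_append)
    next
      case (Gate l ws)
      have "v i j = expr_val sem (\<lambda>_. u) (\<lambda>a. v (ws ! a)) (ES l j)"
        unfolding * Gate gate_exprs.simps
      proof (rule expr_val_cong)
        show "expr_ok m 0 (length ws) s (ES l j)"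
          using tg Gate snoc.prems(4) by (simp add: translatable_def)
        show "vs ! (gate_base ?N s ?k (Gate l ws) (Suc a) + (j * M + (M - 1))) = v (ws ! a) j"
          if "a < length ws" "j < s" for a j
          using tg Gate that by (subst old) (auto simp: translatable_def all_set_conv_all_nth)
      qed simp
      then show ?thesis using i Gate by (simp add: nth_append)
    qed
  qed
qed simp

text \<open>Only the ends of the slots need to be controlled: within a slot the code is no deeper
  than its end, and the chain climbs exactly to \<open>d\<close>.\<close>

lemma translate_depth:
  assumes "\<And>i. i < length gs \<Longrightarrow> translatable m d M s ES i (gs ! i)"
    and "\<And>i j. i < length gs \<Longrightarrow> j < s \<Longrightarrow>
      gate_values depth_sem (\<lambda>_. 0) (translate d M s ES 0 gs) ! (i * (s * M) + (j * M + (M - 1))) \<le> d"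
  shows "(\<forall>w\<in>set (gate_values depth_sem (\<lambda>_. 0) (translate d M s ES 0 gs)). w \<le> d) \<and>
    (gs = [] \<or> s = 0 \<or> d = 0 \<or> d \<in> set (gate_values depth_sem (\<lambda>_. 0) (translate d M s ES 0 gs)))"
  using assms
proof (induction gs rule: rev_induct)
  case (snoc g gs)
  let ?k = "length gs" and ?N = "s * M"
  define vs where "vs = gate_values depth_sem (\<lambda>_. 0) (translate d M s ES 0 gs)"
  have tr: "translatable m d M s ES i (gs ! i)" if "i < length gs" for i
    using snoc.prems(1)[of i] that by (simp add: nth_append)
  have tg: "translatable m d M s ES ?k g"
    using snoc.prems(1)[of ?k] by simp
  have lvs: "length vs = ?k * ?N"
    using length_translate[OF tr] by (simp add: vs_def)
  obtain n r where nr: "\<And>j. j < s \<Longrightarrow> expr_ok m n r s (gate_exprs ES g j)"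
    "\<And>j. j < s \<Longrightarrow> esize (gate_exprs ES g j) + d \<le> M"
    "\<And>a j. a < r \<Longrightarrow> j < s \<Longrightarrow> gate_base ?N s ?k g (Suc a) + (j * M + (M - 1)) < ?k * ?N"
    by (rule translatable_exprs[OF tg]) blast
  have base0: "gate_base ?N s ?k g 0 = ?k * ?N"
    by (cases g) auto
  obtain ws' where ws': "extend_values depth_sem (\<lambda>_. 0) vs
      (map (inst (gate_base ?N s ?k g)) (block d M s (gate_exprs ES g))) = vs @ ws'"
    "length ws' = s * M"
    using block_values[of s m n r s "gate_exprs ES g" M vs "gate_base ?N s ?k g" depth_sem "\<lambda>_. 0" d]
      nr base0 lvs by (auto dest: add_leD1)
  have all: "gate_values depth_sem (\<lambda>_. 0) (translate d M s ES 0 (gs @ [g])) = vs @ ws'"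
    using ws'(1) by (simp add: translate_append gate_values_append vs_def)
  have "vs ! (i * ?N + (j * M + (M - 1))) \<le> d" if "i < ?k" "j < s" for i j
  proof -
    have M: "M > 0"
      using nr(2)[OF that(2)] esize_pos[of "gate_exprs ES g j"] by linarith
    have "i * ?N + (j * M + (M - 1)) < Suc i * ?N"
      using slot_end_less[OF that(2) M] by simp
    also have "\<dots> \<le> ?k * ?N"
      using that(1) by (intro mult_right_mono) auto
    finally show ?thesis
      using snoc.prems(2)[of i j] that lvs unfolding all by (simp add: nth_append)
  qed
  then have "\<forall>w\<in>set vs. w \<le> d"
    using snoc.IH[OF tr] by (simp add: vs_def)
  moreover have "(\<forall>w\<in>set ws'. w \<le> d) \<and> (s = 0 \<or> d = 0 \<or> d \<in> set ws')"
  proof (rule block_depth[OF nr(1,2) _ _ ws'(1)])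
    show "ws' ! (j * M + (M - 1)) \<le> d" if "j < s" for j
      using snoc.prems(2)[of ?k j] that lvs unfolding all by (simp add: nth_append)
  qed (use nr(3) base0 lvs in auto)
  ultimately show ?case
    unfolding all by auto
qed (simp add: gate_values_def)

section \<open>Correctness of the translated circuit\<close>

text \<open>A relative form of \<open>wf_circuit\<close>, in which \<open>n\<close> gates are taken
  to precede the list; well-formedness can thus be checked block by block.\<close>

primrec wf_gates :: "('l \<Rightarrow> nat \<Rightarrow> bool) \<Rightarrow> nat \<Rightarrow> nat \<Rightarrow> 'l gate list \<Rightarrow> bool" where
  "wf_gates ok k n [] \<longleftrightarrow> True"
| "wf_gates ok k n (g # gs) \<longleftrightarrow> (case g of Input j \<Rightarrow> j < k
     | Gate l ws \<Rightarrow> ok l (length ws) \<and> (\<forall>w\<in>set ws. w < n)) \<and> wf_gates ok k (Suc n) gs"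

lemma wf_gates_append:
  "wf_gates ok k n (gs @ hs) \<longleftrightarrow> wf_gates ok k n gs \<and> wf_gates ok k (n + length gs) hs"
  by (induction gs arbitrary: n) auto

lemma wf_gates_nth:
  "wf_gates ok k n gs \<Longrightarrow> i < length gs \<Longrightarrow> (case gs ! i of Input j \<Rightarrow> j < k
     | Gate l ws \<Rightarrow> ok l (length ws) \<and> (\<forall>w\<in>set ws. w < n + i))"
proof (induction gs arbitrary: n i)
  case (Cons g gs)
  show ?case
  proof (cases i)
    case 0
    then show ?thesis using Cons.prems by (auto split: gate.splits)
  next
    case (Suc i')
    then show ?thesis using Cons.IH[of "Suc n" i'] Cons.prems by (auto split: gate.splits)
  qed
qed simp

lemma compile_wf:
  assumes "expr_ok m n r s e" and "\<And>c. c < n \<Longrightarrow> \<rho> 1 + c < q"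
    and "\<And>a j. a < r \<Longrightarrow> j < s \<Longrightarrow> \<rho> (Suc a) + (j * M + (M - 1)) < \<rho> 0 + k"
  shows "wf_gates (cc_label_ok m) q (\<rho> 0 + k) (map (inst \<rho>) (compile M k e))"
  using assms
proof (induction e arbitrary: k)
  case (EAdd e f)
  have "wf_gates (cc_label_ok m) q (\<rho> 0 + (k + esize e)) (map (inst \<rho>) (compile M (k + esize e) f))"
    using EAdd.prems by (intro EAdd.IH(2)) (auto simp: trans_less_add1 simp flip: add.assoc)
  then show ?case
    using EAdd esize_pos[of e] esize_pos[of f]
    by (simp add: wf_gates_append add.assoc del: esize_pos esize_neq_0)
next
  case (EMod e)
  then show ?case
    using esize_pos[of e] by (simp add: wf_gates_append del: esize_pos esize_neq_0)
qed auto

lemma slot_wf: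
  assumes "expr_ok m n r s e" and "\<And>c. c < n \<Longrightarrow> \<rho> 1 + c < q" and "esize e \<le> M"
    and refs: "\<And>a j. a < r \<Longrightarrow> j < s \<Longrightarrow> \<rho> (Suc a) + (j * M + (M - 1)) < \<rho> 0"
  shows "wf_gates (cc_label_ok m) q (\<rho> 0 + j * M) (map (inst \<rho>) (slot d M j e))"
proof -
  have pad: "wf_gates (cc_label_ok m) q (\<rho> 0 + k) (map (inst \<rho>) (pad d k n))" for k n
    by (induction n) (auto simp: pad_Suc wf_gates_append, simp add: pad_def)
  have "wf_gates (cc_label_ok m) q (\<rho> 0 + (j * M + (M - esize e)))
      (map (inst \<rho>) (compile M (j * M + (M - esize e)) e))"
    using compile_wf[where \<rho> = \<rho>, OF assms(1,2)] refs by (auto simp: trans_less_add1)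
  then show ?thesis
    using pad[of "j * M"] by (simp add: slot_def wf_gates_append add.assoc)
qed

lemma block_wf:
  assumes "\<And>j. j < t \<Longrightarrow> expr_ok m n r s (es j)" and "\<And>c. c < n \<Longrightarrow> \<rho> 1 + c < q"
    and "\<And>j. j < t \<Longrightarrow> esize (es j) \<le> M"
    and "\<And>a j. a < r \<Longrightarrow> j < s \<Longrightarrow> \<rho> (Suc a) + (j * M + (M - 1)) < \<rho> 0"
  shows "wf_gates (cc_label_ok m) q (\<rho> 0) (map (inst \<rho>) (block d M t es))"
  using assms(1,3)
proof (induction t)
  case (Suc t)
  have "wf_gates (cc_label_ok m) q (\<rho> 0 + t * M) (map (inst \<rho>) (slot d M t (es t)))"
    by (rule slot_wf[OF _ assms(2) _ assms(4)]) (use Suc.prems in auto)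
  then show ?case
    using Suc by (simp add: block_Suc wf_gates_append)
qed simp

lemma translate_wf:
  assumes "\<And>k. k < length gs \<Longrightarrow> translatable m d M s ES (i + k) (gs ! k)"
    and "\<And>c. Input c \<in> set gs \<Longrightarrow> c < q"
  shows "wf_gates (cc_label_ok m) (s * q) (i * (s * M)) (translate d M s ES i gs)"
  using assms
proof (induction gs arbitrary: i)
  case (Cons g gs)
  have g: "translatable m d M s ES i g"
    using Cons.prems(1)[of 0] by simp
  obtain n r where nr: "\<And>j. j < s \<Longrightarrow> expr_ok m n r s (gate_exprs ES g j)"
    "\<And>j. j < s \<Longrightarrow> esize (gate_exprs ES g j) + d \<le> M"
    "\<And>a j. a < r \<Longrightarrow> j < s \<Longrightarrow> gate_base (s * M) s i g (Suc a) + (j * M + (M - 1)) < i * (s * M)"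
    "\<And>l ws. g = Gate l ws \<Longrightarrow> r = length ws \<and> n = 0"
    "\<And>c. g = Input c \<Longrightarrow> r = 0 \<and> n = s"
    by (rule translatable_exprs[OF g]) blast
  have base0: "gate_base (s * M) s i g 0 = i * (s * M)"
    by (cases g) auto
  have size: "esize (gate_exprs ES g j) \<le> M" if "j < s" for j
    using nr(2)[OF that] by simp
  have "gate_base (s * M) s i g 1 + c < s * q" if "c < n" for c
  proof (cases g)
    case (Input c')
    then have "s * c' + c < s * Suc c'"
      using nr(5) that by simp
    also have "\<dots> \<le> s * q"
      using Cons.prems(2)[of c'] Input by (intro mult_left_mono) auto
    finally show ?thesis using Input by simp
  qed (use nr(4) that in auto)
  then have "wf_gates (cc_label_ok m) (s * q) (i * (s * M))
      (map (inst (gate_base (s * M) s i g)) (block d M s (gate_exprs ES g)))"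
    unfolding base0[symmetric]
    by (intro block_wf[where n = n and r = r]) (use nr(1,3) base0 size in auto)
  moreover have "wf_gates (cc_label_ok m) (s * q) (Suc i * (s * M)) (translate d M s ES (Suc i) gs)"
    using Cons.prems(1)[of "Suc k" for k] Cons.prems(2) by (intro Cons.IH) auto
  ultimately show ?case
    using size by (simp add: wf_gates_append add.commute)
qed simp

lemma translate_circuit_wf:
  assumes "\<And>i. i < length (gates C) \<Longrightarrow> translatable m d M s ES i (gates C ! i)"
    and "wf_circuit ok C" and "outs C \<noteq> []" and "M > 0"
  shows "cc_circuit m (translate_circuit d M s ES C)"
proof -
  have inp: "c < ninputs C" if c: "Input c \<in> set (gates C)" for c
  proof -
    obtain i where "i < length (gates C)" "gates C ! i = Input c"
      using c by (auto simp: in_set_conv_nth)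
    then show ?thesis
      using assms(2) unfolding wf_circuit_def by fastforce
  qed
  let ?gs = "translate d M s ES 0 (gates C)"
  have "wf_gates (cc_label_ok m) (s * ninputs C) 0 ?gs"
    using translate_wf[of "gates C" m d M s ES 0 "ninputs C"] assms(1) inp by simp
  then have "\<forall>i<length ?gs. case ?gs ! i of Input j \<Rightarrow> j < s * ninputs C
      | Gate l ws \<Rightarrow> cc_label_ok m l (length ws) \<and> (\<forall>w\<in>set ws. w < i)"
    using wf_gates_nth[of "cc_label_ok m" "s * ninputs C" 0 ?gs] unfolding add_0 by blast
  moreover have "hd (outs C) * (s * M) + (j * M + (M - 1)) < length ?gs" if "j < s" for j
  proof -
    have "hd (outs C) < length (gates C)"
      using assms(2,3) by (auto simp: wf_circuit_def)
    have "hd (outs C) * (s * M) + (j * M + (M - 1)) < Suc (hd (outs C)) * (s * M)"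
      using slot_end_less[OF that assms(4)] by simp
    also have "\<dots> \<le> length (gates C) * (s * M)"
      using \<open>hd (outs C) < length (gates C)\<close> by (intro mult_right_mono) auto
    finally show ?thesis
      using length_translate[OF assms(1)] by simp
  qed
  ultimately show ?thesis
    unfolding cc_circuit_def wf_circuit_def translate_circuit_def circuit.simps by auto
qed

lemma gate_value_append:
  assumes "\<And>l ws w. g = Gate l ws \<Longrightarrow> w \<in> set ws \<Longrightarrow> w < length vs"
  shows "gate_value sem inp (vs @ us) g = gate_value sem inp vs g"
proof (cases g)
  case (Gate l ws)
  then have "map ((!) (vs @ us)) ws = map ((!) vs) ws"
    using assms by (simp add: nth_append)
  then show ?thesis using Gate by (simp only: gate_value.simps)
qed simp

text \<open>Wires lead backwards, so a gate may as well be evaluated in the complete list of values.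
  This gives the source circuit a recursion by gate number that matches the one of
  \<open>translate_values\<close>.\<close>

lemma gate_values_nth:
  assumes "\<And>i l ws w. i < length gs \<Longrightarrow> gs ! i = Gate l ws \<Longrightarrow> w \<in> set ws \<Longrightarrow> w < i"
    and "i < length gs"
  shows "gate_values sem inp gs ! i = gate_value sem inp (gate_values sem inp gs) (gs ! i)"
  using assms
proof (induction gs rule: rev_induct)
  case (snoc g gs)
  let ?vs = "gate_values sem inp gs"
  have vs: "gate_values sem inp (gs @ [g]) = ?vs @ [gate_value sem inp ?vs g]"
    by (simp add: gate_values_append)
  have app: "gate_value sem inp (?vs @ us) ((gs @ [g]) ! i) = gate_value sem inp ?vs ((gs @ [g]) ! i)" for us
    using snoc.prems(1)[OF snoc.prems(2)] snoc.prems(2) by (intro gate_value_append) fastforce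
  show ?case
  proof (cases "i < length gs")
    case True
    have "?vs ! i = gate_value sem inp ?vs (gs ! i)"
    proof (rule snoc.IH[OF _ True])
      show "w < i" if "i < length gs" "gs ! i = Gate l ws" "w \<in> set ws" for i l ws w
        using snoc.prems(1)[of i l ws w] that by (simp add: nth_append)
    qed
    then show ?thesis
      using True app by (simp add: vs nth_append)
  next
    case False
    then show ?thesis
      using snoc.prems(2) app by (simp add: vs nth_append less_Suc_eq)
  qed
qed simp

text \<open>Source and target obey the same recursion by gate number, so strong induction compares
  them. The expressions are assumed to implement the operations only on \<open>S\<close>, hence
  membership in \<open>S\<close> is carried along.\<close>

lemma translate_correct:
  assumes tr: "\<And>i. i < length gs \<Longrightarrow> translatable m d M s ES i (gs ! i)"
    and inp: "\<And>c j. Input c \<in> set gs \<Longrightarrow> j < s \<Longrightarrow> inp' (s * c + j) = emb (inp c) j"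
      "\<And>c. Input c \<in> set gs \<Longrightarrow> inp c \<in> S"
    and gate: "\<And>l ws vs j. Gate l ws \<in> set gs \<Longrightarrow> length vs = length ws \<Longrightarrow> set vs \<subseteq> S \<Longrightarrow> j < s \<Longrightarrow>
      expr_val (cc_sem m) (\<lambda>_. 0) (\<lambda>a. emb (vs ! a)) (ES l j) = emb (sem l vs) j"
      "\<And>l ws vs. Gate l ws \<in> set gs \<Longrightarrow> length vs = length ws \<Longrightarrow> set vs \<subseteq> S \<Longrightarrow> sem l vs \<in> S"
    and "i < length gs"
  shows "gate_values sem inp gs ! i \<in> S \<and> (\<forall>j<s. gate_values (cc_sem m) inp' (translate d M s ES 0 gs) !
     (i * (s * M) + (j * M + (M - 1))) = emb (gate_values sem inp gs ! i) j)"
proof -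
  define v where "v i j = gate_values (cc_sem m) inp' (translate d M s ES 0 gs) !
     (i * (s * M) + (j * M + (M - 1)))" for i j
  define u where "u = gate_values sem inp gs"
  have wires: "w < i" if "i < length gs" "gs ! i = Gate l ws" "w \<in> set ws" for i l ws w
    using tr[OF that(1)] that by (auto simp: translatable_def)
  have u: "u ! i = gate_value sem inp u (gs ! i)" if "i < length gs" for i
    unfolding u_def by (rule gate_values_nth[OF wires that])
  have v: "v i j = (case gs ! i of Input c \<Rightarrow> inp' (s * c + j)
      | Gate l ws \<Rightarrow> expr_val (cc_sem m) (\<lambda>_. 0) (\<lambda>a. v (ws ! a)) (ES l j))" if "i < length gs" "j < s" for i j
    by (rule translate_values[OF tr v_def that])
  have "u ! i \<in> S \<and> (\<forall>j<s. v i j = emb (u ! i) j)"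
    using assms(6)
  proof (induction i rule: less_induct)
    case (less i)
    have mem: "gs ! i \<in> set gs" using less.prems by simp
    show ?case
    proof (cases "gs ! i")
      case (Input c)
      then show ?thesis
        using u[OF less.prems] v[OF less.prems] inp mem by simp
    next
      case (Gate l ws)
      let ?vs = "map ((!) u) ws"
      have IH: "u ! w \<in> S \<and> (\<forall>j<s. v w j = emb (u ! w) j)" if "w \<in> set ws" for w
        using less.IH wires[OF less.prems Gate that] less.prems by simp
      then have S: "set ?vs \<subseteq> S" by auto
      have uv: "u ! i = sem l ?vs" using u[OF less.prems] Gate by simp
      have "v i j = emb (u ! i) j" if "j < s" for j
      proof -
        have "v i j = expr_val (cc_sem m) (\<lambda>_. 0) (\<lambda>a. v (ws ! a)) (ES l j)"
          using v[OF less.prems that] Gate by simp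
        also have "\<dots> = expr_val (cc_sem m) (\<lambda>_. 0) (\<lambda>a. emb (?vs ! a)) (ES l j)"
        proof (rule expr_val_cong)
          show "expr_ok m 0 (length ws) s (ES l j)"
            using tr[OF less.prems] Gate that by (simp add: translatable_def)
          show "v (ws ! a) j' = emb (?vs ! a) j'" if "a < length ws" "j' < s" for a j'
            using IH[of "ws ! a"] that by simp
        qed simp
        also have "\<dots> = emb (u ! i) j"
          unfolding uv using mem Gate S that by (intro gate(1)) auto
        finally show ?thesis .
      qed
      moreover have "u ! i \<in> S"
        unfolding uv using mem Gate S by (intro gate(2)) auto
      ultimately show ?thesis by blast
    qed
  qed
  then show ?thesis by (simp add: u_def v_def)
qed

text \<open>The expressions of every label preserve the bound \<open>D\<close>, whatever the number
  of the gate, so it holds throughout the circuit independently of its length. That \<open>d\<close>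
  is attained is due to the chains, which exist once there is a gate and a coordinate.\<close>

lemma translate_essential_depth:
  assumes tr: "\<And>i. i < length (gates C) \<Longrightarrow> translatable m d M s ES i (gates C ! i)"
    and "gates C \<noteq> []" and "s > 0" and D: "\<And>j. j < s \<Longrightarrow> D j \<le> d"
    and ES: "\<And>l ws j. Gate l ws \<in> set (gates C) \<Longrightarrow> j < s \<Longrightarrow>
      expr_val depth_sem (\<lambda>_. 0) (\<lambda>_. D) (ES l j) \<le> D j"
  shows "essential_depth (translate_circuit d M s ES C) = d"
proof -
  let ?vs = "gate_values depth_sem (\<lambda>_. 0) (translate d M s ES 0 (gates C))"
  define v where "v i j = ?vs ! (i * (s * M) + (j * M + (M - 1)))" for i j
  have v: "v i j = (case gates C ! i of Input c \<Rightarrow> 0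
      | Gate l ws \<Rightarrow> expr_val depth_sem (\<lambda>_. 0) (\<lambda>a. v (ws ! a)) (ES l j))" if "i < length (gates C)" "j < s" for i j
    by (rule translate_values[OF tr v_def that])
  have vD: "v i j \<le> D j" if "i < length (gates C)" "j < s" for i j
    using that
  proof (induction i arbitrary: j rule: less_induct)
    case (less i)
    show ?case
    proof (cases "gates C ! i")
      case (Gate l ws)
      have "v i j = expr_val depth_sem (\<lambda>_. 0) (\<lambda>a. v (ws ! a)) (ES l j)"
        using v[OF less.prems] Gate by simp
      also have "\<dots> \<le> expr_val depth_sem (\<lambda>_. 0) (\<lambda>_. D) (ES l j)"
      proof (rule expr_val_depth_mono)
        show "expr_ok m 0 (length ws) s (ES l j)"
          using tr[OF less.prems(1)] Gate less.prems(2) by (simp add: translatable_def)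
        show "v (ws ! a) j' \<le> D j'" if "a < length ws" "j' < s" for a j'
        proof (rule less.IH)
          show "ws ! a < i"
            using tr[OF less.prems(1)] Gate that by (auto simp: translatable_def all_set_conv_all_nth)
          then show "ws ! a < length (gates C)" using less.prems by simp
        qed (rule that)
      qed simp
      also have "\<dots> \<le> D j"
        using ES[of l ws j] Gate less.prems by (metis nth_mem)
      finally show ?thesis .
    qed (simp add: v[OF less.prems])
  qed
  have "(\<forall>w\<in>set ?vs. w \<le> d) \<and> (gates C = [] \<or> s = 0 \<or> d = 0 \<or> d \<in> set ?vs)"
  proof (rule translate_depth[OF tr])
    fix i j assume "i < length (gates C)" "j < s"
    then show "?vs ! (i * (s * M) + (j * M + (M - 1))) \<le> d"
      unfolding v_def[symmetric] using vD D le_trans by blast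
  qed
  then have "\<forall>w\<in>set ?vs. w \<le> d" "d \<in> set (0 # ?vs)"
    using assms(2,3) by auto
  then have "Max (set (0 # ?vs)) = d"
    by (intro Max_eqI) auto
  then show ?thesis
    by (simp add: essential_depth_def translate_circuit_def)
qed

lemma nth_concat_uniform:
  "(\<And>xs. xs \<in> set xss \<Longrightarrow> length xs = s) \<Longrightarrow> i < length xss \<Longrightarrow> j < s \<Longrightarrow>
    concat xss ! (s * i + j) = xss ! i ! j"
proof (induction xss arbitrary: i)
  case (Cons xs xss)
  then show ?case
    by (cases i) (auto simp: nth_append algebra_simps)
qed simp

section \<open>The translation in linear time\<close>

text \<open>Total correctness with a time bound: the final tapes are given exactly, the final memory
  only through a predicate.\<close>

definition runs :: "com \<Rightarrow> nat \<Rightarrow> config \<Rightarrow> nat list \<Rightarrow> nat list \<Rightarrow> ((nat \<Rightarrow> nat) \<Rightarrow> bool) \<Rightarrow> bool" where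
  "runs P \<tau> c inp out Q \<longleftrightarrow> (\<exists>t \<mu>. t \<le> \<tau> \<and> exec P c t (\<mu>, inp, out) \<and> Q \<mu>)"

lemma runs_mono:
  assumes "runs P \<tau> c inp out Q" and "\<tau> \<le> \<tau>'" and "\<And>\<mu>. Q \<mu> \<Longrightarrow> Q' \<mu>"
  shows "runs P \<tau>' c inp out Q'"
  using assms unfolding runs_def by (meson le_trans)

lemma runs_Seq:
  assumes "runs P \<tau> c inp out Q" and "\<And>\<mu>. Q \<mu> \<Longrightarrow> runs P' \<tau>' (\<mu>, inp, out) inp' out' Q'"
  shows "runs (Seq P P') (\<tau> + \<tau>') c inp' out' Q'"
proof -
  obtain t \<mu> where 1: "t \<le> \<tau>" "exec P c t (\<mu>, inp, out)" "Q \<mu>"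
    using assms(1) unfolding runs_def by blast
  obtain t' \<mu>' where 2: "t' \<le> \<tau>'" "exec P' (\<mu>, inp, out) t' (\<mu>', inp', out')" "Q' \<mu>'"
    using assms(2)[OF 1(3)] unfolding runs_def by blast
  show ?thesis
    unfolding runs_def using 1 2 exec.intros(9)[OF 1(2) 2(2)] add_mono[OF 1(1) 2(1)] by blast
qed

lemma runs_Skip: "Q \<mu> \<Longrightarrow> runs Skip 1 (\<mu>, inp, out) inp out Q"
  unfolding runs_def using exec.intros(8) by blast

lemma runs_step:
  assumes "exec I c 1 (\<mu>', inp, out)" and "runs P \<tau> (\<mu>', inp, out) inp' out' Q"
  shows "runs (Seq I P) (1 + \<tau>) c inp' out' Q"
  by (rule runs_Seq[where Q = "\<lambda>\<mu>. \<mu> = \<mu>'"]) (use assms in \<open>auto simp: runs_def\<close>)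

lemmas runs_SetC = runs_step[OF exec.intros(1)]
lemmas runs_Add = runs_step[OF exec.intros(2)]
lemmas runs_Sub = runs_step[OF exec.intros(3)]
lemmas runs_Read = runs_step[OF exec.intros(6)]
lemmas runs_Write = runs_step[OF exec.intros(7)]

lemma runs_IfNZ:
  assumes "runs (if \<mu> i \<noteq> 0 then P else P') \<tau> (\<mu>, inp, out) inp' out' Q"
  shows "runs (IfNZ i P P') (Suc \<tau>) (\<mu>, inp, out) inp' out' Q"
  using assms exec.intros(10)[of \<mu> i P inp out _ _ P'] exec.intros(11)[of \<mu> i P' inp out _ _ P]
  unfolding runs_def by (auto split: if_splits) (metis Suc_le_mono)+

lemma runs_While_0: "\<mu> i = 0 \<Longrightarrow> Q \<mu> \<Longrightarrow> runs (WhileNZ i P) 1 (\<mu>, inp, out) inp out Q"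
  unfolding runs_def using exec.intros(12) by blast

lemma runs_While_Suc:
  assumes "\<mu> i \<noteq> 0" and "runs P \<tau> (\<mu>, inp, out) inp' out' Q"
    and "\<And>\<mu>'. Q \<mu>' \<Longrightarrow> runs (WhileNZ i P) \<tau>' (\<mu>', inp', out') inp'' out'' Q'"
  shows "runs (WhileNZ i P) (Suc (\<tau> + \<tau>')) (\<mu>, inp, out) inp'' out'' Q'"
proof -
  obtain t \<mu>1 where 1: "t \<le> \<tau>" "exec P (\<mu>, inp, out) t (\<mu>1, inp', out')" "Q \<mu>1"
    using assms(2) unfolding runs_def by blast
  obtain t' \<mu>2 where 2: "t' \<le> \<tau>'" "exec (WhileNZ i P) (\<mu>1, inp', out') t' (\<mu>2, inp'', out'')" "Q' \<mu>2"
    using assms(3)[OF 1(3)] unfolding runs_def by blast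
  have "Suc (t + t') \<le> Suc (\<tau> + \<tau>')" using 1(1) 2(1) by simp
  then show ?thesis
    unfolding runs_def using exec.intros(13)[of \<mu> i P inp out t _ t', OF assms(1) 1(2) 2(2)] 2(3) by blast
qed

text \<open>The machine cannot multiply, but all factors that occur, \<open>s\<close> and
  \<open>s * M\<close>, are constants of the program; unrolled additions take constant time.\<close>

primrec mul :: "nat \<Rightarrow> nat \<Rightarrow> nat \<Rightarrow> com" where
  "mul i j 0 = SetC i 0"
| "mul i j (Suc n) = Seq (mul i j n) (com.Add i i j)"

lemma exec_mul:
  assumes "i \<noteq> j"
  shows "exec (mul i j n) (\<mu>, inp, out) (Suc n) (\<mu>(i := \<mu> j * n), inp, out)"
proof (induction n)
  case 0
  show ?case
    unfolding mul.simps mult_0_right One_nat_def[symmetric] by (rule exec.intros)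
next
  case (Suc n)
  let ?\<mu> = "\<mu>(i := \<mu> j * n)"
  have eq: "?\<mu>(i := ?\<mu> i + ?\<mu> j) = \<mu>(i := \<mu> j * Suc n)"
    using assms by (auto simp: fun_eq_iff)
  have "exec (mul i j (Suc n)) (\<mu>, inp, out) (Suc n + 1) (?\<mu>(i := ?\<mu> i + ?\<mu> j), inp, out)"
    unfolding mul.simps by (rule exec.intros(9)[OF Suc exec.intros(2)])
  then show ?case
    unfolding eq by (simp only: Suc_eq_plus1)
qed

lemma runs_mul:
  assumes "i \<noteq> j" and "runs P \<tau> (\<mu>(i := \<mu> j * n), inp, out) inp' out' Q"
  shows "runs (Seq (mul i j n) P) (Suc n + \<tau>) (\<mu>, inp, out) inp' out' Q"
  by (rule runs_Seq[where Q = "\<lambda>\<mu>'. \<mu>' = \<mu>(i := \<mu> j * n)"])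
    (use assms exec_mul[OF assms(1)] in \<open>auto simp: runs_def\<close>)

text \<open>A pair \<open>(r, c)\<close> writes the content of register \<open>r\<close> plus
  \<open>c\<close>. Register 0 is the scratch register, so the pairs have to avoid it.\<close>

primrec emit :: "(nat \<times> nat) list \<Rightarrow> com" where
  "emit [] = Skip"
| "emit (rc # rcs) = Seq (SetC 0 (snd rc)) (Seq (com.Add 0 0 (fst rc)) (Seq (Write 0) (emit rcs)))"

lemma runs_emit:
  assumes "\<And>rc. rc \<in> set rcs \<Longrightarrow> fst rc \<noteq> 0"
  shows "runs (emit rcs) (3 * length rcs + 1) (\<mu>, inp, out) inp (out @ map (\<lambda>(r, c). \<mu> r + c) rcs)
    (\<lambda>\<mu>'. \<forall>r. r \<noteq> 0 \<longrightarrow> \<mu>' r = \<mu> r)"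
  using assms
proof (induction rcs arbitrary: \<mu> out)
  case Nil
  then show ?case by (auto intro: runs_Skip[simplified])
next
  case (Cons rc rcs)
  obtain r c where rc: "rc = (r, c)" by force
  have r: "r \<noteq> 0" using Cons.prems[of rc] rc by simp
  define \<mu>' where "\<mu>' = \<mu>(0 := c, 0 := c + \<mu> r)"
  have "map (\<lambda>(r, c). \<mu>' r + c) rcs = map (\<lambda>(r, c). \<mu> r + c) rcs"
    using Cons.prems by (force simp: \<mu>'_def)
  then have eq: "(out @ [\<mu>' 0]) @ map (\<lambda>(r, c). \<mu>' r + c) rcs = out @ map (\<lambda>(r, c). \<mu> r + c) (rc # rcs)"
    by (simp add: rc \<mu>'_def add.commute)
  have "runs (emit rcs) (3 * length rcs + 1) (\<mu>', inp, out @ [\<mu>' 0]) inp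
      ((out @ [\<mu>' 0]) @ map (\<lambda>(r, c). \<mu>' r + c) rcs) (\<lambda>\<mu>''. \<forall>r. r \<noteq> 0 \<longrightarrow> \<mu>'' r = \<mu>' r)"
    by (rule Cons.IH) (use Cons.prems in simp)
  then have "runs (emit rcs) (3 * length rcs + 1) (\<mu>', inp, out @ [\<mu>' 0]) inp
      (out @ map (\<lambda>(r, c). \<mu> r + c) (rc # rcs)) (\<lambda>\<mu>''. \<forall>r. r \<noteq> 0 \<longrightarrow> \<mu>'' r = \<mu> r)"
    unfolding eq by (rule runs_mono) (simp_all add: \<mu>'_def)
  then have "runs (emit (rc # rcs)) (1 + (1 + (1 + (3 * length rcs + 1)))) (\<mu>, inp, out) inp
      (out @ map (\<lambda>(r, c). \<mu> r + c) (rc # rcs)) (\<lambda>\<mu>''. \<forall>r. r \<noteq> 0 \<longrightarrow> \<mu>'' r = \<mu> r)"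
    unfolding emit.simps rc fst_conv snd_conv
    by (intro runs_SetC runs_Add runs_Write) (use r in \<open>simp add: \<mu>'_def\<close>)
  then show ?case by (simp add: numeral_3_eq_3)
qed

text \<open>Register \<open>10 + a\<close> receives the start of the block of the \<open>a\<close>-th argument.\<close>

primrec read_args :: "nat \<Rightarrow> nat \<Rightarrow> com" where
  "read_args N 0 = Skip"
| "read_args N (Suc r) = Seq (read_args N r) (Seq (Read 0) (Seq (mul (10 + r) 0 N) Skip))"

lemma runs_read_args:
  assumes "r \<le> length ws"
  shows "runs (read_args N r) (1 + r * (N + 3)) (\<mu>, ws @ inp, out) (drop r ws @ inp) out
    (\<lambda>\<mu>'. (\<forall>a<r. \<mu>' (10 + a) = ws ! a * N) \<and> (\<forall>k. 0 < k \<longrightarrow> k < 10 \<longrightarrow> \<mu>' k = \<mu> k))"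
  using assms
proof (induction r)
  case 0
  then show ?case by (auto intro: runs_Skip[simplified])
next
  case (Suc r)
  let ?Q = "\<lambda>r \<mu>'. (\<forall>a<r. \<mu>' (10 + a) = ws ! a * N) \<and> (\<forall>k. 0 < k \<longrightarrow> k < 10 \<longrightarrow> \<mu>' k = \<mu> k)"
  have drop: "drop r ws = ws ! r # drop (Suc r) ws"
    using Suc.prems by (simp add: Cons_nth_drop_Suc)
  have "runs (read_args N (Suc r)) (1 + r * (N + 3) + (1 + (Suc N + 1))) (\<mu>, ws @ inp, out)
      (drop (Suc r) ws @ inp) out (?Q (Suc r))"
    unfolding read_args.simps
  proof (rule runs_Seq[OF Suc.IH])
    fix \<mu>' assume \<mu>': "?Q r \<mu>'"
    show "runs (Seq (Read 0) (Seq (mul (10 + r) 0 N) Skip)) (1 + (Suc N + 1))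
        (\<mu>', drop r ws @ inp, out) (drop (Suc r) ws @ inp) out (?Q (Suc r))"
      unfolding drop append_Cons
      by (intro runs_Read runs_mul runs_Skip) (use \<mu>' in \<open>auto simp: less_Suc_eq\<close>)
  qed (use Suc.prems in simp)
  then show ?case by (rule runs_mono) auto
qed

text \<open>Register 3 holds the tag; registers 4 to 6 serve to compare it with the constants.\<close>

primrec dispatch :: "(nat \<times> com) list \<Rightarrow> com" where
  "dispatch [] = Skip"
| "dispatch (cP # cPs) = Seq (SetC 4 (fst cP)) (Seq (com.Sub 5 3 4) (Seq (com.Sub 6 4 3)
     (Seq (com.Add 5 5 6) (IfNZ 5 (dispatch cPs) (snd cP)))))"

lemma runs_dispatch:
  assumes "(\<mu> 3, P) \<in> set cPs" and "distinct (map fst cPs)"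
    and "\<And>\<mu>'. (\<And>k. k \<notin> {4, 5, 6} \<Longrightarrow> \<mu>' k = \<mu> k) \<Longrightarrow> runs P \<tau> (\<mu>', inp, out) inp' out' Q"
  shows "runs (dispatch cPs) (\<tau> + 5 * length cPs) (\<mu>, inp, out) inp' out' Q"
  using assms
proof (induction cPs arbitrary: \<mu>)
  case (Cons cP cPs)
  obtain c P' where cP: "cP = (c, P')" by force
  \<comment> \<open>Subtraction is truncated, so the sum of the two differences is 0 exactly if the
    tag equals \<open>c\<close>, and only then does \<open>IfNZ\<close> take the matching
    branch.\<close>
  define \<mu>1 where "\<mu>1 = \<mu>(4 := c, 5 := \<mu> 3 - c, 6 := c - \<mu> 3, 5 := (\<mu> 3 - c) + (c - \<mu> 3))"
  have "runs (if \<mu>1 5 \<noteq> 0 then dispatch cPs else P') (\<tau> + 5 * length cPs) (\<mu>1, inp, out) inp' out' Q"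
  proof (cases "c = \<mu> 3")
    case True
    then have "P' = P"
      using Cons.prems(1,2) cP by force
    moreover have "runs P \<tau> (\<mu>1, inp, out) inp' out' Q"
      by (rule Cons.prems(3)) (auto simp: \<mu>1_def)
    ultimately show ?thesis
      using True by (auto simp: \<mu>1_def intro: runs_mono)
  next
    case False
    then have "runs (dispatch cPs) (\<tau> + 5 * length cPs) (\<mu>1, inp, out) inp' out' Q"
    proof (intro Cons.IH)
      show "(\<mu>1 3, P) \<in> set cPs" using Cons.prems(1) cP False by (auto simp: \<mu>1_def)
      show "runs P \<tau> (\<mu>', inp, out) inp' out' Q" if "\<And>k. k \<notin> {4, 5, 6} \<Longrightarrow> \<mu>' k = \<mu>1 k" for \<mu>'
        by (rule Cons.prems(3)) (simp add: that \<mu>1_def)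
    qed (use Cons.prems(2) in auto)
    moreover have "\<mu>1 5 \<noteq> 0" using False by (auto simp: \<mu>1_def)
    ultimately show ?thesis by simp
  qed
  then have "runs (dispatch (cP # cPs)) (1 + (1 + (1 + (1 + Suc (\<tau> + 5 * length cPs))))) (\<mu>, inp, out) inp' out' Q"
    unfolding dispatch.simps cP fst_conv snd_conv
    by (intro runs_SetC runs_Sub runs_Add runs_IfNZ) (simp add: \<mu>1_def)
  then show ?case by (rule runs_mono) auto
qed simp

text \<open>Register 8 remains \<open>0\<close>, and register \<open>9 + r\<close> holds \<open>\<rho> r\<close>.\<close>

primrec tgate_items :: "tgate \<Rightarrow> (nat \<times> nat) list" where
  "tgate_items (TIn c) = [(8, 0), (10, c)]"
| "tgate_items (TGate l ws) = [(8, Suc (cc_code l)), (8, length ws)] @ map (\<lambda>(r, c). (9 + r, c)) ws"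

text \<open>Guarantees that a template mentions only registers that have been loaded, up to
  \<open>9 + R\<close>; an input template uses register 10.\<close>

primrec tgate_bound :: "nat \<Rightarrow> tgate \<Rightarrow> bool" where
  "tgate_bound R (TIn c) \<longleftrightarrow> R \<ge> 1"
| "tgate_bound R (TGate l ws) \<longleftrightarrow> (\<forall>(r, c)\<in>set ws. r \<le> R)"

text \<open>Since register 8 contributes 0, tags and lengths can be emitted as pairs of the same
  form as wires.\<close>

lemma encode_inst:
  assumes "\<mu> 8 = 0" and "\<And>r. r \<le> R \<Longrightarrow> \<mu> (9 + r) = \<rho> r" and "tgate_bound R g"
  shows "encode_gate cc_code (inst \<rho> g) = map (\<lambda>(r, c). \<mu> r + c) (tgate_items g)"
  using assms assms(2)[of 1] by (cases g) (auto simp: case_prod_unfold)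

lemma compile_bound:
  assumes "expr_ok m n r s e" and "r \<le> R" and "n > 0 \<Longrightarrow> R \<ge> 1" and "g \<in> set (compile M k e)"
  shows "tgate_bound R g"
  using assms by (induction e arbitrary: k) auto

lemma block_bound:
  assumes "\<And>j. j < t \<Longrightarrow> expr_ok m n r s (es j)" and "r \<le> R" and "n > 0 \<Longrightarrow> R \<ge> 1"
    and "g \<in> set (block d M t es)"
  shows "tgate_bound R g"
  using assms compile_bound[OF assms(1) assms(2,3)]
  by (auto simp: block_def slot_def pad_def)

definition block_items :: "nat \<Rightarrow> nat \<Rightarrow> nat \<Rightarrow> (nat \<Rightarrow> expr) \<Rightarrow> (nat \<times> nat) list" where
  "block_items d M s es = concat (map tgate_items (block d M s es))"

lemma block_items_reg: "rc \<in> set (block_items d M s es) \<Longrightarrow> fst rc \<noteq> 0"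
proof -
  have "rc \<in> set (tgate_items g) \<Longrightarrow> fst rc \<noteq> 0" for g
    by (cases g) auto
  then show "rc \<in> set (block_items d M s es) \<Longrightarrow> fst rc \<noteq> 0"
    by (auto simp: block_items_def)
qed

lemma runs_block_items:
  assumes "\<mu> 8 = 0" and "\<And>r. r \<le> R \<Longrightarrow> \<mu> (9 + r) = \<rho> r"
    and "\<And>g. g \<in> set (block d M s es) \<Longrightarrow> tgate_bound R g"
  shows "runs (emit (block_items d M s es)) (3 * length (block_items d M s es) + 1) (\<mu>, inp, out) inp
    (out @ concat (map (encode_gate cc_code) (map (inst \<rho>) (block d M s es)))) (\<lambda>\<mu>'. \<forall>r. r \<noteq> 0 \<longrightarrow> \<mu>' r = \<mu> r)"
proof -
  have "map (encode_gate cc_code) (map (inst \<rho>) (block d M s es)) =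
      map (\<lambda>g. map (\<lambda>(r, c). \<mu> r + c) (tgate_items g)) (block d M s es)"
    using encode_inst[where \<mu> = \<mu> and R = R and \<rho> = \<rho>, OF assms(1,2)] assms(3) by simp
  then have "concat (map (encode_gate cc_code) (map (inst \<rho>) (block d M s es))) =
      concat (map (\<lambda>g. map (\<lambda>(r, c). \<mu> r + c) (tgate_items g)) (block d M s es))"
    by (rule arg_cong)
  also have "\<dots> = map (\<lambda>(r, c). \<mu> r + c) (block_items d M s es)"
    by (simp add: block_items_def map_concat comp_def)
  finally show ?thesis
    using runs_emit[of "block_items d M s es", OF block_items_reg] by (simp only:)
qed

definition input_com :: "nat \<Rightarrow> nat \<Rightarrow> nat \<Rightarrow> com" where
  "input_com d M s = Seq (Read 0) (Seq (mul 10 0 s) (emit (block_items d M s EIn)))"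

definition label_com :: "nat \<Rightarrow> nat \<Rightarrow> nat \<Rightarrow> ('l \<Rightarrow> nat \<Rightarrow> expr) \<Rightarrow> ('l \<Rightarrow> nat) \<Rightarrow> 'l \<Rightarrow> com" where
  "label_com d M s ES art l =
     Seq (Read 0) (Seq (read_args (s * M) (art l)) (emit (block_items d M s (ES l))))"

text \<open>Tag 0 belongs to \<open>Input\<close>, as labels are encoded by
  \<open>Suc (\<nu> l)\<close>. Register 1 counts the gates still to come, and register 9 advances
  by one block per gate.\<close>

definition gate_com where
  "gate_com d M s ES art \<nu> ls = Seq (Read 3)
     (Seq (IfNZ 3 (dispatch (map (\<lambda>l. (Suc (\<nu> l), label_com d M s ES art l)) ls)) (input_com d M s))
     (Seq (SetC 0 (s * M)) (Seq (com.Add 9 9 0) (Seq (SetC 0 1) (Seq (com.Sub 1 1 0) Skip)))))"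

definition label_time where
  "label_time d M s ES art l = 1 + (1 + art l * (s * M + 3) + (3 * length (block_items d M s (ES l)) + 1))"

definition input_time where
  "input_time d M s = 1 + (Suc s + (3 * length (block_items d M s EIn) + 1))"

text \<open>The sum over all labels dominates whichever branch is taken, which makes the bound a
  constant.\<close>

definition gate_time where
  "gate_time d M s ES art ls =
     1 + (Suc (input_time d M s + sum_list (map (label_time d M s ES art) ls) + 5 * length ls) +
     (1 + (1 + (1 + (1 + 1)))))"

lemma runs_gate:
  assumes tr: "translatable m d M s ES i g"
    and g: "\<And>l ws. g = Gate l ws \<Longrightarrow> l \<in> set ls \<and> length ws = art l"
    and ls: "distinct ls" "inj_on \<nu> (set ls)"
    and \<mu>: "\<mu> 8 = 0" "\<mu> 9 = i * (s * M)"
  shows "runs (gate_com d M s ES art \<nu> ls) (gate_time d M s ES art ls) (\<mu>, encode_gate \<nu> g @ inp, out) inp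
    (out @ concat (map (encode_gate cc_code) (map (inst (gate_base (s * M) s i g)) (block d M s (gate_exprs ES g)))))
    (\<lambda>\<mu>'. \<mu>' 8 = 0 \<and> \<mu>' 9 = Suc i * (s * M) \<and> \<mu>' 1 = \<mu> 1 - 1)"
proof -
  let ?out = "out @ concat (map (encode_gate cc_code)
    (map (inst (gate_base (s * M) s i g)) (block d M s (gate_exprs ES g))))"
  obtain n r where nr: "\<And>j. j < s \<Longrightarrow> expr_ok m n r s (gate_exprs ES g j)"
    "\<And>l ws. g = Gate l ws \<Longrightarrow> r = length ws \<and> n = 0"
    "\<And>c. g = Input c \<Longrightarrow> r = 0 \<and> n = s"
    by (rule translatable_exprs[OF tr]) blast
  let ?Q = "\<lambda>\<mu>'. \<mu>' 8 = 0 \<and> \<mu>' 9 = i * (s * M) \<and> \<mu>' 1 = \<mu> 1"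
  let ?cPs = "map (\<lambda>l. (Suc (\<nu> l), label_com d M s ES art l)) ls"
  let ?\<tau> = "input_time d M s + sum_list (map (label_time d M s ES art) ls) + 5 * length ls"
  have main: "runs (if tag \<noteq> 0 then dispatch ?cPs else input_com d M s) ?\<tau>
      (\<mu>(3 := tag), rest, out) inp ?out ?Q" if e: "encode_gate \<nu> g @ inp = tag # rest" for tag rest
  proof (cases g)
    case (Input c)
    then have tag: "tag = 0" "rest = c # inp" using e by auto
    have bound: "tgate_bound 1 h" if "h \<in> set (block d M s EIn)" for h
      by (rule block_bound[OF nr(1) _ _ that[folded gate_exprs.simps(1)[of ES c], folded Input]])
        (use nr(3) Input in auto)
    define \<mu>1 where "\<mu>1 = \<mu>(3 := 0, 0 := c, 10 := c * s)"
    have "runs (emit (block_items d M s EIn)) (3 * length (block_items d M s EIn) + 1) (\<mu>1, inp, out) inp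
        ?out (\<lambda>\<mu>'. \<forall>r. r \<noteq> 0 \<longrightarrow> \<mu>' r = \<mu>1 r)"
      unfolding Input gate_exprs.simps
      by (rule runs_block_items[where R = 1])
        (use \<mu> bound in \<open>auto simp: \<mu>1_def le_Suc_eq numeral_eq_Suc\<close>)
    then have "runs (emit (block_items d M s EIn)) (3 * length (block_items d M s EIn) + 1) (\<mu>1, inp, out) inp
        ?out ?Q"
      by (rule runs_mono) (use \<mu> in \<open>auto simp: \<mu>1_def\<close>)
    then have "runs (input_com d M s) (input_time d M s) (\<mu>(3 := tag), rest, out) inp ?out ?Q"
      unfolding input_com_def input_time_def tag
      by (intro runs_Read runs_mul) (simp_all add: \<mu>1_def)
    then show ?thesis
      using tag(1) by (auto intro: runs_mono)
  next
    case (Gate l ws)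
    then have tag: "tag = Suc (\<nu> l)" "rest = length ws # ws @ inp" using e by auto
    have l: "l \<in> set ls" "length ws = art l" using g[OF Gate] by auto
    have bound: "tgate_bound (art l) h" if "h \<in> set (block d M s (ES l))" for h
      by (rule block_bound[OF nr(1) _ _ that[folded gate_exprs.simps(2)[of ES l ws], folded Gate]])
        (use nr(2)[OF Gate] l in auto)
    have "runs (dispatch ?cPs) (label_time d M s ES art l + 5 * length ?cPs) (\<mu>(3 := tag), rest, out) inp ?out ?Q"
    proof (rule runs_dispatch)
      show "((\<mu>(3 := tag)) 3, label_com d M s ES art l) \<in> set ?cPs"
        using l tag by auto
      show "distinct (map fst ?cPs)"
        using ls by (auto simp: distinct_map comp_def inj_on_def)
      fix \<mu>' assume \<mu>': "\<And>k. k \<notin> {4, 5, 6} \<Longrightarrow> \<mu>' k = (\<mu>(3 := tag)) k"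
      show "runs (label_com d M s ES art l) (label_time d M s ES art l) (\<mu>', rest, out) inp ?out ?Q"
        unfolding label_com_def label_time_def tag
      proof (rule runs_Read, rule runs_Seq)
        show "runs (read_args (s * M) (art l)) (1 + art l * (s * M + 3)) (\<mu>'(0 := length ws), ws @ inp, out) inp out
          (\<lambda>\<mu>''. (\<forall>a<art l. \<mu>'' (10 + a) = ws ! a * (s * M)) \<and>
             (\<forall>k. 0 < k \<longrightarrow> k < 10 \<longrightarrow> \<mu>'' k = (\<mu>'(0 := length ws)) k))"
          using runs_read_args[of "art l" ws "s * M" "\<mu>'(0 := length ws)" inp out] l(2) by simp
        fix \<mu>'' assume \<mu>'': "(\<forall>a<art l. \<mu>'' (10 + a) = ws ! a * (s * M)) \<and>
             (\<forall>k. 0 < k \<longrightarrow> k < 10 \<longrightarrow> \<mu>'' k = (\<mu>'(0 := length ws)) k)"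
        have 8: "\<mu>'' 8 = 0" and 9: "\<mu>'' 9 = i * (s * M)" and 1: "\<mu>'' 1 = \<mu> 1"
          using \<mu>'' \<mu>' \<mu> by auto
        have regs: "\<mu>'' (9 + r) = gate_base (s * M) s i g r" if "r \<le> art l" for r
          using that \<mu>'' 9 by (cases r) (auto simp: Gate)
        have "runs (emit (block_items d M s (ES l))) (3 * length (block_items d M s (ES l)) + 1) (\<mu>'', inp, out) inp
           ?out (\<lambda>\<mu>3. \<forall>r. r \<noteq> 0 \<longrightarrow> \<mu>3 r = \<mu>'' r)"
          unfolding Gate gate_exprs.simps
          by (rule runs_block_items[where R = "art l", OF 8 regs[unfolded Gate] bound])
        then show "runs (emit (block_items d M s (ES l))) (3 * length (block_items d M s (ES l)) + 1) (\<mu>'', inp, out) inp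
           ?out ?Q"
          by (rule runs_mono) (use 8 9 1 in auto)
      qed
    qed
    moreover have "label_time d M s ES art l \<le> sum_list (map (label_time d M s ES art) ls)"
      using l(1) by (intro member_le_sum_list) auto
    ultimately show ?thesis
      using tag(1) by (auto intro: runs_mono)
  qed
  obtain tag rest where e: "encode_gate \<nu> g @ inp = tag # rest"
    by (cases g) auto
  show ?thesis
    unfolding gate_com_def gate_time_def e
  proof (rule runs_Read, rule runs_Seq[OF runs_IfNZ])
    show "runs (if (\<mu>(3 := tag)) 3 \<noteq> 0 then dispatch ?cPs else input_com d M s) ?\<tau> (\<mu>(3 := tag), rest, out) inp ?out ?Q"
      using main[OF e] by (simp cong: if_cong)
    fix \<mu>' :: "nat \<Rightarrow> nat" assume "?Q \<mu>'"
    then show "runs (Seq (SetC 0 (s * M)) (Seq (com.Add 9 9 0) (Seq (SetC 0 1) (Seq (com.Sub 1 1 0) Skip))))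
        (1 + (1 + (1 + (1 + 1)))) (\<mu>', inp, ?out) inp ?out
        (\<lambda>\<mu>'. \<mu>' 8 = 0 \<and> \<mu>' 9 = Suc i * (s * M) \<and> \<mu>' 1 = \<mu> 1 - 1)"
      by (intro runs_SetC runs_Add runs_Sub runs_Skip) auto
  qed
qed

lemma runs_gates:
  assumes "\<And>k. k < length gs \<Longrightarrow> translatable m d M s ES (i + k) (gs ! k)"
    and "\<And>l ws. Gate l ws \<in> set gs \<Longrightarrow> l \<in> set ls \<and> length ws = art l"
    and ls: "distinct ls" "inj_on \<nu> (set ls)"
    and "\<mu> 8 = 0" "\<mu> 9 = i * (s * M)" "\<mu> 1 = length gs"
  shows "runs (WhileNZ 1 (gate_com d M s ES art \<nu> ls)) (1 + length gs * Suc (gate_time d M s ES art ls))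
    (\<mu>, concat (map (encode_gate \<nu>) gs) @ inp, out) inp
    (out @ concat (map (encode_gate cc_code) (translate d M s ES i gs))) (\<lambda>_. True)"
  using assms(1,2,5-7)
proof (induction gs arbitrary: i \<mu> out)
  case Nil
  then show ?case by (auto intro: runs_While_0[simplified])
next
  case (Cons g gs)
  have "runs (WhileNZ 1 (gate_com d M s ES art \<nu> ls))
      (Suc (gate_time d M s ES art ls + (1 + length gs * Suc (gate_time d M s ES art ls))))
      (\<mu>, encode_gate \<nu> g @ (concat (map (encode_gate \<nu>) gs) @ inp), out) inp
      ((out @ concat (map (encode_gate cc_code) (map (inst (gate_base (s * M) s i g)) (block d M s (gate_exprs ES g))))) @
        concat (map (encode_gate cc_code) (translate d M s ES (Suc i) gs))) (\<lambda>_. True)"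
  proof (rule runs_While_Suc)
    show "runs (gate_com d M s ES art \<nu> ls) (gate_time d M s ES art ls)
        (\<mu>, encode_gate \<nu> g @ (concat (map (encode_gate \<nu>) gs) @ inp), out)
        (concat (map (encode_gate \<nu>) gs) @ inp)
        (out @ concat (map (encode_gate cc_code) (map (inst (gate_base (s * M) s i g)) (block d M s (gate_exprs ES g)))))
        (\<lambda>\<mu>'. \<mu>' 8 = 0 \<and> \<mu>' 9 = Suc i * (s * M) \<and> \<mu>' 1 = \<mu> 1 - 1)"
      by (rule runs_gate[OF _ _ ls]) (use Cons.prems(1)[of 0] Cons.prems(2-4) in auto)
  next
    fix \<mu>' :: "nat \<Rightarrow> nat" assume "\<mu>' 8 = 0 \<and> \<mu>' 9 = Suc i * (s * M) \<and> \<mu>' 1 = \<mu> 1 - 1"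
    then show "runs (WhileNZ 1 (gate_com d M s ES art \<nu> ls)) (1 + length gs * Suc (gate_time d M s ES art ls))
       (\<mu>', concat (map (encode_gate \<nu>) gs) @ inp,
         out @ concat (map (encode_gate cc_code) (map (inst (gate_base (s * M) s i g)) (block d M s (gate_exprs ES g))))) inp
       ((out @ concat (map (encode_gate cc_code) (map (inst (gate_base (s * M) s i g)) (block d M s (gate_exprs ES g))))) @
        concat (map (encode_gate cc_code) (translate d M s ES (Suc i) gs))) (\<lambda>_. True)"
      using Cons.prems(1)[of "Suc k" for k] Cons.prems(2,5) by (intro Cons.IH) auto
  qed (use Cons.prems in simp)
  moreover have "1 + length (g # gs) * Suc (gate_time d M s ES art ls) =
      Suc (gate_time d M s ES art ls + (1 + length gs * Suc (gate_time d M s ES art ls)))"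
    by simp
  ultimately show ?case by (simp only: list.map concat.simps append_assoc translate.simps map_append concat_append)
qed

text \<open>The label set is finite, so a program can contain one branch per label with the block
  built in. It passes once over the input tape and spends constant time on each gate.\<close>

lemma translate_linear_time:
  fixes X :: "'l circuit set"
  assumes "finite \<Lambda>" and "inj_on \<nu> \<Lambda>"
    and X: "\<And>C i. C \<in> X \<Longrightarrow> i < length (gates C) \<Longrightarrow> translatable m d M s ES i (gates C ! i)"
      "\<And>C l ws. C \<in> X \<Longrightarrow> Gate l ws \<in> set (gates C) \<Longrightarrow> l \<in> \<Lambda> \<and> length ws = art l"
      "\<And>C. C \<in> X \<Longrightarrow> length (outs C) = 1"
  shows "linear_time_computable X (encode_circuit \<nu>) (encode_circuit cc_code) (translate_circuit d M s ES)"
proof -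
  obtain ls where ls: "set ls = \<Lambda>" "distinct ls"
    using finite_distinct_list[OF assms(1)] by blast
  let ?N = "s * M"
  let ?body = "gate_com d M s ES art \<nu> ls"
  let ?outs = "map (\<lambda>j. (10 :: nat, j * M + (M - 1))) [0..<s]"
  \<comment> \<open>After the loop, the first \<open>Read 0\<close> discards the number of outputs,
    which is 1 and is replaced by \<open>s\<close>; then register 10 receives the start of the block
    of the output gate, whose slot ends are the new outputs.\<close>
  define P where "P = Seq (Read 1) (Seq (mul 0 1 s) (Seq (Write 0) (Seq (Read 1) (Seq (mul 0 1 ?N) (Seq (Write 0)
    (Seq (WhileNZ 1 ?body)
    (Seq (Read 0) (Seq (SetC 0 s) (Seq (Write 0) (Seq (Read 0) (Seq (mul 10 0 ?N) (emit ?outs))))))))))))"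
  let ?g = "Suc (gate_time d M s ES art ls)"
  define \<tau> where "\<tau> n = 1 + (Suc s + (1 + (1 + (Suc ?N + (1 + ((1 + n * ?g) +
    (1 + (1 + (1 + (1 + (Suc ?N + (3 * length ?outs + 1))))))))))))" for n
  have run: "runs P (\<tau> (length (gates C))) (\<lambda>_. 0, encode_circuit \<nu> C, []) []
      (encode_circuit cc_code (translate_circuit d M s ES C)) (\<lambda>_. True)" if C: "C \<in> X" for C
  proof -
    obtain w where w: "outs C = [w]"
      using X(3)[OF C] by (auto simp: length_Suc_conv)
    have enc: "encode_circuit \<nu> C = ninputs C # length (gates C) #
        concat (map (encode_gate \<nu>) (gates C)) @ [1, w]"
      by (simp add: encode_circuit_def w)
    let ?out1 = "[ninputs C * s] @ [length (gates C) * ?N]"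
    let ?out2 = "?out1 @ concat (map (encode_gate cc_code) (translate d M s ES 0 (gates C)))"
    have enc': "encode_circuit cc_code (translate_circuit d M s ES C) =
        (?out2 @ [s]) @ map (\<lambda>(r, c). ((\<lambda>_. 0)(10 := w * ?N)) r + c) ?outs"
      using length_translate[OF X(1)[OF C]] w
      by (simp add: encode_circuit_def translate_circuit_def comp_def mult.commute)
    have loop: "runs (WhileNZ 1 ?body) (1 + length (gates C) * ?g)
        (\<mu>, concat (map (encode_gate \<nu>) (gates C)) @ [1, w], ?out1) [1, w] ?out2 (\<lambda>_. True)"
      if "\<mu> 8 = 0" "\<mu> 9 = 0" "\<mu> 1 = length (gates C)" for \<mu>
      by (rule runs_gates[where m = m]) (use that C X ls assms(2) in auto)
    have fin: "runs (Seq (Read 0) (Seq (SetC 0 s) (Seq (Write 0) (Seq (Read 0) (Seq (mul 10 0 ?N) (emit ?outs))))))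
        (1 + (1 + (1 + (1 + (Suc ?N + (3 * length ?outs + 1)))))) (\<mu>, [1, w], ?out2) []
        (encode_circuit cc_code (translate_circuit d M s ES C)) (\<lambda>_. True)" for \<mu>
      unfolding enc'
    proof (intro runs_Read runs_SetC runs_Write runs_mul)
      let ?\<mu> = "\<mu>(0 := 1, 0 := s, 0 := w, 10 := w * ?N)"
      have "map (\<lambda>(r, c). ((\<lambda>_. 0)(10 := w * ?N)) r + c) ?outs = map (\<lambda>(r, c). ?\<mu> r + c) ?outs"
        by simp
      then show "runs (emit ?outs) (3 * length ?outs + 1)
          ((\<mu>(0 := 1, 0 := s, 0 := w)) (10 := (\<mu>(0 := 1, 0 := s, 0 := w)) 0 * ?N), [], ?out2 @ [(\<mu>(0 := 1, 0 := s)) 0]) []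
          ((?out2 @ [s]) @ map (\<lambda>(r, c). ((\<lambda>_. 0)(10 := w * ?N)) r + c) ?outs) (\<lambda>_. True)"
        using runs_mono[OF runs_emit[of ?outs ?\<mu> "[]" "?out2 @ [s]"]] by (force simp: comp_def)
    qed simp
    show ?thesis
      unfolding P_def \<tau>_def enc
    proof (rule runs_Read, rule runs_mul, simp, rule runs_Write, rule runs_Read, rule runs_mul, simp, rule runs_Write)
    qed (rule runs_Seq[where Q = "\<lambda>_. True", OF _ fin],
      use loop[of "(\<lambda>_. 0)(1 := length (gates C), 0 := length (gates C) * ?N)"] in simp)
  qed
  \<comment> \<open>\<open>\<tau>\<close> is affine with slope \<open>?g\<close>, and the code of a
    circuit is longer than its list of gates.\<close>
  define c where "c = \<tau> 0 + ?g"
  have "\<tau> n \<le> c * (n + 1)" for n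
    by (simp add: \<tau>_def c_def algebra_simps)
  moreover have "length (gates C) + 1 \<le> length (encode_circuit \<nu> C)" for C :: "'l circuit"
  proof -
    have le: "length gs \<le> length (concat (map (encode_gate \<nu>) gs))" for gs :: "'l gate list"
    proof (induction gs)
      case (Cons g gs)
      then show ?case by (cases g) auto
    qed simp
    show ?thesis
      using le[of "gates C"] by (simp add: encode_circuit_def)
  qed
  ultimately have "\<tau> (length (gates C)) \<le> c * length (encode_circuit \<nu> C)" for C :: "'l circuit"
    by (meson le_trans mult_le_mono2)
  then show ?thesis
    using run unfolding linear_time_computable_def runs_def by (meson le_trans)
qed

section \<open>Module operations in coordinates\<close>

text \<open>Polynomials of a module are affine. In the form g(y + z) + g(0) = g(y) + g(z), which
  needs no subtraction, affinity passes through every constructor of \<open>Pol\<close>; the closure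
  claims allow computing in the group.\<close>

lemma Pol_module_additive:
  assumes "comm_group G" and "endo_ring G R" and "g \<in> Pol (module_alg G R) r"
    and y: "\<And>a. a < r \<Longrightarrow> y a \<in> carrier G" and z: "\<And>a. a < r \<Longrightarrow> z a \<in> carrier G"
  shows "g (map y [0..<r]) \<in> carrier G \<and> g (map z [0..<r]) \<in> carrier G \<and>
    g (map (\<lambda>_. \<one>\<^bsub>G\<^esub>) [0..<r]) \<in> carrier G \<and>
    g (map (\<lambda>a. y a \<otimes>\<^bsub>G\<^esub> z a) [0..<r]) \<in> carrier G \<and>
    g (map (\<lambda>a. y a \<otimes>\<^bsub>G\<^esub> z a) [0..<r]) \<otimes>\<^bsub>G\<^esub> g (map (\<lambda>_. \<one>\<^bsub>G\<^esub>) [0..<r]) =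
    g (map y [0..<r]) \<otimes>\<^bsub>G\<^esub> g (map z [0..<r])"
  using assms(3)
proof induction
  interpret comm_group G by fact
  have T: "map w [0..<r] \<in> tuples (univ (module_alg G R)) r" if "\<And>a. a < r \<Longrightarrow> w a \<in> carrier G" for w
    using that by (auto simp: tuples_def module_alg_def)
  note Ts = T[OF y] T[OF z] T[OF one_closed] T[OF m_closed, OF y z]
  {
    case (proj i)
    then show ?case using Ts y z by simp
  next
    case (const a)
    then show ?case using Ts by (simp add: module_alg_def)
  next
    case (comp f gs)
    note IH = comp.IH[rule_format]
    consider "f = MPlus" | "f = MZero" | "f = MNeg" | t where "f = MScale t" "t \<in> R"
      using comp.hyps by (auto simp: module_alg_def)
    then show ?case
    proof cases
      case 1
      then obtain g h where gs: "gs = [g, h]"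
        using comp.hyps by (auto simp: module_alg_def length_Suc_conv numeral_2_eq_2)
      have "g \<in> set gs" "h \<in> set gs" by (auto simp: gs)
      note gh = comp.IH[rule_format, OF this(1)] comp.IH[rule_format, OF this(2)]
      have "(g (map (\<lambda>a. y a \<otimes>\<^bsub>G\<^esub> z a) [0..<r]) \<otimes>\<^bsub>G\<^esub> h (map (\<lambda>a. y a \<otimes>\<^bsub>G\<^esub> z a) [0..<r])) \<otimes>\<^bsub>G\<^esub>
          (g (map (\<lambda>_. \<one>\<^bsub>G\<^esub>) [0..<r]) \<otimes>\<^bsub>G\<^esub> h (map (\<lambda>_. \<one>\<^bsub>G\<^esub>) [0..<r])) =
          (g (map (\<lambda>a. y a \<otimes>\<^bsub>G\<^esub> z a) [0..<r]) \<otimes>\<^bsub>G\<^esub> g (map (\<lambda>_. \<one>\<^bsub>G\<^esub>) [0..<r])) \<otimes>\<^bsub>G\<^esub>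
          (h (map (\<lambda>a. y a \<otimes>\<^bsub>G\<^esub> z a) [0..<r]) \<otimes>\<^bsub>G\<^esub> h (map (\<lambda>_. \<one>\<^bsub>G\<^esub>) [0..<r]))"
        using gh by (simp add: m_ac)
      also have "\<dots> = (g (map y [0..<r]) \<otimes>\<^bsub>G\<^esub> g (map z [0..<r])) \<otimes>\<^bsub>G\<^esub> (h (map y [0..<r]) \<otimes>\<^bsub>G\<^esub> h (map z [0..<r]))"
        using gh by simp
      also have "\<dots> = (g (map y [0..<r]) \<otimes>\<^bsub>G\<^esub> h (map y [0..<r])) \<otimes>\<^bsub>G\<^esub> (g (map z [0..<r]) \<otimes>\<^bsub>G\<^esub> h (map z [0..<r]))"
        using gh by (simp add: m_ac)
      finally show ?thesis
        using Ts gh 1 by (simp add: gs) (simp add: module_alg_def)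
    next
      case 2
      then show ?thesis using Ts by simp (simp add: module_alg_def)
    next
      case 3
      then obtain g where gs: "gs = [g]"
        using comp.hyps by (auto simp: module_alg_def length_Suc_conv)
      have "g \<in> set gs" by (auto simp: gs)
      note g = comp.IH[rule_format, OF this]
      have "inv\<^bsub>G\<^esub> (g (map (\<lambda>a. y a \<otimes>\<^bsub>G\<^esub> z a) [0..<r])) \<otimes>\<^bsub>G\<^esub> inv\<^bsub>G\<^esub> (g (map (\<lambda>_. \<one>\<^bsub>G\<^esub>) [0..<r])) =
          inv\<^bsub>G\<^esub> (g (map (\<lambda>a. y a \<otimes>\<^bsub>G\<^esub> z a) [0..<r]) \<otimes>\<^bsub>G\<^esub> g (map (\<lambda>_. \<one>\<^bsub>G\<^esub>) [0..<r]))"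
        by (rule inv_mult[symmetric]) (use g in blast)+
      also have "\<dots> = inv\<^bsub>G\<^esub> (g (map y [0..<r]) \<otimes>\<^bsub>G\<^esub> g (map z [0..<r]))"
        using g by (simp only:)
      also have "\<dots> = inv\<^bsub>G\<^esub> (g (map y [0..<r])) \<otimes>\<^bsub>G\<^esub> inv\<^bsub>G\<^esub> (g (map z [0..<r]))"
        by (rule inv_mult) (use g in blast)+
      finally show ?thesis
        using Ts g 3 by (simp add: gs) (simp add: module_alg_def)
    next
      case 4
      then obtain g where gs: "gs = [g]"
        using comp.hyps by (auto simp: module_alg_def length_Suc_conv)
      have "g \<in> set gs" by (auto simp: gs)
      note g = comp.IH[rule_format, OF this]
      have t: "t \<in> hom G G"
        using 4 assms(2) by (auto simp: endo_ring_def)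
      have "t (g (map (\<lambda>a. y a \<otimes>\<^bsub>G\<^esub> z a) [0..<r])) \<otimes>\<^bsub>G\<^esub> t (g (map (\<lambda>_. \<one>\<^bsub>G\<^esub>) [0..<r])) =
          t (g (map (\<lambda>a. y a \<otimes>\<^bsub>G\<^esub> z a) [0..<r]) \<otimes>\<^bsub>G\<^esub> g (map (\<lambda>_. \<one>\<^bsub>G\<^esub>) [0..<r]))"
        by (rule hom_mult[OF t, symmetric]) (use g in blast)+
      also have "\<dots> = t (g (map y [0..<r]) \<otimes>\<^bsub>G\<^esub> g (map z [0..<r]))"
        using g by (simp only:)
      also have "\<dots> = t (g (map y [0..<r])) \<otimes>\<^bsub>G\<^esub> t (g (map z [0..<r]))"
        by (rule hom_mult[OF t]) (use g in blast)+
      finally show ?thesis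
        using Ts g 4 hom_in_carrier[OF t] by (simp add: gs) (simp add: module_alg_def)
    qed
  }
qed

lemma module_equivalent_additive:
  assumes "module_equivalent L G" and "f \<in> syms L" and r: "r = ar L f"
    and y: "\<And>a. a < r \<Longrightarrow> y a \<in> carrier G" and z: "\<And>a. a < r \<Longrightarrow> z a \<in> carrier G"
  shows "opr L f (map (\<lambda>a. y a \<otimes>\<^bsub>G\<^esub> z a) [0..<r]) \<otimes>\<^bsub>G\<^esub> opr L f (map (\<lambda>_. \<one>\<^bsub>G\<^esub>) [0..<r]) =
    opr L f (map y [0..<r]) \<otimes>\<^bsub>G\<^esub> opr L f (map z [0..<r])"
proof -
  obtain R where R: "comm_group G" "endo_ring G R" "univ L = carrier G"
    "\<And>k. Pol L k = Pol (module_alg G R) k"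
    using assms(1) by (auto simp: module_equivalent_def polynomially_equivalent_def module_alg_def)
  interpret comm_group G by fact
  \<comment> \<open>Composed with the projections, a basic operation of \<open>L\<close> is a
    polynomial of \<open>L\<close>, and therefore one of the module.\<close>
  define gs where "gs = map (\<lambda>i. \<lambda>xs\<in>tuples (univ L) r. xs ! i) [0..<r]"
  define g where "g = (\<lambda>xs\<in>tuples (univ L) r. opr L f (map (\<lambda>g. g xs) gs))"
  have "g \<in> Pol L r"
    unfolding g_def using assms(2) r by (intro Pol.comp) (auto simp: gs_def intro: Pol.proj)
  then have g: "g \<in> Pol (module_alg G R) r"
    using R(4) by simp
  have eq: "g (map w [0..<r]) = opr L f (map w [0..<r])" if "\<And>a. a < r \<Longrightarrow> w a \<in> carrier G" for w
  proof -
    have "map w [0..<r] \<in> tuples (univ L) r"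
      using that R(3) by (auto simp: tuples_def)
    then have "map (\<lambda>g. g (map w [0..<r])) gs = map w [0..<r]"
      by (auto simp: gs_def)
    with \<open>map w [0..<r] \<in> tuples (univ L) r\<close> show ?thesis
      by (simp add: g_def)
  qed
  show ?thesis
    using Pol_module_additive[OF R(1,2) g y z] eq[OF y] eq[OF z] eq[OF one_closed] eq[OF m_closed, OF y z]
    by simp
qed

text \<open>Natural numbers as entries permit induction by repeated addition, so the values at the
  unit vectors become the coefficients.\<close>

lemma additive_mod_linear:
  fixes \<Gamma> :: "('k \<Rightarrow> nat) \<Rightarrow> int"
  assumes "finite I" and add: "\<And>w w'. [\<Gamma> (\<lambda>k. w k + w' k) = \<Gamma> w + \<Gamma> w'] (mod q)"
    and zero: "[\<Gamma> (\<lambda>_. 0) = 0] (mod q)"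
  shows "[\<Gamma> (\<lambda>k. if k \<in> I then w k else 0) =
    (\<Sum>k\<in>I. int (w k) * \<Gamma> (\<lambda>i. if i = k then 1 else 0))] (mod q)"
  using assms(1)
proof (induction I rule: finite_induct)
  case (insert k F)
  have mult: "[\<Gamma> (\<lambda>i. if i = k then n else 0) = int n * \<Gamma> (\<lambda>i. if i = k then 1 else 0)] (mod q)" for n
  proof (induction n)
    case (Suc n)
    have "(\<lambda>i. if i = k then Suc n else 0) = (\<lambda>i. (if i = k then n else 0) + (if i = k then 1 else 0))"
      by auto
    then have "[\<Gamma> (\<lambda>i. if i = k then Suc n else 0) =
        \<Gamma> (\<lambda>i. if i = k then n else 0) + \<Gamma> (\<lambda>i. if i = k then 1 else 0)] (mod q)"
      by (simp only: add)
    also have "[\<Gamma> (\<lambda>i. if i = k then n else 0) + \<Gamma> (\<lambda>i. if i = k then 1 else 0) =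
        int n * \<Gamma> (\<lambda>i. if i = k then 1 else 0) + \<Gamma> (\<lambda>i. if i = k then 1 else 0)] (mod q)"
      by (rule cong_add[OF Suc.IH cong_refl])
    finally show ?case by (simp add: algebra_simps)
  qed (simp add: zero)
  have "(\<lambda>i. if i \<in> insert k F then w i else 0) =
      (\<lambda>i. (if i \<in> F then w i else 0) + (if i = k then w k else 0))"
    using insert.hyps by auto
  then have "[\<Gamma> (\<lambda>i. if i \<in> insert k F then w i else 0) =
      \<Gamma> (\<lambda>i. if i \<in> F then w i else 0) + \<Gamma> (\<lambda>i. if i = k then w k else 0)] (mod q)"
    by (simp only: add)
  also have "[\<Gamma> (\<lambda>i. if i \<in> F then w i else 0) + \<Gamma> (\<lambda>i. if i = k then w k else 0) =
      (\<Sum>k\<in>F. int (w k) * \<Gamma> (\<lambda>i. if i = k then 1 else 0)) + int (w k) * \<Gamma> (\<lambda>i. if i = k then 1 else 0)] (mod q)"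
    by (rule cong_add[OF insert.IH mult])
  finally show ?case using insert.hyps by (simp add: add.commute)
qed (simp add: zero)

lemma carrier_Zprod: "(\<And>j. j \<in> J \<Longrightarrow> p j > 0) \<Longrightarrow> carrier (Zprod p J) = (\<Pi>\<^sub>E j\<in>J. {0..<int (p j)})"
  by (simp add: Zprod_def carrier_integer_mod_group) (rule PiE_cong, simp)

lemma mult_Zprod: "x \<otimes>\<^bsub>Zprod p J\<^esub> y = (\<lambda>j\<in>J. (x j + y j) mod int (p j))"
  and one_Zprod: "\<one>\<^bsub>Zprod p J\<^esub> = (\<lambda>j\<in>J. 0)"
  by (simp_all add: Zprod_def)

text \<open>Endomorphisms of a power of Z_q are matrices, so a coordinate of the operation is an
  affine form in the coordinates of all arguments. The scalars need not be followed: additivity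
  alone produces the coefficients.\<close>

lemma level_affine:
  assumes "module_equivalent L (Zprod p J)" and "finite J" and "\<And>i. i \<in> J \<Longrightarrow> p i = q" and "q > 0"
    and "f \<in> syms L" and r: "r = ar L f" and "j \<in> J"
  obtains c k where "\<And>x. (\<And>a i. a < r \<Longrightarrow> i \<in> J \<Longrightarrow> 0 \<le> x a i \<and> x a i < int q) \<Longrightarrow>
    [opr L f (map (\<lambda>a. restrict (x a) J) [0..<r]) j = c + (\<Sum>(a, i)\<in>{..<r} \<times> J. k (a, i) * x a i)] (mod int q)"
proof -
  let ?G = "Zprod p J"
  have pq: "i \<in> J \<Longrightarrow> p i = q" for i by fact
  have carr: "carrier ?G = (\<Pi>\<^sub>E j\<in>J. {0..<int q})"
    using assms(3,4) by (subst carrier_Zprod) (auto intro!: PiE_cong)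
  \<comment> \<open>Reduction modulo \<open>q\<close> sends arbitrary natural entries into the
    carrier, which makes \<open>\<Gamma>\<close> below additive modulo \<open>q\<close> without any
    restriction of range.\<close>
  define Y where "Y w a = (\<lambda>i\<in>J. int (w (a, i)) mod int q)" for w :: "nat \<times> nat \<Rightarrow> nat" and a
  have Y: "Y w a \<in> carrier ?G" for w a
    using assms(4) by (auto simp: carr Y_def)
  define g where "g w = opr L f (map (Y w) [0..<r]) j" for w
  define \<Gamma> where "\<Gamma> w = g w - g (\<lambda>_. 0)" for w
  have Y0: "Y (\<lambda>_. 0) = (\<lambda>_. \<one>\<^bsub>?G\<^esub>)"
    by (auto simp: Y_def one_Zprod)
  have Yadd: "Y (\<lambda>k. w k + w' k) = (\<lambda>a. Y w a \<otimes>\<^bsub>?G\<^esub> Y w' a)" for w w'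
    by (auto simp: Y_def mult_Zprod pq mod_simps intro!: restrict_ext ext)
  have "[\<Gamma> (\<lambda>k. w k + w' k) = \<Gamma> w + \<Gamma> w'] (mod int q)" for w w'
  proof -
    have "(opr L f (map (Y (\<lambda>k. w k + w' k)) [0..<r]) \<otimes>\<^bsub>?G\<^esub> opr L f (map (Y (\<lambda>_. 0)) [0..<r])) j =
       (opr L f (map (Y w) [0..<r]) \<otimes>\<^bsub>?G\<^esub> opr L f (map (Y w') [0..<r])) j"
      using module_equivalent_additive[OF assms(1,5) r, of "Y w" "Y w'"] Y by (simp add: Y0 Yadd)
    then have "[g (\<lambda>k. w k + w' k) + g (\<lambda>_. 0) = g w + g w'] (mod int q)"
      using assms(7) by (simp add: mult_Zprod pq g_def cong_def)
    then have "[g (\<lambda>k. w k + w' k) + g (\<lambda>_. 0) - 2 * g (\<lambda>_. 0) = g w + g w' - 2 * g (\<lambda>_. 0)] (mod int q)"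
      by (rule cong_diff) simp
    then show ?thesis by (simp add: \<Gamma>_def algebra_simps)
  qed
  note lin = additive_mod_linear[of "{..<r} \<times> J" \<Gamma>, OF _ this]
  define k where "k ai = \<Gamma> (\<lambda>i. if i = ai then 1 else 0)" for ai
  show thesis
  proof (rule that[of "g (\<lambda>_. 0)" k])
    fix x :: "nat \<Rightarrow> nat \<Rightarrow> int"
    assume x: "\<And>a i. a < r \<Longrightarrow> i \<in> J \<Longrightarrow> 0 \<le> x a i \<and> x a i < int q"
    define w where "w = (\<lambda>(a, i). nat (x a i))"
    have "map (Y (\<lambda>k. if k \<in> {..<r} \<times> J then w k else 0)) [0..<r] = map (\<lambda>a. restrict (x a) J) [0..<r]"
      using x by (auto simp: Y_def w_def intro!: restrict_ext)
    then have "\<Gamma> (\<lambda>k. if k \<in> {..<r} \<times> J then w k else 0) =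
        opr L f (map (\<lambda>a. restrict (x a) J) [0..<r]) j - g (\<lambda>_. 0)"
      by (simp only: \<Gamma>_def g_def)
    moreover have "[\<Gamma> (\<lambda>k. if k \<in> {..<r} \<times> J then w k else 0) = (\<Sum>k'\<in>{..<r} \<times> J. int (w k') * k k')] (mod int q)"
      unfolding k_def by (rule lin) (use assms(2) in \<open>auto simp: \<Gamma>_def\<close>)
    moreover have "(\<Sum>k'\<in>{..<r} \<times> J. int (w k') * k k') = (\<Sum>(a, i)\<in>{..<r} \<times> J. k (a, i) * x a i)"
      using x by (intro sum.cong) (auto simp: w_def)
    ultimately have "[opr L f (map (\<lambda>a. restrict (x a) J) [0..<r]) j - g (\<lambda>_. 0) =
        (\<Sum>(a, i)\<in>{..<r} \<times> J. k (a, i) * x a i)] (mod int q)"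
      by simp
    then have "[g (\<lambda>_. 0) + (opr L f (map (\<lambda>a. restrict (x a) J) [0..<r]) j - g (\<lambda>_. 0)) =
        g (\<lambda>_. 0) + (\<Sum>(a, i)\<in>{..<r} \<times> J. k (a, i) * x a i)] (mod int q)"
      by (rule cong_add[OF cong_refl])
    then show "[opr L f (map (\<lambda>a. restrict (x a) J) [0..<r]) j =
        g (\<lambda>_. 0) + (\<Sum>(a, i)\<in>{..<r} \<times> J. k (a, i) * x a i)] (mod int q)"
      by simp
  qed
qed

section \<open>Functions of scaled coordinates computed by expressions\<close>

locale modular_coordinates =
  fixes m s :: nat and p D :: "nat \<Rightarrow> nat"
  assumes m_gt_2: "m > 2"
    and prime_p: "j < s \<Longrightarrow> prime (p j)"
    and p_dvd_m: "j < s \<Longrightarrow> p j dvd m"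
begin

definition valid :: "nat \<Rightarrow> (nat \<Rightarrow> nat \<Rightarrow> int) \<Rightarrow> bool" where
  "valid r x \<longleftrightarrow> (\<forall>a<r. \<forall>j<s. 0 \<le> x a j \<and> x a j < int (p j))"

text \<open>\<open>\<phi>\<close> takes integer values that matter only modulo \<open>m\<close>. The
  expression sees the arguments through the embedding, scaled by \<open>m div p j\<close>, and
  coordinate \<open>j\<close> of every argument is taken to arrive at depth
  \<open>D j\<close>.\<close>

definition computable :: "nat \<Rightarrow> nat \<Rightarrow> ((nat \<Rightarrow> nat \<Rightarrow> int) \<Rightarrow> int) \<Rightarrow> bool" where
  "computable r \<delta> \<phi> \<longleftrightarrow> (\<exists>e. expr_ok m 0 r s e \<and> expr_val depth_sem (\<lambda>_. 0) (\<lambda>_. D) e \<le> \<delta> \<and>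
     (\<forall>x. valid r x \<longrightarrow>
       expr_val (cc_sem m) (\<lambda>_. 0) (\<lambda>a j. int (m div p j) * x a j) e = \<phi> x mod int m))"

lemma computable_cong:
  "computable r \<delta> \<phi> \<Longrightarrow> (\<And>x. valid r x \<Longrightarrow> [\<psi> x = \<phi> x] (mod int m)) \<Longrightarrow> computable r \<delta> \<psi>"
  unfolding computable_def cong_def by metis

lemma computable_const: "computable r \<delta> (\<lambda>_. c)"
  unfolding computable_def using m_gt_2
  by (intro exI[of _ "ELit (c mod int m)"]) (simp add: depth_sem_def)

lemma computable_ref:
  "a < r \<Longrightarrow> j < s \<Longrightarrow> D j \<le> \<delta> \<Longrightarrow> computable r \<delta> (\<lambda>x. int (m div p j) * x a j)"
  unfolding computable_def by (intro exI[of _ "ERef a j"]) (simp add: depth_sem_def)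

lemma computable_add:
  assumes "computable r \<delta> \<phi>" and "computable r \<delta> \<psi>"
  shows "computable r \<delta> (\<lambda>x. \<phi> x + \<psi> x)"
proof -
  obtain e e' where "expr_ok m 0 r s e" "expr_val depth_sem (\<lambda>_. 0) (\<lambda>_. D) e \<le> \<delta>"
    "\<forall>x. valid r x \<longrightarrow> expr_val (cc_sem m) (\<lambda>_. 0) (\<lambda>a j. int (m div p j) * x a j) e = \<phi> x mod int m"
    "expr_ok m 0 r s e'" "expr_val depth_sem (\<lambda>_. 0) (\<lambda>_. D) e' \<le> \<delta>"
    "\<forall>x. valid r x \<longrightarrow> expr_val (cc_sem m) (\<lambda>_. 0) (\<lambda>a j. int (m div p j) * x a j) e' = \<psi> x mod int m"
    using assms unfolding computable_def by blast
  then show ?thesis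
    unfolding computable_def
    by (intro exI[of _ "EAdd e e'"]) (simp add: depth_sem_def mod_simps)
qed

lemma computable_mod_gate:
  assumes "computable r \<delta> \<phi>"
  shows "computable r (Suc \<delta>) (\<lambda>x. of_bool (int m dvd \<phi> x))"
proof -
  obtain e where "expr_ok m 0 r s e" "expr_val depth_sem (\<lambda>_. 0) (\<lambda>_. D) e \<le> \<delta>"
    "\<forall>x. valid r x \<longrightarrow> expr_val (cc_sem m) (\<lambda>_. 0) (\<lambda>a j. int (m div p j) * x a j) e = \<phi> x mod int m"
    using assms unfolding computable_def by blast
  then show ?thesis
    unfolding computable_def using m_gt_2
    by (intro exI[of _ "EMod e"]) (auto simp: depth_sem_def dvd_eq_mod_eq_0)
qed

lemma computable_scale_nat: "computable r \<delta> \<phi> \<Longrightarrow> computable r \<delta> (\<lambda>x. int n * \<phi> x)"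
proof (induction n)
  case (Suc n)
  then have "computable r \<delta> (\<lambda>x. int n * \<phi> x + \<phi> x)"
    by (intro computable_add)
  then show ?case by (simp add: algebra_simps)
qed (simp add: computable_const)

text \<open>A constant factor is a repeated addition; passing to its residue modulo \<open>m\<close>
  admits negative factors.\<close>

lemma computable_scale:
  assumes "computable r \<delta> \<phi>"
  shows "computable r \<delta> (\<lambda>x. k * \<phi> x)"
proof (rule computable_cong[OF computable_scale_nat[OF assms, of "nat (k mod int m)"]])
  show "[k * \<phi> x = int (nat (k mod int m)) * \<phi> x] (mod int m)" for x
    using m_gt_2 by (simp add: cong_def mod_simps)
qed

lemma computable_sum:
  "finite I \<Longrightarrow> (\<And>i. i \<in> I \<Longrightarrow> computable r \<delta> (\<phi> i)) \<Longrightarrow> computable r \<delta> (\<lambda>x. \<Sum>i\<in>I. \<phi> i x)"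
  by (induction I rule: finite_induct) (auto intro: computable_const computable_add)

lemma m_div_p: "j < s \<Longrightarrow> int m = int (m div p j) * int (p j)"
  using p_dvd_m by (metis dvd_div_mult_self of_nat_mult)

lemma m_div_p_pos: "j < s \<Longrightarrow> m div p j > 0"
  using m_div_p[of j] m_gt_2 by (cases "m div p j = 0") auto

text \<open>A \<open>MOD\<close>-gate applied to \<open>(m div p j) * (x a j - v)\<close> tests
  whether \<open>p j\<close> divides the difference, and both numbers are residues modulo
  \<open>p j\<close>.\<close>

lemma computable_coordinate_eq:
  assumes "a < r" and "j < s" and "D j \<le> \<delta>" and "0 \<le> v" and "v < int (p j)"
  shows "computable r (Suc \<delta>) (\<lambda>x. of_bool (x a j = v))"
proof (rule computable_cong[OF computable_mod_gate])
  let ?k = "int (m div p j)"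
  show "computable r \<delta> (\<lambda>x. ?k * x a j + ?k * (- v))"
    by (intro computable_add computable_const computable_ref assms(1-3))
  show "[of_bool (x a j = v) = of_bool (int m dvd ?k * x a j + ?k * (- v))] (mod int m)" if "valid r x" for x
  proof -
    have "int m dvd ?k * x a j + ?k * (- v) \<longleftrightarrow> int (p j) dvd x a j - v"
      using m_div_p[OF assms(2)] m_div_p_pos[OF assms(2)]
      by (metis (no_types, lifting) add.inverse_inverse add_uminus_conv_diff dvd_mult_cancel_left
          of_nat_0_less_iff order_less_irrefl right_diff_distrib mult_minus_right)
    also have "\<dots> \<longleftrightarrow> x a j = v"
    proof -
      have "0 \<le> x a j" "x a j < int (p j)"
        using that assms(1,2) by (auto simp: valid_def)
      then have "[x a j = v] (mod int (p j)) \<longleftrightarrow> x a j = v"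
        using assms(4,5) by (simp add: cong_def)
      then show ?thesis
        by (simp add: cong_iff_dvd_diff)
    qed
    finally show ?thesis by simp
  qed
qed

text \<open>For bits \<open>b\<close> and \<open>b'\<close>, \<open>m > 2\<close> makes \<open>b + b' - 2 \<equiv> 0\<close> equivalent to \<open>b = b' = 1\<close>; a balanced
  tree of such gates computes a conjunction.\<close>

lemma computable_conj_tree:
  assumes "\<And>b. b \<in> set bs \<Longrightarrow> computable r \<delta> (\<lambda>x. of_bool (b x))" and "length bs \<le> 2 ^ t"
  shows "computable r (\<delta> + t) (\<lambda>x. of_bool (\<forall>b\<in>set bs. b x))"
  using assms
proof (induction t arbitrary: bs)
  case 0
  then have "bs = [] \<or> (\<exists>b. bs = [b])"
    by (cases bs) auto
  then show ?case
    using 0 by (auto intro: computable_const)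
next
  case (Suc t)
  define cs ds where "cs = take (2 ^ t) bs" and "ds = drop (2 ^ t) bs"
  have bs: "set bs = set cs \<union> set ds"
    unfolding cs_def ds_def by (metis append_take_drop_id set_append)
  have cd: "computable r (\<delta> + t) (\<lambda>x. of_bool (\<forall>b\<in>set cs. b x))"
    "computable r (\<delta> + t) (\<lambda>x. of_bool (\<forall>b\<in>set ds. b x))"
    by (rule Suc.IH; use Suc.prems bs in \<open>force simp: cs_def ds_def\<close>)+
  let ?g = "\<lambda>x. of_bool (\<forall>b\<in>set cs. b x) + of_bool (\<forall>b\<in>set ds. b x) + (- 2)"
  have "computable r (Suc (\<delta> + t)) (\<lambda>x. of_bool (int m dvd ?g x))"
    by (intro computable_mod_gate computable_add computable_const cd)
  moreover have "int m dvd ?g x \<longleftrightarrow> (\<forall>b\<in>set bs. b x)" for x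
  proof -
    have "\<not> int m dvd - 2" "\<not> int m dvd - 1"
      using m_gt_2 by (auto dest: zdvd_imp_le)
    then show ?thesis
      by (auto simp: bs split: if_splits)
  qed
  ultimately show ?case by simp
qed

end

text \<open>\<open>hyperplane_count r ys t\<close> is the number of \<open>\<lambda> \<in> {0..<r}\<^sup>k\<close> with
  \<open>t + \<lambda> \<bullet> ys \<equiv> 0\<close> modulo \<open>r\<close>.\<close>

primrec hyperplane_count :: "nat \<Rightarrow> int list \<Rightarrow> int \<Rightarrow> int" where
  "hyperplane_count r [] t = of_bool (int r dvd t)"
| "hyperplane_count r (y # ys) t = (\<Sum>v<r. hyperplane_count r ys (t + int v * y))"

lemma hyperplane_count_zero:
  "(\<forall>y\<in>set ys. y = 0) \<Longrightarrow> hyperplane_count r ys t = int r ^ length ys * of_bool (int r dvd t)"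
  by (induction ys) auto

text \<open>Each vector solves the equation for exactly one of the \<open>r\<close> consecutive
  shifts of \<open>t\<close>, so the sum counts all vectors.\<close>

lemma sum_hyperplane_count:
  assumes "r > 0"
  shows "(\<Sum>v<r. hyperplane_count r ys (t + int v)) = int r ^ length ys"
proof (induction ys arbitrary: t)
  case Nil
  define w where "w = nat ((- t) mod int r)"
  have w: "w < r" "int r dvd t + int v \<longleftrightarrow> v = w" if "v < r" for v
  proof -
    show "w < r" using assms by (simp add: w_def nat_less_iff)
    have "int r dvd t + int v \<longleftrightarrow> [int v = - t] (mod int r)"
      by (simp add: cong_iff_dvd_diff add.commute)
    also have "\<dots> \<longleftrightarrow> v = w"
      using that assms by (auto simp: cong_def w_def)
    finally show "int r dvd t + int v \<longleftrightarrow> v = w" .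
  qed
  have "(\<Sum>v<r. hyperplane_count r [] (t + int v)) = (\<Sum>v<r. if v = w then 1 else 0)"
    using w(2) by (intro sum.cong) auto
  also have "\<dots> = 1"
    using w(1)[of 0] assms by simp
  finally show ?case by simp
next
  case (Cons y ys)
  have "(\<Sum>v<r. hyperplane_count r (y # ys) (t + int v)) =
      (\<Sum>v<r. \<Sum>w<r. hyperplane_count r ys ((t + int w * y) + int v))"
    by (simp add: ac_simps)
  also have "\<dots> = (\<Sum>w<r. \<Sum>v<r. hyperplane_count r ys ((t + int w * y) + int v))"
    by (rule sum.swap)
  finally show ?case using Cons.IH by simp
qed

text \<open>The variable of a coefficient 1 runs through all shifts, so
  \<open>sum_hyperplane_count\<close> applies; a coefficient 0 only contributes a factor
  \<open>r\<close>. With entries 0 and 1, no inverse modulo \<open>r\<close> is called for.\<close>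

lemma hyperplane_count_nonzero:
  assumes "r > 0" and "set ys \<subseteq> {0, 1}" and "1 \<in> set ys"
  shows "hyperplane_count r ys t = int r ^ (length ys - 1)"
  using assms(2,3)
proof (induction ys arbitrary: t)
  case (Cons y ys)
  show ?case
  proof (cases "y = 1")
    case True
    then show ?thesis using sum_hyperplane_count[OF assms(1)] by simp
  next
    case False
    then have y: "y = 0" "1 \<in> set ys" "set ys \<subseteq> {0, 1}" using Cons.prems by auto
    then have "length ys = Suc (length ys - 1)" by (cases ys) auto
    then have "int r * int r ^ (length ys - 1) = int r ^ length ys"
      by (metis power_Suc)
    then show ?thesis using Cons.IH[OF y(3,2)] y(1) by simp
  qed
qed simp

section \<open>Conjunctions by hyperplane counts modulo a second prime\<close>

context modular_coordinates
begin

text \<open>With the factor \<open>k\<close>, the quotient of \<open>m\<close> by \<open>q\<close>,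
  a \<open>MOD\<close>-gate tests divisibility by \<open>q\<close>. The gates for the various
  vectors lie side by side, so a single layer suffices for all of them.\<close>

lemma computable_hyperplane_count:
  assumes k: "int m = k * int q" "k > 0"
    and "\<And>y. y \<in> set ys \<Longrightarrow> computable r \<delta> (\<lambda>x. k * y x)" and "computable r \<delta> (\<lambda>x. k * t x)"
  shows "computable r (Suc \<delta>) (\<lambda>x. hyperplane_count q (map (\<lambda>y. y x) ys) (t x))"
  using assms(3,4)
proof (induction ys arbitrary: t)
  case Nil
  have "computable r (Suc \<delta>) (\<lambda>x. of_bool (int m dvd k * t x))"
    by (rule computable_mod_gate[OF Nil(2)])
  then show ?case
    using k by simp
next
  case (Cons y ys)
  have "computable r \<delta> (\<lambda>x. k * (t x + int v * y x))" for v
  proof -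
    have "computable r \<delta> (\<lambda>x. k * t x + int v * (k * y x))"
      by (rule computable_add[OF Cons.prems(2) computable_scale[OF Cons.prems(1)]]) simp
    then show ?thesis by (simp add: algebra_simps)
  qed
  then show ?case
    using Cons.IH Cons.prems(1) by (auto intro!: computable_sum)
qed

text \<open>The number of \<open>\<lambda>\<close> with \<open>\<lambda> \<bullet> y \<equiv> 1\<close> modulo \<open>r'\<close> is \<open>0\<close> if \<open>y = 0\<close>, and otherwise a power of
  \<open>r'\<close>, which is invertible modulo \<open>q\<close>.\<close>

lemma computable_conj_hyperplanes:
  assumes "prime q" and "prime r'" and "q \<noteq> r'" and "q dvd m" and "r' dvd m"
    and bs: "\<And>b. b \<in> set bs \<Longrightarrow> computable r \<delta> (\<lambda>x. of_bool (b x))"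
  shows "computable r (Suc \<delta>) (\<lambda>x. int (m div q) * of_bool (\<forall>b\<in>set bs. b x))"
proof -
  define k where "k = int (m div r')"
  have k: "int m = k * int r'" "k > 0"
    using assms(5) m_gt_2 dvd_imp_le[OF assms(5)] prime_gt_0_nat[OF assms(2)]
    by (auto simp: k_def div_greater_zero_iff simp flip: of_nat_mult)
  have kq: "int m = int (m div q) * int q"
    using assms(4) by (simp flip: of_nat_mult)
  \<comment> \<open>The conjunction holds exactly if all complements are 0. The argument
    \<open>- 1\<close> below encodes the right-hand side 1 of the hyperplanes, none of which
    contains the zero vector.\<close>
  define ys where "ys = map (\<lambda>b x. 1 - of_bool (b x) :: int) bs"
  have "coprime (int q) (int r' ^ (length bs - 1))"
    using assms(1-3) primes_coprime by (auto simp: coprime_commute intro!: coprime_power_right_iff[THEN iffD2])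
  then obtain u where u: "[int r' ^ (length bs - 1) * u = 1] (mod int q)"
    using cong_solve_coprime_int[of "int r' ^ (length bs - 1)" "int q"] by (auto simp: coprime_commute)
  have "computable r (Suc \<delta>) (\<lambda>x. hyperplane_count r' (map (\<lambda>y. y x) ys) (- 1))"
  proof (rule computable_hyperplane_count[OF k])
    show "computable r \<delta> (\<lambda>x. k * y x)" if y: "y \<in> set ys" for y
    proof -
      obtain b where b: "b \<in> set bs" "y = (\<lambda>x. 1 - of_bool (b x))"
        using y by (auto simp: ys_def)
      have "computable r \<delta> (\<lambda>x. k + (- k) * of_bool (b x))"
        by (intro computable_add computable_scale computable_const bs b(1))
      then show ?thesis by (simp add: b(2) algebra_simps)
    qed
  qed (rule computable_const)
  \<comment> \<open>This is \<open>int (m div q) * (1 - u * h)\<close> with the count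
    \<open>h\<close>; owing to the factor, agreement modulo \<open>q\<close> is enough.\<close>
  then have "computable r (Suc \<delta>)
      (\<lambda>x. int (m div q) + (- int (m div q) * u) * hyperplane_count r' (map (\<lambda>y. y x) ys) (- 1))"
    by (intro computable_add computable_scale computable_const)
  then show ?thesis
  proof (rule computable_cong)
    fix x
    define h where "h = hyperplane_count r' (map (\<lambda>y. y x) ys) (- 1)"
    have r': "\<not> int r' dvd - 1" "r' > 0"
      using assms(2) prime_gt_1_nat[OF assms(2)] by (auto dest: zdvd_imp_le)
    have "[of_bool (\<forall>b\<in>set bs. b x) = 1 - u * h] (mod int q)"
    proof (cases "\<forall>b\<in>set bs. b x")
      case True
      then have "h = 0"
        unfolding h_def using r' by (subst hyperplane_count_zero) (auto simp: ys_def)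
      then have "of_bool (\<forall>b\<in>set bs. b x) = 1 - u * h" using True by simp
      then show ?thesis by (simp only: cong_refl)
    next
      case False
      then have "h = int r' ^ (length bs - 1)"
        unfolding h_def using r' by (subst hyperplane_count_nonzero) (force simp: ys_def)+
      then have "[u * h = 1] (mod int q)"
        using u by (simp add: mult.commute)
      then have "[1 - u * h = 1 - 1] (mod int q)"
        by (intro cong_diff cong_refl)
      moreover have zero: "of_bool (\<forall>b\<in>set bs. b x) = (0::int)" using False by simp
      ultimately show ?thesis unfolding zero by (simp add: cong_sym)
    qed
    then have "[int (m div q) * of_bool (\<forall>b\<in>set bs. b x) = int (m div q) * (1 - u * h)] (mod int m)"
      unfolding kq by (rule cong_cmult_leftI[where c = "int (m div q)"])
    then show "[int (m div q) * of_bool (\<forall>b\<in>set bs. b x) =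
        int (m div q) + (- int (m div q) * u) * hyperplane_count r' (map (\<lambda>y. y x) ys) (- 1)] (mod int m)"
      by (simp add: h_def algebra_simps)
  qed
qed

section \<open>Arbitrary functions of boundedly many coordinates\<close>

lemma computable_function:
  assumes "finite I" and "I \<subseteq> {..<r} \<times> {..<s}"
    and pt: "\<And>\<alpha>. (\<And>a j. (a, j) \<in> I \<Longrightarrow> 0 \<le> \<alpha> (a, j) \<and> \<alpha> (a, j) < int (p j)) \<Longrightarrow>
      computable r \<delta> (\<lambda>x. k * of_bool (\<forall>(a, j)\<in>I. x a j = \<alpha> (a, j)))"
    and dep: "\<And>x y. valid r x \<Longrightarrow> valid r y \<Longrightarrow> (\<forall>(a, j)\<in>I. x a j = y a j) \<Longrightarrow> \<phi> x = \<phi> y"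
  shows "computable r \<delta> (\<lambda>x. k * \<phi> x)"
proof -
  define A where "A = (\<Pi>\<^sub>E aj\<in>I. {0..<int (p (snd aj))})"
  have finA: "finite A"
    unfolding A_def using assms(1) by (intro finite_PiE) auto
  \<comment> \<open>A point given on \<open>I\<close> is extended by 0 to a valid assignment at
    which \<open>\<phi>\<close> can be evaluated; by \<open>dep\<close> the values outside
    \<open>I\<close> do not matter.\<close>
  define X where "X \<alpha> a j = (if (a, j) \<in> I then \<alpha> (a, j) else 0)" for \<alpha> :: "nat \<times> nat \<Rightarrow> int" and a j
  have X: "valid r (X \<alpha>)" if "\<alpha> \<in> A" for \<alpha>
    unfolding valid_def
  proof (intro allI impI)
    fix a j assume "a < r" "j < s"
    then show "0 \<le> X \<alpha> a j \<and> X \<alpha> a j < int (p j)"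
      using that PiE_mem[of \<alpha> I _ "(a, j)"] prime_gt_0_nat[OF prime_p] by (force simp: X_def A_def)
  qed
  have "computable r \<delta> (\<lambda>x. \<Sum>\<alpha>\<in>A. \<phi> (X \<alpha>) * (k * of_bool (\<forall>(a, j)\<in>I. x a j = \<alpha> (a, j))))"
    by (intro computable_sum computable_scale pt finA) (force simp: A_def dest: PiE_mem)
  then show ?thesis
  proof (rule computable_cong)
    fix x assume x: "valid r x"
    define \<alpha>0 where "\<alpha>0 = restrict (\<lambda>(a, j). x a j) I"
    have "\<alpha>0 \<in> A"
      using x assms(2) by (force simp: A_def \<alpha>0_def valid_def)
    have eq: "(\<forall>(a, j)\<in>I. x a j = \<alpha> (a, j)) \<longleftrightarrow> \<alpha> = \<alpha>0" if "\<alpha> \<in> A" for \<alpha>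
    proof
      assume "\<forall>(a, j)\<in>I. x a j = \<alpha> (a, j)"
      then show "\<alpha> = \<alpha>0"
        by (intro PiE_ext[OF that[unfolded A_def] \<open>\<alpha>0 \<in> A\<close>[unfolded A_def]]) (auto simp: \<alpha>0_def)
    qed (auto simp: \<alpha>0_def)
    have "(\<Sum>\<alpha>\<in>A. \<phi> (X \<alpha>) * (k * of_bool (\<forall>(a, j)\<in>I. x a j = \<alpha> (a, j)))) =
        (\<Sum>\<alpha>\<in>A. if \<alpha> = \<alpha>0 then \<phi> (X \<alpha>) * k else 0)"
      by (intro sum.cong refl) (simp only: eq, simp)
    also have "\<dots> = \<phi> (X \<alpha>0) * k"
      using \<open>\<alpha>0 \<in> A\<close> finA by simp
    also have "\<phi> (X \<alpha>0) = \<phi> x"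
      by (rule dep[OF X[OF \<open>\<alpha>0 \<in> A\<close>] x]) (auto simp: X_def \<alpha>0_def)
    finally show "[k * \<phi> x = (\<Sum>\<alpha>\<in>A. \<phi> (X \<alpha>) * (k * of_bool (\<forall>(a, j)\<in>I. x a j = \<alpha> (a, j))))] (mod int m)"
      by (simp add: mult.commute)
  qed
qed

text \<open>\<open>c\<close> is the cost of a level: the additional depth of an arbitrary function
  of coordinates at depth at most \<open>\<delta>\<close>. It has to be uniform in the set
  \<open>S\<close> of coordinates read and in the number of arguments up to
  \<open>R\<close>.\<close>

definition functions_computable :: "nat \<Rightarrow> nat \<Rightarrow> bool" where
  "functions_computable R c \<longleftrightarrow> (\<forall>r j S \<delta> \<phi>. r \<le> R \<longrightarrow> j < s \<longrightarrow> S \<subseteq> {..<s} \<longrightarrow> (\<forall>i\<in>S. D i \<le> \<delta>) \<longrightarrow>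
     (\<forall>x y. valid r x \<longrightarrow> valid r y \<longrightarrow> (\<forall>a<r. \<forall>i\<in>S. x a i = y a i) \<longrightarrow> \<phi> x = \<phi> y) \<longrightarrow>
     computable r (\<delta> + c) (\<lambda>x. int (m div p j) * \<phi> x))"

lemma functions_computableD:
  assumes "functions_computable R c" and "r \<le> R" and "j < s" and "S \<subseteq> {..<s}"
    and "\<And>i. i \<in> S \<Longrightarrow> D i \<le> \<delta>"
    and "\<And>x y. \<forall>a<r. \<forall>i\<in>S. x a i = y a i \<Longrightarrow> \<phi> x = \<phi> y"
  shows "computable r (\<delta> + c) (\<lambda>x. int (m div p j) * \<phi> x)"
  using assms(1)[unfolded functions_computable_def, rule_format, where \<phi> = \<phi>, OF assms(2-5)] assms(6)
  by simp

text \<open>Interpolation reduces the claim to conjunctions of bits, one for each argument and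
  coordinate. The premise offers the bits at depth \<open>Suc \<delta>\<close>, so \<open>c\<close>
  has to include their layer of \<open>MOD\<close>-gates.\<close>

lemma functions_computableI:
  assumes "\<And>r j \<delta> bs. r \<le> R \<Longrightarrow> j < s \<Longrightarrow> length bs \<le> r * s \<Longrightarrow>
    (\<And>b. b \<in> set bs \<Longrightarrow> computable r (Suc \<delta>) (\<lambda>x. of_bool (b x))) \<Longrightarrow>
    computable r (\<delta> + c) (\<lambda>x. int (m div p j) * of_bool (\<forall>b\<in>set bs. b x))"
  shows "functions_computable R c"
  unfolding functions_computable_def
proof (intro allI impI)
  fix r j S \<delta> and \<phi> :: "(nat \<Rightarrow> nat \<Rightarrow> int) \<Rightarrow> int"
  assume rR: "r \<le> R" and j: "j < s" and S: "S \<subseteq> {..<s}" and D: "\<forall>i\<in>S. D i \<le> \<delta>"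
    and dep: "\<forall>x y. valid r x \<longrightarrow> valid r y \<longrightarrow> (\<forall>a<r. \<forall>i\<in>S. x a i = y a i) \<longrightarrow> \<phi> x = \<phi> y"
  let ?I = "{..<r} \<times> S"
  have fin: "finite ?I"
    using S finite_subset by blast
  obtain js where js: "set js = ?I" "distinct js"
    using finite_distinct_list[OF fin] by blast
  have "card ?I \<le> card ({..<r} \<times> {..<s})"
    using S by (intro card_mono) auto
  then have len: "length js \<le> r * s"
    using distinct_card[OF js(2)] js(1) by simp
  show "computable r (\<delta> + c) (\<lambda>x. int (m div p j) * \<phi> x)"
  proof (rule computable_function[OF fin])
    fix \<alpha> :: "nat \<times> nat \<Rightarrow> int"
    assume \<alpha>: "\<And>a j. (a, j) \<in> ?I \<Longrightarrow> 0 \<le> \<alpha> (a, j) \<and> \<alpha> (a, j) < int (p j)"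
    let ?bs = "map (\<lambda>(a, j) x. x a j = \<alpha> (a, j)) js"
    have "computable r (\<delta> + c) (\<lambda>x. int (m div p j) * of_bool (\<forall>b\<in>set ?bs. b x))"
    proof (rule assms[OF rR j])
      show "computable r (Suc \<delta>) (\<lambda>x. of_bool (b x))" if b: "b \<in> set ?bs" for b
      proof -
        obtain a i where "(a, i) \<in> ?I" "b = (\<lambda>x. x a i = \<alpha> (a, i))"
          using b js(1) by auto
        then show ?thesis
          using computable_coordinate_eq[of a r i \<delta> "\<alpha> (a, i)"] \<alpha>[of a i] S D by auto
      qed
    qed (simp add: len)
    moreover have "(\<forall>b\<in>set ?bs. b x) \<longleftrightarrow> (\<forall>(a, j)\<in>?I. x a j = \<alpha> (a, j))" for x
      using js(1) by auto
    ultimately show "computable r (\<delta> + c) (\<lambda>x. int (m div p j) * of_bool (\<forall>(a, j)\<in>?I. x a j = \<alpha> (a, j)))"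
      by (simp only:)
  next
    fix x y assume "valid r x" "valid r y" "\<forall>(a, i)\<in>?I. x a i = y a i"
    then show "\<phi> x = \<phi> y"
      by (intro dep[rule_format]) auto
  qed (use S in auto)
qed

text \<open>The bits take one layer, and a tree with at most \<open>R * s\<close> leaves takes
  \<open>t\<close> more.\<close>

lemma functions_computable_prime:
  assumes "R * s \<le> 2 ^ t"
  shows "functions_computable R (Suc t)"
proof (rule functions_computableI)
  fix r j \<delta> and bs :: "((nat \<Rightarrow> nat \<Rightarrow> int) \<Rightarrow> bool) list"
  assume *: "r \<le> R" "length bs \<le> r * s"
    "\<And>b. b \<in> set bs \<Longrightarrow> computable r (Suc \<delta>) (\<lambda>x. of_bool (b x))"
  have "r * s \<le> R * s" using *(1) by simp
  then have "length bs \<le> 2 ^ t" using *(2) assms by linarith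
  then show "computable r (\<delta> + Suc t) (\<lambda>x. int (m div p j) * of_bool (\<forall>b\<in>set bs. b x))"
    using computable_conj_tree[OF *(3), of bs t] by (intro computable_scale) simp
qed

text \<open>One layer for the bits and one for the hyperplanes; the auxiliary prime may depend on
  the coordinate.\<close>

lemma functions_computable_nonprime:
  assumes "\<And>j. j < s \<Longrightarrow> \<exists>r'. prime r' \<and> r' dvd m \<and> r' \<noteq> p j"
  shows "functions_computable R 2"
proof (rule functions_computableI)
  fix r j \<delta> and bs :: "((nat \<Rightarrow> nat \<Rightarrow> int) \<Rightarrow> bool) list"
  assume j: "j < s" and bs: "\<And>b. b \<in> set bs \<Longrightarrow> computable r (Suc \<delta>) (\<lambda>x. of_bool (b x))"
  obtain r' where "prime r'" "r' dvd m" "r' \<noteq> p j"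
    using assms[OF j] by blast
  then show "computable r (\<delta> + 2) (\<lambda>x. int (m div p j) * of_bool (\<forall>b\<in>set bs. b x))"
    using computable_conj_hyperplanes[OF prime_p[OF j] _ _ p_dvd_m[OF j] _ bs, of r'] by auto
qed

end

section \<open>Induction along the levels of the tower\<close>

primrec later_coordinates :: "nat set list \<Rightarrow> nat \<Rightarrow> nat" where
  "later_coordinates [] j = 0"
| "later_coordinates (J # Js) j = (if j \<in> J then card (\<Union>(set Js)) else later_coordinates Js j)"

lemma coordinate_level_module: "coordinate_level p J L \<Longrightarrow> module_equivalent L (Zprod p J)"
  by (simp add: coordinate_level_def)

lemma univ_coordinate_level: "coordinate_level p J L \<Longrightarrow> univ L = carrier (Zprod p J)"
  by (auto simp: coordinate_level_def module_equivalent_def polynomially_equivalent_def module_alg_def)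

text \<open>The strict inequality is the source of \<open>s - 1\<close> in the depth bound. Counting
  later coordinates instead of later blocks makes empty blocks free of charge.\<close>

lemma coordinate_tower_facts:
  "coordinate_tower p Js B \<Longrightarrow> finite (\<Union>(set Js)) \<and> (\<forall>j\<in>\<Union>(set Js). prime (p j)) \<and>
     univ B = carrier (Zprod p (\<Union>(set Js))) \<and> (\<forall>j\<in>\<Union>(set Js). later_coordinates Js j < card (\<Union>(set Js)))"
proof (induction p Js B rule: coordinate_tower.induct)
  case (2 p J B)
  then show ?case
    by (auto simp: coordinate_level_def card_gt_0_iff univ_coordinate_level)
next
  case (3 p J K Js B)
  let ?S = "\<Union>(set (K # Js))"
  obtain L U where "coordinate_level p J L" "coordinate_tower p (K # Js) U"
    "univ B = carrier (Zprod p (\<Union>(set (J # K # Js))))" and disj: "J \<inter> ?S = {}"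
    and "is_extension B L (Zprod p J) U (\<lambda>x. restrict x J) (\<lambda>x. restrict x ?S)"
    using 3(2) unfolding coordinate_tower.simps by blast
  moreover note 3(1)[OF this(2)]
  ultimately have IH: "finite J" "\<forall>j\<in>J. prime (p j)" "finite ?S" "\<forall>j\<in>?S. prime (p j)"
    "univ B = carrier (Zprod p (\<Union>(set (J # K # Js))))" "\<forall>j\<in>?S. later_coordinates (K # Js) j < card ?S"
    by (auto simp: coordinate_level_def)
  have un: "\<Union>(set (J # K # Js)) = J \<union> ?S" by simp
  have "later_coordinates (J # K # Js) j < card (J \<union> ?S)" if "j \<in> J \<union> ?S" for j
  proof (cases "j \<in> J")
    case True
    then have "card ?S < card (J \<union> ?S)"
      using disj IH(1,3) by (intro psubset_card_mono) auto
    then show ?thesis using True by simp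
  next
    case False
    then have "later_coordinates (J # K # Js) j < card ?S"
      using that IH(6) by simp
    also have "\<dots> \<le> card (J \<union> ?S)"
      using IH(1,3) by (intro card_mono) auto
    finally show ?thesis .
  qed
  then show ?case
    using IH un by (auto simp del: later_coordinates.simps)
qed simp

context modular_coordinates
begin

text \<open>The affine form consists of references, constant factors and sums, so it adds no depth.
  The primes in \<open>J\<close> coincide, hence the scaled references already carry the factor
  \<open>m div p j\<close> of the target.\<close>

lemma computable_level:
  assumes "coordinate_level p J L" and "J \<subseteq> {..<s}" and "\<And>i. i \<in> J \<Longrightarrow> D i \<le> \<delta>"
    and "f \<in> syms L" and "j \<in> J" and r: "r = ar L f"
  shows "computable r \<delta> (\<lambda>x. int (m div p j) * opr L f (map (\<lambda>a. restrict (x a) J) [0..<r]) j)"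
proof -
  have J: "finite J" "\<And>i. i \<in> J \<Longrightarrow> p i = p j"
    using assms(1,5) by (auto simp: coordinate_level_def)
  have j: "j < s" using assms(2,5) by auto
  obtain c k where ck: "\<And>x. (\<And>a i. a < r \<Longrightarrow> i \<in> J \<Longrightarrow> 0 \<le> x a i \<and> x a i < int (p j)) \<Longrightarrow>
    [opr L f (map (\<lambda>a. restrict (x a) J) [0..<r]) j = c + (\<Sum>(a, i)\<in>{..<r} \<times> J. k (a, i) * x a i)] (mod int (p j))"
    using level_affine[OF coordinate_level_module[OF assms(1)] J prime_gt_0_nat[OF prime_p[OF j]] assms(4) r assms(5)]
    by blast
  have "computable r \<delta> (\<lambda>x. int (m div p j) * c +
      (\<Sum>ai\<in>{..<r} \<times> J. k ai * (int (m div p (snd ai)) * x (fst ai) (snd ai))))"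
    using J(1) assms(2,3)
    by (intro computable_add computable_const computable_sum computable_scale computable_ref) auto
  then show ?thesis
  proof (rule computable_cong)
    fix x assume "valid r x"
    then have "[opr L f (map (\<lambda>a. restrict (x a) J) [0..<r]) j =
        c + (\<Sum>(a, i)\<in>{..<r} \<times> J. k (a, i) * x a i)] (mod int (p j))"
      using assms(2) J(2) by (intro ck) (fastforce simp: valid_def)
    then have "[int (m div p j) * opr L f (map (\<lambda>a. restrict (x a) J) [0..<r]) j =
        int (m div p j) * (c + (\<Sum>(a, i)\<in>{..<r} \<times> J. k (a, i) * x a i))] (mod int m)"
      unfolding m_div_p[OF j] by (rule cong_cmult_leftI)
    moreover have "int (m div p j) * (c + (\<Sum>(a, i)\<in>{..<r} \<times> J. k (a, i) * x a i)) =
       int (m div p j) * c + (\<Sum>ai\<in>{..<r} \<times> J. k ai * (int (m div p (snd ai)) * x (fst ai) (snd ai)))"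
      unfolding distrib_left sum_distrib_left
      by (intro arg_cong2[where f = "(+)"] refl sum.cong) (auto simp: J(2))
    ultimately show "[int (m div p j) * opr L f (map (\<lambda>a. restrict (x a) J) [0..<r]) j =
       int (m div p j) * c + (\<Sum>ai\<in>{..<r} \<times> J. k ai * (int (m div p (snd ai)) * x (fst ai) (snd ai)))] (mod int m)"
      by simp
  qed
qed

lemma restrict_in_tuples:
  assumes "valid r x" and "S \<subseteq> {..<s}" and "univ A = carrier (Zprod p S)"
  shows "map (\<lambda>a. restrict (x a) S) [0..<r] \<in> tuples (univ A) r"
proof -
  have "carrier (Zprod p S) = (\<Pi>\<^sub>E j\<in>S. {0..<int (p j)})"
    using assms(2) by (intro carrier_Zprod prime_gt_0_nat prime_p) auto
  then show ?thesis
    using assms(1,2) by (auto simp: tuples_def valid_def assms(3) restrict_PiE_iff)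
qed

text \<open>Coordinates in \<open>S\<close> belong to \<open>U\<close> and keep its bounds. Those in
  \<open>J\<close> combine an affine form of coordinates with the same bound and the correction
  \<open>h\<close>, which depends on \<open>S\<close> alone.\<close>

lemma computable_tower:
  assumes "coordinate_tower p Js B" and "\<Union>(set Js) \<subseteq> {..<s}"
    and "\<And>j. j \<in> \<Union>(set Js) \<Longrightarrow> D j = c * later_coordinates Js j"
    and "functions_computable R c" and "f \<in> syms B" and "ar B f \<le> R" and "j \<in> \<Union>(set Js)"
  shows "computable (ar B f) (D j)
    (\<lambda>x. int (m div p j) * opr B f (map (\<lambda>a. restrict (x a) (\<Union>(set Js))) [0..<ar B f]) j)"
  using assms
proof (induction Js arbitrary: B j)
  case (Cons J Js)
  show ?case
  proof (cases Js)
    case Nil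
    then have un: "\<Union>(set (J # Js)) = J" by simp
    show ?thesis
      unfolding un using Cons.prems(1-3,5,7) Nil by (intro computable_level) auto
  next
    case (Cons K Ks)
    define S where "S = \<Union>(set Js)"
    have un: "\<Union>(set (J # Js)) = J \<union> S" by (simp add: S_def)
    note prems = Cons.prems[unfolded un]
    obtain L U where L: "coordinate_level p J L" and U: "coordinate_tower p Js U"
      and ext: "is_extension B L (Zprod p J) U (\<lambda>x. restrict x J) (\<lambda>x. restrict x S)"
      and disj: "J \<inter> S = {}" and univB: "univ B = carrier (Zprod p (J \<union> S))"
      using prems(1) un by (auto simp: Cons S_def)
    let ?r = "ar B f"
    have sig: "f \<in> syms L" "f \<in> syms U" "ar L f = ?r" "ar U f = ?r"
      using ext prems(5) by (auto simp: is_extension_def same_signature_def)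
    have JS: "J \<subseteq> {..<s}" "S \<subseteq> {..<s}" using prems(2) by auto
    obtain h where h: "h \<in> tuples (univ U) ?r \<rightarrow> univ L"
      and opr: "\<And>xs. xs \<in> tuples (univ B) ?r \<Longrightarrow>
        restrict (opr B f xs) J = opr L f (map (\<lambda>x. restrict x J) xs) \<otimes>\<^bsub>Zprod p J\<^esub> h (map (\<lambda>x. restrict x S) xs) \<and>
        restrict (opr B f xs) S = opr U f (map (\<lambda>x. restrict x S) xs)"
      using ext prems(5) by (auto simp: is_extension_def)
    let ?xs = "\<lambda>T x. map (\<lambda>a. restrict (x a) T) [0..<?r]"
    have xs: "map (\<lambda>x. restrict x J) (?xs (J \<union> S) x) = ?xs J x"
      "map (\<lambda>x. restrict x S) (?xs (J \<union> S) x) = ?xs S x" for x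
      by (simp_all add: Int_absorb1 Un_Int_eq)
    have tup: "?xs (J \<union> S) x \<in> tuples (univ B) ?r" if "valid ?r x" for x
      using restrict_in_tuples[OF that _ univB] JS by blast
    show ?thesis
    proof (cases "j \<in> S")
      case True
      have "computable ?r (D j) (\<lambda>x. int (m div p j) * opr U f (?xs S x) j)"
        unfolding sig(4)[symmetric] S_def
      proof (rule Cons.IH[OF U _ _ prems(4) sig(2)])
        show "D j = c * later_coordinates Js j" if "j \<in> \<Union>(set Js)" for j
          using prems(3)[of j] that disj by (auto simp: S_def)
      qed (use JS True prems(6) sig(4) in \<open>auto simp: S_def\<close>)
      then show ?thesis
        unfolding un
      proof (rule computable_cong)
        fix x assume v: "valid ?r x"
        have "restrict (opr B f (?xs (J \<union> S) x)) S j = opr U f (?xs S x) j"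
          using opr[OF tup[OF v]] unfolding xs by (simp only:)
        then have "opr B f (?xs (J \<union> S) x) j = opr U f (?xs S x) j"
          using True by (simp only: restrict_apply')
        then show "[int (m div p j) * opr B f (?xs (J \<union> S) x) j = int (m div p j) * opr U f (?xs S x) j] (mod int m)"
          by simp
      qed
    next
      case False
      then have j: "j \<in> J" "j < s" using prems(7) JS by auto
      have D: "D i = c * card S" if "i \<in> J" for i
        using prems(3)[of i] that by (simp add: S_def)
      have lin: "computable ?r (D j) (\<lambda>x. int (m div p j) * opr L f (?xs J x) j)"
        using D j(1) by (intro computable_level[OF L JS(1) _ sig(1) j(1)]) (auto simp: sig)
      note Ufacts = coordinate_tower_facts[OF U, folded S_def]
      have hdep: "h (?xs S x) j = h (?xs S y) j" if "\<forall>a<?r. \<forall>i\<in>S. x a i = y a i" for x y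
        using that by (intro arg_cong[where f = "\<lambda>u. h u j"] map_cong refl restrict_ext) auto
      have nonlin: "computable ?r (D j) (\<lambda>x. int (m div p j) * h (?xs S x) j)"
      proof (cases "S = {}")
        case True
        then have const: "h (?xs S x) j = h (?xs S (\<lambda>_ _. 0)) j" for x
          by (intro hdep) auto
        show ?thesis
        proof (rule computable_cong[OF computable_const])
          show "[int (m div p j) * h (?xs S x) j = int (m div p j) * h (?xs S (\<lambda>_ _. 0)) j] (mod int m)" for x
            by (simp only: const[of x] cong_refl)
        qed
      next
        case False
        then have card: "card S > 0"
          using Ufacts by (auto simp: card_gt_0_iff)
        have "D i \<le> c * (card S - 1)" if "i \<in> S" for i
        proof -
          have "D i = c * later_coordinates Js i"
            using prems(3)[of i] that disj by (auto simp: S_def)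
          also have "\<dots> \<le> c * (card S - 1)"
            using Ufacts that by (intro mult_left_mono) force+
          finally show ?thesis .
        qed
        \<comment> \<open>All of \<open>S\<close> lies at depth at most
          \<open>c * (card S - 1)\<close>; one arbitrary function on top of it leads to
          \<open>c * card S\<close>, just the bound allotted to \<open>J\<close>.\<close>
        then have "computable ?r (c * (card S - 1) + c) (\<lambda>x. int (m div p j) * h (?xs S x) j)"
          by (rule functions_computableD[OF prems(4,6) j(2) JS(2) _ hdep])
        moreover have "c * (card S - 1) + c = D j"
          using card D[OF j(1)] by (cases "card S") auto
        ultimately show ?thesis by simp
      qed
      show ?thesis
        unfolding un
      proof (rule computable_cong[OF computable_add[OF lin nonlin]])
        fix x assume v: "valid ?r x"
        have "restrict (opr B f (?xs (J \<union> S) x)) J j =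
            (opr L f (?xs J x) \<otimes>\<^bsub>Zprod p J\<^esub> h (?xs S x)) j"
          using opr[OF tup[OF v]] unfolding xs by (simp only:)
        then have "opr B f (?xs (J \<union> S) x) j = (opr L f (?xs J x) j + h (?xs S x) j) mod int (p j)"
          using j(1) by (simp only: restrict_apply' mult_Zprod)
        then have "[opr B f (?xs (J \<union> S) x) j = opr L f (?xs J x) j + h (?xs S x) j] (mod int (p j))"
          by simp
        then have "[int (m div p j) * opr B f (?xs (J \<union> S) x) j =
            int (m div p j) * (opr L f (?xs J x) j + h (?xs S x) j)] (mod int m)"
          unfolding m_div_p[OF j(2)] by (rule cong_cmult_leftI)
        then show "[int (m div p j) * opr B f (?xs (J \<union> S) x) j =
            int (m div p j) * opr L f (?xs J x) j + int (m div p j) * h (?xs S x) j] (mod int m)"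
          by (simp add: distrib_left)
      qed
    qed
  qed
qed simp

end

section \<open>Coordinatised algebras\<close>

context modular_coordinates
begin

lemma scaled_coordinate_bounds:
  assumes "j < s" and "0 \<le> v" and "v < int (p j)"
  shows "int (m div p j) * v \<in> {0..<int m}"
proof -
  have "int (m div p j) * v < int (m div p j) * int (p j)"
    using assms m_div_p_pos[OF assms(1)] by (intro mult_strict_left_mono) auto
  then show ?thesis
    using assms m_div_p[OF assms(1)] by simp
qed

lemma coordinates_in_PiE:
  assumes "coordinate_tower p Js B'" and "\<Union>(set Js) = {..<s}" and "alg_iso \<kappa> B B'" and "x \<in> univ B"
  shows "\<kappa> x \<in> (\<Pi>\<^sub>E j\<in>{..<s}. {0..<int (p j)})"
proof -
  have "\<kappa> x \<in> univ B'"
    using assms(3,4) by (auto simp: alg_iso_def dest: bij_betwE)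
  also have "univ B' = carrier (Zprod p {..<s})"
    using coordinate_tower_facts[OF assms(1)] assms(2) by simp
  also have "\<dots> = (\<Pi>\<^sub>E j\<in>{..<s}. {0..<int (p j)})"
    by (intro carrier_Zprod prime_gt_0_nat prime_p) simp
  finally show ?thesis .
qed

text \<open>Transport along \<open>\<kappa>\<close>. The final reduction modulo \<open>m\<close> has
  no effect because a scaled coordinate is already a residue.\<close>

lemma computable_operation:
  assumes tower: "coordinate_tower p Js B'" "\<Union>(set Js) = {..<s}" and iso: "alg_iso \<kappa> B B'" and "is_alg B"
    and D: "\<And>j. j < s \<Longrightarrow> D j = c * later_coordinates Js j"
    and "functions_computable R c" and f: "f \<in> syms B" "ar B f \<le> R" and j: "j < s"
  shows "\<exists>e. expr_ok m 0 (ar B f) s e \<and> expr_val depth_sem (\<lambda>_. 0) (\<lambda>_. D) e \<le> D j \<and>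
    (\<forall>xs\<in>tuples (univ B) (ar B f).
      expr_val (cc_sem m) (\<lambda>_. 0) (\<lambda>a j. int (m div p j) * \<kappa> (xs ! a) j) e =
      int (m div p j) * \<kappa> (opr B f xs) j)"
proof -
  let ?r = "ar B f"
  have f': "f \<in> syms B'" "ar B' f = ?r"
    using iso f by (auto simp: alg_iso_def same_signature_def)
  note univ = coordinates_in_PiE[OF tower iso]
  have "computable ?r (D j)
    (\<lambda>x. int (m div p j) * opr B' f (map (\<lambda>a. restrict (x a) {..<s}) [0..<?r]) j)"
    using computable_tower[OF tower(1) _ _ assms(6) f'(1), of j] tower(2) D f j f'(2) by simp
  then obtain e where e: "expr_ok m 0 ?r s e" "expr_val depth_sem (\<lambda>_. 0) (\<lambda>_. D) e \<le> D j"
    "\<And>x. valid ?r x \<Longrightarrow> expr_val (cc_sem m) (\<lambda>_. 0) (\<lambda>a j. int (m div p j) * x a j) e =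
      (int (m div p j) * opr B' f (map (\<lambda>a. restrict (x a) {..<s}) [0..<?r]) j) mod int m"
    unfolding computable_def by blast
  have "expr_val (cc_sem m) (\<lambda>_. 0) (\<lambda>a j. int (m div p j) * \<kappa> (xs ! a) j) e =
      int (m div p j) * \<kappa> (opr B f xs) j"
    if xs: "xs \<in> tuples (univ B) ?r" for xs
  proof -
    have cl: "opr B f xs \<in> univ B"
      using assms(4) f(1) xs by (auto simp: is_alg_def)
    have in_univ: "xs ! a \<in> univ B" if "a < ?r" for a
      using xs that by (auto simp: tuples_def)
    have "valid ?r (\<lambda>a. \<kappa> (xs ! a))"
      using univ[OF in_univ] by (fastforce simp: valid_def PiE_iff)
    then have "expr_val (cc_sem m) (\<lambda>_. 0) (\<lambda>a j. int (m div p j) * \<kappa> (xs ! a) j) e =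
      (int (m div p j) * opr B' f (map (\<lambda>a. restrict (\<kappa> (xs ! a)) {..<s}) [0..<?r]) j) mod int m"
      by (rule e(3))
    also have "map (\<lambda>a. restrict (\<kappa> (xs ! a)) {..<s}) [0..<?r] = map \<kappa> xs"
    proof (rule nth_equalityI)
      show "length (map (\<lambda>a. restrict (\<kappa> (xs ! a)) {..<s}) [0..<?r]) = length (map \<kappa> xs)"
        using xs by (simp add: tuples_def)
      fix a assume "a < length (map (\<lambda>a. restrict (\<kappa> (xs ! a)) {..<s}) [0..<?r])"
      then have a: "a < ?r" by simp
      have "restrict (\<kappa> (xs ! a)) {..<s} = \<kappa> (xs ! a)"
        by (rule PiE_restrict[OF univ[OF in_univ[OF a]]])
      then show "map (\<lambda>a. restrict (\<kappa> (xs ! a)) {..<s}) [0..<?r] ! a = map \<kappa> xs ! a"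
        using a xs by (simp add: tuples_def)
    qed
    also have "opr B' f (map \<kappa> xs) = \<kappa> (opr B f xs)"
      using iso f(1) xs by (simp add: alg_iso_def)
    also have "(int (m div p j) * \<kappa> (opr B f xs) j) mod int m = int (m div p j) * \<kappa> (opr B f xs) j"
      using scaled_coordinate_bounds[OF j, of "\<kappa> (opr B f xs) j"] PiE_mem[OF univ[OF cl], of j] j by simp
    finally show ?thesis .
  qed
  then show ?thesis using e(1,2) by blast
qed

lemma circuit_translation:
  fixes B :: "('a, 'j) alg"
  assumes tower: "coordinate_tower p Js B'" "\<Union>(set Js) = {..<s}" and iso: "alg_iso \<kappa> B B'"
    and fin: "finite_alg B" and s: "s > 0"
    and D: "\<And>j. j < s \<Longrightarrow> D j = c * later_coordinates Js j"
    and fc: "functions_computable (max_arity B) c" and d: "d = c * (s - 1)"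
  shows "\<exists>F :: ('a, 'j) alg_label circuit \<Rightarrow> cc_label circuit.
        (\<forall>C. circuit_over B C \<longrightarrow>
           cc_circuit m (F C) \<and> ninputs (F C) = s * ninputs C \<and> length (outs (F C)) = s \<and>
           essential_depth (F C) = d \<and>
           (\<forall>xs\<in>tuples (univ B) (ninputs C).
              run_circuit (cc_sem m) (F C) (concat (map (embed m s p \<kappa>) xs)) =
              embed m s p \<kappa> (hd (run_circuit (alg_sem B) C xs)))) \<and>
        (\<forall>\<nu>. inj_on \<nu> (alg_labels B) \<longrightarrow>
           linear_time_computable {C. circuit_over B C} (encode_circuit \<nu>) (encode_circuit cc_code) F)"
proof -
  have R: "ar B f \<le> max_arity B" if "f \<in> syms B" for f
    using fin that by (auto simp: max_arity_def finite_alg_def)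
  have closed: "opr B f xs \<in> univ B" if "f \<in> syms B" "xs \<in> tuples (univ B) (ar B f)" for f xs
    using fin that by (auto simp: finite_alg_def is_alg_def)
  define good where "good f j e \<longleftrightarrow> expr_ok m 0 (ar B f) s e \<and>
    expr_val depth_sem (\<lambda>_. 0) (\<lambda>_. D) e \<le> D j \<and>
    (\<forall>xs\<in>tuples (univ B) (ar B f).
      expr_val (cc_sem m) (\<lambda>_. 0) (\<lambda>a j. int (m div p j) * \<kappa> (xs ! a) j) e =
      int (m div p j) * \<kappa> (opr B f xs) j)" for f j e
  have "\<exists>e. good f j e" if "f \<in> syms B" "j < s" for f j
    unfolding good_def
    by (rule computable_operation[OF tower iso _ D fc that(1) R[OF that(1)] that(2)])
      (use fin in \<open>auto simp: finite_alg_def\<close>)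
  \<comment> \<open>The expressions are fixed per symbol and coordinate before any circuit is given,
    so that a single program can have them built in.\<close>
  then obtain E where E: "\<And>f j. f \<in> syms B \<Longrightarrow> j < s \<Longrightarrow> good f j (E f j)"
    by metis
  define ES where "ES l j = (case l of Const a \<Rightarrow> ELit (int (m div p j) * \<kappa> a j) | Basic f \<Rightarrow> E f j)" for l j
  define art where "art l = (case l of Const a \<Rightarrow> 0 | Basic f \<Rightarrow> ar B f)" for l :: "('a, 'j) alg_label"
  have fin_labels: "finite (alg_labels B)"
    using fin by (auto simp: alg_labels_def finite_alg_def)
  obtain M0 where M0: "\<And>l j. l \<in> alg_labels B \<Longrightarrow> j < s \<Longrightarrow> esize (ES l j) \<le> M0"
  proof -
    have "finite ((\<lambda>(l, j). esize (ES l j)) ` (alg_labels B \<times> {..<s}))"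
      using fin_labels by simp
    then show ?thesis
      by (intro that[of "Max ((\<lambda>(l, j). esize (ES l j)) ` (alg_labels B \<times> {..<s}))"] Max_ge) force+
  qed
  \<comment> \<open>Room for the largest expression and for the chain of length \<open>d\<close>;
    the extra 1 ensures \<open>d < M\<close> for input gates.\<close>
  define M where "M = M0 + d + 1"
  define F where "F = translate_circuit d M s ES"
  have \<kappa>: "\<kappa> x j \<in> {0..<int (p j)}" if "x \<in> univ B" "j < s" for x j
    using PiE_mem[OF coordinates_in_PiE[OF tower iso that(1)], of j] that(2) by simp
  have Const_ok: "int (m div p j) * \<kappa> a j \<in> {0..<int m}" if "a \<in> univ B" "j < s" for a j
    using scaled_coordinate_bounds[OF that(2)] \<kappa>[OF that] by simp
  have Dd: "D j \<le> d" if "j < s" for j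
  proof -
    have "later_coordinates Js j < s"
      using coordinate_tower_facts[OF tower(1)] tower(2) that by simp
    then show ?thesis
      unfolding D[OF that] d by (intro mult_left_mono) auto
  qed
  have label: "l \<in> alg_labels B \<and> length ws = art l" "\<forall>w\<in>set ws. w < i"
    if C: "circuit_over B C" "i < length (gates C)" "gates C ! i = Gate l ws" for C i l ws
  proof -
    have "alg_label_ok B l (length ws) \<and> (\<forall>w\<in>set ws. w < i)"
      using C unfolding circuit_over_def wf_circuit_def by (auto dest!: spec[of _ i])
    then show "l \<in> alg_labels B \<and> length ws = art l" "\<forall>w\<in>set ws. w < i"
      by (cases l; auto simp: alg_labels_def art_def)+
  qed
  have ok: "expr_ok m 0 (art l) s (ES l j)" if "l \<in> alg_labels B" "j < s" for l j
    using that E Const_ok by (auto simp: alg_labels_def ES_def art_def good_def)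
  have tr: "translatable m d M s ES i (gates C ! i)" if "circuit_over B C" "i < length (gates C)" for C i
    using label[OF that] ok M0 by (fastforce simp: translatable_def M_def split: gate.split)
  have label': "l \<in> alg_labels B \<and> length ws = art l" if "circuit_over B C" "Gate l ws \<in> set (gates C)" for C l ws
    using label(1)[OF that(1)] that(2) by (metis in_set_conv_nth)
  have outs: "\<exists>w. outs C = [w] \<and> w < length (gates C)" if "circuit_over B C" for C
    using that by (auto simp: circuit_over_def wf_circuit_def length_Suc_conv)
  have "cc_circuit m (F C) \<and> ninputs (F C) = s * ninputs C \<and> length (outs (F C)) = s \<and>
      essential_depth (F C) = d \<and>
      (\<forall>xs\<in>tuples (univ B) (ninputs C).
        run_circuit (cc_sem m) (F C) (concat (map (embed m s p \<kappa>) xs)) =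
        embed m s p \<kappa> (hd (run_circuit (alg_sem B) C xs)))" if C: "circuit_over B C" for C
  proof (intro conjI ballI)
    obtain w where w: "outs C = [w]" "w < length (gates C)"
      using outs[OF C] by blast
    show "cc_circuit m (F C)"
      unfolding F_def using C w
      by (intro translate_circuit_wf[OF tr[OF C]]) (auto simp: circuit_over_def M_def)
    show "ninputs (F C) = s * ninputs C" "length (outs (F C)) = s"
      by (simp_all add: F_def translate_circuit_def)
    show "essential_depth (F C) = d"
      unfolding F_def
    proof (rule translate_essential_depth[OF tr[OF C] _ s Dd])
      show "expr_val depth_sem (\<lambda>_. 0) (\<lambda>_. D) (ES l j) \<le> D j"
        if "Gate l ws \<in> set (gates C)" "j < s" for l ws j
        using label'[OF C that(1)] E that(2)
        by (auto simp: alg_labels_def ES_def good_def depth_sem_def)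
    qed (use w in auto)
    fix xs assume xs: "xs \<in> tuples (univ B) (ninputs C)"
    let ?inp' = "(!) (concat (map (embed m s p \<kappa>) xs))"
    define emb where "emb x j = int (m div p j) * \<kappa> x j" for x j
    have embed: "embed m s p \<kappa> x = map (emb x) [0..<s]" for x
      by (simp add: embed_def emb_def)
    have inputs: "k < length xs" if k: "Input k \<in> set (gates C)" for k
    proof -
      obtain i where "i < length (gates C)" "gates C ! i = Input k"
        using k by (auto simp: in_set_conv_nth)
      then have "k < ninputs C"
        using C unfolding circuit_over_def wf_circuit_def by (auto dest!: spec[of _ i])
      then show ?thesis using xs by (simp add: tuples_def)
    qed
    have len: "length ys = s" if "ys \<in> set (map (embed m s p \<kappa>) xs)" for ys
      using that by (auto simp: embed)
    let ?u = "gate_values (alg_sem B) ((!) xs) (gates C)"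
    have "?u ! w \<in> univ B \<and> (\<forall>j<s. gate_values (cc_sem m) ?inp' (translate d M s ES 0 (gates C)) !
        (w * (s * M) + (j * M + (M - 1))) = emb (?u ! w) j)"
    proof (rule translate_correct[OF tr[OF C] _ _ _ _ w(2)])
      show "?inp' (s * k + j) = emb (xs ! k) j" if "Input k \<in> set (gates C)" "j < s" for k j
        using nth_concat_uniform[where xss = "map (embed m s p \<kappa>) xs" and i = k and j = j, OF len] inputs[OF that(1)] that(2) by (simp add: embed)
      show "xs ! k \<in> univ B" if "Input k \<in> set (gates C)" for k
        using inputs[OF that] xs by (auto simp: tuples_def)
      fix l ws and vs :: "'a list"
      assume vs: "Gate l ws \<in> set (gates C)" "length vs = length ws" "set vs \<subseteq> univ B"
      have l: "l \<in> alg_labels B" "vs \<in> tuples (univ B) (art l)"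
        using label'[OF C vs(1)] vs(2,3) by (auto simp: tuples_def)
      then show "alg_sem B l vs \<in> univ B"
        using closed by (auto simp: alg_labels_def art_def)
      show "expr_val (cc_sem m) (\<lambda>_. 0) (\<lambda>a. emb (vs ! a)) (ES l j) = emb (alg_sem B l vs) j"
        if "j < s" for j
        using l E that by (auto simp: alg_labels_def art_def ES_def good_def emb_def[abs_def])
    qed
    then show "run_circuit (cc_sem m) (F C) (concat (map (embed m s p \<kappa>) xs)) =
        embed m s p \<kappa> (hd (run_circuit (alg_sem B) C xs))"
      using w by (simp add: run_circuit_def F_def translate_circuit_def embed)
  qed
  moreover have "linear_time_computable {C. circuit_over B C} (encode_circuit \<nu>) (encode_circuit cc_code) F"
    if "inj_on \<nu> (alg_labels B)" for \<nu>
    unfolding F_def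
    by (rule translate_linear_time[OF fin_labels that, where m = m and art = art])
      (use tr label' in \<open>auto dest!: outs\<close>)
  ultimately show ?thesis by blast
qed

end

theorem proposition3p5:
  fixes A :: "('a, 'i) alg" and B :: "('a, 'j) alg" and z :: 'a
    and s m :: nat and p :: "nat \<Rightarrow> nat" and \<kappa> :: "'a \<Rightarrow> nat \<Rightarrow> int"
  assumes "finite_alg A" and "nilpotent A" and "z \<in> univ A"
    and "coordinatised_extension A z B s p \<kappa>"
    and "m = \<Prod>(prime_factors (card (univ A)))" and "m > 2"
  shows "\<exists>d :: nat.
     real d \<le> (real_of_int \<lceil>log 2 (real (s * max_arity B))\<rceil> + 1) * (log 2 (real (card (univ A))) - 1) \<and>
     (\<not> prime m \<longrightarrow> real d \<le> 3 * (log 2 (real (card (univ A))) - 1)) \<and>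
     (\<exists>F :: ('a, 'j) alg_label circuit \<Rightarrow> cc_label circuit.
        (\<forall>C. circuit_over B C \<longrightarrow>
           cc_circuit m (F C) \<and> ninputs (F C) = s * ninputs C \<and> length (outs (F C)) = s \<and>
           essential_depth (F C) = d \<and>
           (\<forall>xs\<in>tuples (univ A) (ninputs C).
              run_circuit (cc_sem m) (F C) (concat (map (embed m s p \<kappa>) xs)) =
              embed m s p \<kappa> (hd (run_circuit (alg_sem B) C xs)))) \<and>
        (\<forall>\<nu>. inj_on \<nu> (alg_labels B) \<longrightarrow>
           linear_time_computable {C. circuit_over B C} (encode_circuit \<nu>) (encode_circuit cc_code) F))"
proof -
  obtain B' Js plus where fin: "finite_alg B" and univ: "univ B = univ A"
    and tower: "coordinate_tower p Js B'" "\<Union>(set Js) = {..<s}" and iso: "alg_iso \<kappa> B B'"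
    and plus: "plus \<in> syms B" "ar B plus = 2"
    using assms(4) unfolding coordinatised_extension_def by blast
  note facts = coordinate_tower_facts[OF tower(1), unfolded tower(2)]
  have prime_p: "prime (p j)" if "j < s" for j
    using facts that by auto
  define N where "N = card (univ A)"
  have N: "N = (\<Prod>j<s. p j)"
  proof -
    have "N = card (univ B')"
      using iso univ unfolding N_def alg_iso_def by (auto dest: bij_betw_same_card)
    also have "univ B' = (\<Pi>\<^sub>E j\<in>{..<s}. {0..<int (p j)})"
      using facts carrier_Zprod[of "{..<s}" p] prime_gt_0_nat[OF prime_p] by simp
    finally show ?thesis by (simp add: card_PiE)
  qed
  have N0: "N \<noteq> 0"
    unfolding N using prime_gt_0_nat[OF prime_p] by fastforce
  have m: "m = \<Prod>(prime_factors N)"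
    using assms(5) by (simp add: N_def)
  have p_in: "p j \<in> prime_factors N" if "j < s" for j
    using that prime_p N0 by (auto simp: in_prime_factors_iff N intro: dvd_prodI)
  have p_dvd: "q dvd m" if "q \<in> prime_factors N" for q
    unfolding m using that by (intro dvd_prodI) auto
  have s: "s > 0"
    using assms(6) m N by (cases s) auto
  \<comment> \<open>All \<open>s\<close> primes are at least 2, so \<open>2 ^ s \<le> N\<close>;
    this is where the number of coordinates becomes a logarithm.\<close>
  have log: "real (s - 1) \<le> log 2 (real N) - 1"
  proof -
    have "2 ^ s = (\<Prod>j<s. 2::nat)" by simp
    also have "\<dots> \<le> N"
      unfolding N using prime_ge_2_nat[OF prime_p] by (intro prod_mono) auto
    finally have "2 powr real s \<le> real N"
      by (simp add: powr_realpow)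
    then have "real s \<le> log 2 (real N)"
      using N0 by (simp add: le_log_iff)
    then show ?thesis using s by (simp add: of_nat_diff)
  qed
  let ?R = "max_arity B"
  \<comment> \<open>The addition is a basic operation of arity 2. Consequently \<open>?L\<close> is
    at least 1, and \<open>?L + 1\<close> also dominates the cost 2 of the case of a nonprime
    \<open>m\<close>.\<close>
  have R2: "?R \<ge> 2"
    using fin plus Max_ge[of "ar B ` syms B" "ar B plus"] by (auto simp: max_arity_def finite_alg_def)
  let ?L = "\<lceil>log 2 (real (s * ?R))\<rceil>"
  have sR: "s * ?R \<ge> 2"
    using s R2 mult_le_mono[of 1 s 2 ?R] by simp
  have L1: "?L \<ge> 1"
  proof -
    have "1 \<le> log 2 (real (s * ?R))"
      using sR s R2 by (subst le_log_iff) (auto simp del: of_nat_mult)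
    then show ?thesis by (simp add: le_ceiling_iff)
  qed
  have sRL: "s * ?R \<le> 2 ^ nat ?L"
  proof -
    have "log 2 (real (s * ?R)) \<le> real (nat ?L)"
      using L1 by (simp add: real_nat_ceiling_ge)
    then have "real (s * ?R) \<le> 2 powr real (nat ?L)"
      using s R2 by (subst (asm) log_le_iff) auto
    also have "\<dots> = real (2 ^ nat ?L)"
      by (simp add: powr_realpow)
    finally show ?thesis by (simp only: of_nat_le_iff)
  qed
  \<comment> \<open>A prime \<open>m\<close> needs a layer of bits and a tree of height
    \<open>nat ?L\<close>. Otherwise two layers suffice, which lies below both \<open>?L + 1\<close>
    and the claimed 3.\<close>
  define c where "c = (if prime m then Suc (nat ?L) else 2)"
  interpret modular_coordinates m s p "\<lambda>j. c * later_coordinates Js j"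
    by standard (use assms(6) prime_p p_dvd p_in in auto)
  have fc: "functions_computable ?R c"
  proof (cases "prime m")
    case True
    then show ?thesis
      using functions_computable_prime[of ?R "nat ?L"] sRL by (simp add: c_def mult.commute)
  next
    case False
    have "\<exists>r. prime r \<and> r dvd m \<and> r \<noteq> p j" if "j < s" for j
    proof (rule ccontr)
      assume *: "\<not> ?thesis"
      \<comment> \<open>Every prime factor of \<open>N\<close> divides \<open>m\<close>; if
        \<open>p j\<close> were the only prime divisor of \<open>m\<close>, the product
        \<open>m\<close> would be \<open>p j\<close> itself and thus prime.\<close>
      have "prime_factors N = {p j}"
        using * p_in[OF that] p_dvd by (auto simp: in_prime_factors_iff)
      then show False using False m prime_p[OF that] by simp
    qed
    then show ?thesis
      using False functions_computable_nonprime by (simp add: c_def)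
  qed
  define d where "d = c * (s - 1)"
  have log0: "0 \<le> log 2 (real N) - 1"
    using log s by (meson le_trans of_nat_0_le_iff order_trans)
  have bound: "real d \<le> k * (log 2 (real N) - 1)" if "real c \<le> k" for k
    unfolding d_def of_nat_mult using that log by (intro mult_mono) auto
  have general: "real d \<le> (real_of_int ?L + 1) * (log 2 (real N) - 1)"
    using L1 by (intro bound) (auto simp: c_def)
  have nonprime: "\<not> prime m \<longrightarrow> real d \<le> 3 * (log 2 (real N) - 1)"
    by (intro impI bound) (simp add: c_def)
  show ?thesis
    by (rule exI[of _ d], fold N_def, rule conjI[OF general conjI[OF nonprime]],
        rule circuit_translation[OF tower iso fin s refl fc d_def, unfolded univ])
qed

end
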